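(* For every dimension vector $\mathbf l\in\mathbb Z_{\ge0}^I$ one has $\rho^{\mathrm h}_{\mathbf l}\circ\Phi_W=\phi_W\circ\mathrm{tr}_{\mathbf l}[\mathrm h]$ as maps $(\mathrm{Sym}\,L)[\mathrm h]\to D_Q$, and $\mathrm{tr}_{\mathbf l}[\mathrm h]$ is a homomorphism of $\mathbf k[\mathrm h]$-algebras from $((\mathrm{Sym}\,L)[\mathrm h],*_{\mathrm h})$ to $\mathbf k[\mathrm h][\mathrm{Rep}_{\mathbf l}(\overline Q)]$ equipped with the usual Moyal product of the bivector $\pi$ on $\mathrm{Rep}_{\mathbf l}(\overline Q)$.
   Context: Let $\mathbf k$ be a field of characteristic $0$ and $Q$ a finite quiver with vertex set $I$. The double $\overline Q$ has edges $e,e^*$ for $e\in Q$, with $e^*$ the reverse of $e$, $(e^* )^*=e$; $*$ is edge reversal; $t(e),h(e)$ are tail and head. $[e,f]=1$ if $e\in Q,f=e^*$; $-1$ if $f\in Q,e=f^*$; $0$ otherwise. $L$ is the $\mathbf k$-space with basis the cyclic paths (necklaces) in $\overline Q$ up to rotation, including the trivial path at each vertex; paths $a_1a_2\cdots$ are written with $h(a_1)=t(a_2)$. $\mathrm{Sym}\,L$ (product $\&$) has basis the collections $P=P_1\&\cdots\&P_k\&v_1\&\cdots\&v_q$, $P_i=a_{i1}\cdots a_{il_i}$ necklaces of positive length, $v_s\in I$. Abstract edges: $X=\{(i,j)\}$, $\mathrm{pr}_X(i,j)=a_{ij}$, $(i,j)+1=(i,j+1)$ with $j$ modulo $l_i$.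 **Cutting and gluing.** Let $Z$ be the abstract edges of a collection, $J\subset Z$, $\phi:J\to J$ an involution taking each edge to one projecting to the reverse edge. Let $f(z)=z+1$ for $z\notin J$, $f(z)=\phi(z)+1$ for $z\in J$. The glued collection has one member per orbit of $f$: the necklace of the edges of the orbit not in $J$, in order, or the trivial path at the start vertex of any edge of the orbit if the orbit lies in $J$; original trivial paths are kept. **Product.** $P*_{\mathrm h}R=\sum_{(I_X,I_Y,\phi)}\frac{\mathrm h^{\#I_X}}{2^{\#I_X}}(-1)^{\#(I_Y\cap\mathrm{pr}_Y^{-1}(Q))}PR_{I_X,I_Y,\phi}$, over subsets $I_X\subset X,I_Y\subset Y$ of the abstract edges of $P,R$ and bijections $\phi:I_X\to I_Y$ with $\mathrm{pr}_Y\circ\phi=*\circ\mathrm{pr}_X$; $PR_{I_X,I_Y,\phi}$ is the result of cutting and gluing $P\&R$ along $I_X\sqcup I_Y$ with $\phi$ extended to an involution. **$A_{\mathrm h}$ and $\Phi_W$.** For a collection $P$ with $N$ abstract edges, a height assignment is a bijection $H:X\to\{1,\dots,N\}$, and $P_H$ is $P$ with edges labeled by heights (up to isomorphism). $A_{\mathrm h}$ is the $\mathbf k[\mathrm h]$-module generated by all $P_H$ with relations $P_H-P_{H'}=\mathrm h[\mathrm{pr}_X(x),\mathrm{pr}_X(y)]P''_{H''}$ whenever $H(y)=H(x)+1$; here $H'$ interchanges the heights of $x,y$, $P''$ is $P$ cut and glued along $\{x,y\}$, and $H''$ induces the same order as $H$ on the remaining edges. The product $P_HR_{H'}$ is $P\&R$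 with all heights of $R$ placed above those of $P$. $\Phi_W(P)=\frac1{N!}\sum_HP_H$ over all height assignments, extended $\mathbf k[\mathrm h]$-linearly. **Representations.** $\mathrm{Rep}_{\mathbf l}(\overline Q)$ is the space of tuples of matrices $(M_e)_{e\in\overline Q}$, with $M_e$ of size $l_{t(e)}\times l_{h(e)}$ (acting on row vectors). Its bivector is $\pi((M_e)_{ij},(M_f)_{kl})=\delta_{il}\delta_{jk}[e,f]$ on coordinate functions, and the Moyal product is $u*v=m\circ e^{\frac12\mathrm h\pi}(u\otimes v)$, with $m$ the commutative multiplication and $\pi$ acting on $u\otimes v$ as a constant-coefficient bidifferential operator. $\mathrm{tr}_{\mathbf l}:\mathrm{Sym}\,L\to\mathbf k[\mathrm{Rep}_{\mathbf l}(\overline Q)]$ is the commutative algebra homomorphism with $e_1\cdots e_m\mapsto\mathrm{tr}(M_{e_1}\cdots M_{e_m})$ and the trivial path at $i$ sent to $l_i$; $\mathrm{tr}_{\mathbf l}[\mathrm h]$ is its $\mathbf k[\mathrm h]$-linear extension. $D_Q$ is the $\mathbf k[\mathrm h]$-algebra of differential operators generated by the $(M_e)_{ij}$ and $-\mathrm h\frac{\partial}{\partial(M_e)_{ij}}$, $e\in Q$. Put $\iota(e)=M_e$ for $e\in Q$, and $\iota(e^* )_{ij}=-\mathrm h\frac{\partial}{\partial(M_e)_{ji}}$. $\phi_W:\mathbf k[\mathrm h][\mathrm{Rep}_{\mathbf l}(\overline Q)]\to D_Q$ is the symmetrization map sending a monomial in the coordinates $(M_e)_{ij}$, $e\in\overline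 Q$, to the average over all orderings of the product of the operators $\iota(e)_{ij}$. $\rho^{\mathrm h}_{\mathbf l}:A_{\mathrm h}\to D_Q$ sends $P_H$ to the sum, over assignments of matrix indices as in the product of traces $\prod_i\mathrm{tr}(\iota(a_{i1})\cdots\iota(a_{il_i}))$, of the products of the corresponding matrix entries multiplied (as operators) in order of increasing height from left to right, times $\prod_sl_{v_s}$. *)

theory Defs
  imports
    "HOL-Library.Poly_Mapping"
    "HOL-Library.Multiset"
    "HOL-Library.FuncSet"
    "HOL-Computational_Algebra.Polynomial"
    "HOL-Combinatorics.Combinatorics"
    "HOL-Algebra.Module"
    "Graph_Theory.Arc_Walk"
    "Jordan_Normal_Form.Matrix"
begin

section \<open>Quivers and their doubles\<close>

text \<open>
  A finite quiver is a \<^typ>\<open>('v, 'e) pre_digraph\<close> satisfying \<^const>\<open>fin_digraph\<close>, which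
  allows loops and multiple edges, and an empty vertex or edge set.  The edge \<open>e\<close> of the quiver
  appears in the double as \<open>Orig e\<close>, and \<open>e\<^sup>*\<close> is \<open>Star e\<close>.
\<close>

datatype 'e dedge = Orig 'e | Star 'e

fun rev_edge :: "'e dedge \<Rightarrow> 'e dedge" where
  "rev_edge (Orig e) = Star e"
| "rev_edge (Star e) = Orig e"

fun is_orig :: "'e dedge \<Rightarrow> bool" where
  "is_orig (Orig e) = True"
| "is_orig (Star e) = False"

definition double :: "('v, 'e) pre_digraph \<Rightarrow> ('v, 'e dedge) pre_digraph" where
  "double Q = \<lparr> verts = verts Q,
                arcs = Orig ` arcs Q \<union> Star ` arcs Q,
                tail = (\<lambda>a. case a of Orig e \<Rightarrow> tail Q e | Star e \<Rightarrow> head Q e),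
                head = (\<lambda>a. case a of Orig e \<Rightarrow> head Q e | Star e \<Rightarrow> tail Q e) \<rparr>"

definition bracket :: "'e dedge \<Rightarrow> 'e dedge \<Rightarrow> 'a::ring_1" where
  "bracket e f = (if is_orig e \<and> f = rev_edge e then 1
                  else if is_orig f \<and> e = rev_edge f then - 1 else 0)"


section \<open>Necklaces and collections of necklaces\<close>

lemma rotate_equivp: "equivp (\<lambda>xs ys :: 'x list. \<exists>n. ys = rotate n xs)"
proof (rule equivpI)
  show "reflp (\<lambda>xs ys :: 'x list. \<exists>n. ys = rotate n xs)"
    by (rule reflpI) (metis rotate0 id_apply)
  show "symp (\<lambda>xs ys :: 'x list. \<exists>n. ys = rotate n xs)"
  proof (rule sympI, elim exE)
    fix xs ys :: "'x list" and n assume "ys = rotate n xs"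
    then have "rotate (length xs - n mod length xs) ys
        = rotate (length xs - n mod length xs + n mod length xs) xs"
      by (metis rotate_conv_mod rotate_rotate)
    also have "\<dots> = xs"
      by (cases "xs = []") (simp_all add: rotate_id less_imp_le)
    finally show "\<exists>n. xs = rotate n ys" by metis
  qed
  show "transp (\<lambda>xs ys :: 'x list. \<exists>n. ys = rotate n xs)"
    by (rule transpI) (metis rotate_rotate)
qed

quotient_type 'x cyclic = "'x list" / "\<lambda>xs ys. \<exists>n. ys = rotate n xs"
  by (rule rotate_equivp)

datatype ('v, 'x) necklace = Triv 'v | Cyc "'x cyclic"

text \<open>
  A collection \<open>P\<^sub>1 & \<dots> & P\<^sub>k & v\<^sub>1 & \<dots> & v\<^sub>q\<close> is a multiset of necklaces.  It is presented by the
  list of words \<open>P\<^sub>i = a\<^sub>i\<^sub>1 \<dots> a\<^sub>i\<^sub>l\<close> and the list of the vertices \<open>v\<^sub>s\<close>; abstract edges are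
  attached to a presentation.  All indices start at \<open>0\<close>.
\<close>

type_synonym ('v, 'x) pres = "'x list list \<times> 'v list"

definition coll :: "('v, 'x) pres \<Rightarrow> ('v, 'x) necklace multiset" where
  "coll p = image_mset (\<lambda>w. Cyc (abs_cyclic w)) (mset (fst p)) + image_mset Triv (mset (snd p))"

definition present :: "('v, 'x) necklace multiset \<Rightarrow> ('v, 'x) pres" where
  "present P = (SOME p. coll p = P)"

definition valid_pres :: "('v, 'e) pre_digraph \<Rightarrow> ('v, 'e dedge) pres set" where
  "valid_pres Q = {(ws, vs). (\<forall>w\<in>set ws. w \<noteq> [] \<and> (\<exists>u. pre_digraph.awalk (double Q) u w u))
                             \<and> set vs \<subseteq> verts Q}"

definition abs_edges :: "'x list list \<Rightarrow> (nat \<times> nat) set" where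
  "abs_edges ws = {(i, j). i < length ws \<and> j < length (ws ! i)}"

definition pr :: "'x list list \<Rightarrow> nat \<times> nat \<Rightarrow> 'x" where
  "pr ws z = ws ! fst z ! snd z"

definition nxt :: "'x list list \<Rightarrow> nat \<times> nat \<Rightarrow> nat \<times> nat" where
  "nxt ws z = (fst z, Suc (snd z) mod length (ws ! fst z))"


section \<open>Cutting and gluing\<close>

text \<open>
  The function \<open>lab\<close> gives the labels of the edges in the result: it is \<open>pr ws\<close> in the product
  \<open>*\<^sub>h\<close>, and also records heights in the relations of \<open>A\<^sub>h\<close>.  The necklace of an orbit is read
  from an arbitrary element of the orbit.
\<close>

definition glue_step ::
    "'x list list \<Rightarrow> (nat \<times> nat) set \<Rightarrow> (nat \<times> nat \<Rightarrow> nat \<times> nat) \<Rightarrow> nat \<times> nat \<Rightarrow> nat \<times> nat" where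
  "glue_step ws J \<phi> z = (if z \<in> J then nxt ws (\<phi> z) else nxt ws z)"

definition orbit_necklace ::
    "('v, 'e) pre_digraph \<Rightarrow> 'e dedge list list \<Rightarrow> (nat \<times> nat) set
      \<Rightarrow> (nat \<times> nat \<Rightarrow> nat \<times> nat) \<Rightarrow> (nat \<times> nat \<Rightarrow> 'y) \<Rightarrow> (nat \<times> nat) set \<Rightarrow> ('v, 'y) necklace" where
  "orbit_necklace Q ws J \<phi> lab C =
    (let z = (SOME z. z \<in> C);
         zs = filter (\<lambda>x. x \<notin> J) (support (glue_step ws J \<phi>) z)
     in if zs = [] then Triv (tail (double Q) (pr ws z)) else Cyc (abs_cyclic (map lab zs)))"

definition cut_glue ::
    "('v, 'e) pre_digraph \<Rightarrow> ('v, 'e dedge) pres \<Rightarrow> (nat \<times> nat) set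
      \<Rightarrow> (nat \<times> nat \<Rightarrow> nat \<times> nat) \<Rightarrow> (nat \<times> nat \<Rightarrow> 'y) \<Rightarrow> ('v, 'y) necklace multiset" where
  "cut_glue Q p J \<phi> lab =
     image_mset (orbit_necklace Q (fst p) J \<phi> lab)
       (mset_set (orbit (glue_step (fst p) J \<phi>) ` abs_edges (fst p)))
     + image_mset Triv (mset (snd p))"


section \<open>The algebra \<open>(Sym L)[h]\<close> with the product \<open>*\<^sub>h\<close>\<close>

text \<open>
  \<open>k[h]\<close> is \<^typ>\<open>'k poly\<close>.  The free \<open>k[h]\<close>-module on a set of basis elements consists of the
  finitely supported functions from the basis to \<open>k[h]\<close>; for a basis of multisets the
  multiplication of \<^typ>\<open>'a \<Rightarrow>\<^sub>0 'b\<close> is the commutative product \<open>&\<close>.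
\<close>

type_synonym ('v, 'e, 'k) nalg = "('v, 'e dedge) necklace multiset \<Rightarrow>\<^sub>0 'k poly"

definition cst :: "'c \<Rightarrow> 'm::zero \<Rightarrow>\<^sub>0 'c::zero" where
  "cst c = Poly_Mapping.single 0 c"

definition symL :: "('v, 'e) pre_digraph \<Rightarrow> ('v, 'e, 'k::field_char_0) nalg set" where
  "symL Q = {F. Poly_Mapping.keys F \<subseteq> coll ` valid_pres Q}"

text \<open>
  In \<open>P & R\<close> the words of \<open>R\<close> come after the words of \<open>P\<close>, so that the abstract edge \<open>(i, j)\<close>
  of \<open>R\<close> becomes \<open>(k + i, j)\<close>, with \<open>k\<close> the number of words of \<open>P\<close>.
\<close>

definition star_pres ::
    "('v, 'e) pre_digraph \<Rightarrow> ('v, 'e dedge) pres \<Rightarrow> ('v, 'e dedge) pres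
      \<Rightarrow> ('v, 'e, 'k::field_char_0) nalg" where
  "star_pres Q p r =
    (let ws = fst p @ fst r;
         X = abs_edges (fst p);
         Y = (\<lambda>(i, j). (length (fst p) + i, j)) ` abs_edges (fst r)
     in \<Sum>(A, B, \<phi>) \<in> {(A, B, \<phi>). A \<subseteq> X \<and> B \<subseteq> Y \<and> \<phi> \<in> A \<rightarrow>\<^sub>E B \<and> bij_betw \<phi> A B
                                   \<and> (\<forall>x\<in>A. pr ws (\<phi> x) = rev_edge (pr ws x))}.
          Poly_Mapping.single
            (cut_glue Q (ws, snd p @ snd r) (A \<union> B)
               (\<lambda>z. if z \<in> A then \<phi> z else inv_into A \<phi> z) (pr ws))
            (monom ((- 1) ^ card {y \<in> B. is_orig (pr ws y)} / 2 ^ card A) (card A)))"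

definition star ::
    "('v, 'e) pre_digraph \<Rightarrow> ('v, 'e, 'k::field_char_0) nalg \<Rightarrow> ('v, 'e, 'k) nalg
      \<Rightarrow> ('v, 'e, 'k) nalg" where
  "star Q F G = (\<Sum>P\<in>Poly_Mapping.keys F. \<Sum>R\<in>Poly_Mapping.keys G.
      cst (Poly_Mapping.lookup F P * Poly_Mapping.lookup G R) * star_pres Q (present P) (present R))"

definition necklace_algebra ::
    "('v, 'e) pre_digraph \<Rightarrow> ('k::field_char_0 poly, ('v, 'e, 'k) nalg) module" where
  "necklace_algebra Q = \<lparr> carrier = symL Q, monoid.mult = star Q, one = 1,
                          zero = 0, add = (+), smult = (\<lambda>c F. cst c * F) \<rparr>"


section \<open>The module \<open>A\<^sub>h\<close> and the map \<open>\<Phi>\<^sub>W\<close>\<close>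

text \<open>
  As a height assignment is injective, a collection with heights is determined up to isomorphism
  by the multiset of cyclic words in the pairs (edge, height).
\<close>

type_synonym ('v, 'e, 'k) hmod = "('v, 'e dedge \<times> nat) necklace multiset \<Rightarrow>\<^sub>0 'k poly"

definition heights :: "'x list list \<Rightarrow> (nat \<times> nat \<Rightarrow> nat) set" where
  "heights ws = {H \<in> abs_edges ws \<rightarrow>\<^sub>E {1..card (abs_edges ws)}.
                   bij_betw H (abs_edges ws) {1..card (abs_edges ws)}}"

definition with_heights ::
    "('v, 'x) pres \<Rightarrow> (nat \<times> nat \<Rightarrow> nat) \<Rightarrow> ('v, 'x \<times> nat) necklace multiset" where
  "with_heights p H =
     coll (map (\<lambda>i. map (\<lambda>j. (fst p ! i ! j, H (i, j))) [0..<length (fst p ! i)])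
             [0..<length (fst p)], snd p)"

definition free_hmod :: "('v, 'e) pre_digraph \<Rightarrow> ('v, 'e, 'k::field_char_0) hmod set" where
  "free_hmod Q = {F. Poly_Mapping.keys F \<subseteq> {with_heights p H | p H. p \<in> valid_pres Q \<and> H \<in> heights (fst p)}}"

text \<open>
  If the bracket vanishes, the collection obtained by cutting and gluing along \<open>{x, y}\<close> is
  meaningless, but it is multiplied by \<open>0\<close>.
\<close>

definition hrelations :: "('v, 'e) pre_digraph \<Rightarrow> ('v, 'e, 'k::field_char_0) hmod set" where
  "hrelations Q =
    {Poly_Mapping.single (with_heights p H) 1
       - Poly_Mapping.single (with_heights p (H(x := H y, y := H x))) 1
       - Poly_Mapping.single
           (cut_glue Q p {x, y} (transpose x y)
              (\<lambda>z. (pr (fst p) z, card {w \<in> abs_edges (fst p) - {x, y}. H w \<le> H z})))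
           (monom (bracket (pr (fst p) x) (pr (fst p) y)) 1)
     | p H x y. p \<in> valid_pres Q \<and> H \<in> heights (fst p)
         \<and> x \<in> abs_edges (fst p) \<and> y \<in> abs_edges (fst p) \<and> H y = H x + 1}"

definition hcong ::
    "('v, 'e) pre_digraph \<Rightarrow> (('v, 'e, 'k::field_char_0) hmod \<times> ('v, 'e, 'k) hmod) set" where
  "hcong Q = {(F, G). F \<in> free_hmod Q \<and> G \<in> free_hmod Q
                \<and> F - G \<in> Modules.module.span (\<lambda>c F. cst c * F) (hrelations Q)}"

definition A_h :: "('v, 'e) pre_digraph \<Rightarrow> ('v, 'e, 'k::field_char_0) hmod set set" where
  "A_h Q = free_hmod Q // hcong Q"

definition \<Phi>\<^sub>W ::
    "('v, 'e) pre_digraph \<Rightarrow> ('v, 'e, 'k::field_char_0) nalg \<Rightarrow> ('v, 'e, 'k) hmod set" where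
  "\<Phi>\<^sub>W Q F = hcong Q ``
     {\<Sum>P\<in>Poly_Mapping.keys F. let p = present P in
        cst (Polynomial.smult (1 / fact (card (abs_edges (fst p)))) (Poly_Mapping.lookup F P))
          * (\<Sum>H\<in>heights (fst p). Poly_Mapping.single (with_heights p H) 1)}"


section \<open>Functions on the representation space\<close>

text \<open>
  A coordinate \<open>(M\<^sub>e)\<^sub>i\<^sub>j\<close> is \<open>(e, i, j)\<close>, and polynomials over \<open>k[h]\<close> in variables from \<^typ>\<open>'x\<close>
  have type \<open>('x, 'k) kpoly\<close>.
\<close>

type_synonym ('x, 'k) kpoly = "('x \<Rightarrow>\<^sub>0 nat) \<Rightarrow>\<^sub>0 'k poly"

type_synonym 'e coord = "'e \<times> nat \<times> nat"

definition var :: "'x \<Rightarrow> ('x, 'k::field_char_0) kpoly" where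
  "var x = Poly_Mapping.single (Poly_Mapping.single x 1) 1"

definition pdiff :: "'x \<Rightarrow> ('x, 'k::field_char_0) kpoly \<Rightarrow> ('x, 'k) kpoly" where
  "pdiff x p = (\<Sum>m\<in>Poly_Mapping.keys p. Poly_Mapping.single (m - Poly_Mapping.single x 1)
                               (of_nat (Poly_Mapping.lookup m x) * Poly_Mapping.lookup p m))"

definition coords ::
    "('v, 'e) pre_digraph \<Rightarrow> ('v \<Rightarrow> nat) \<Rightarrow> 'e dedge coord set" where
  "coords Q l = {(a, i, j). a \<in> arcs (double Q)
                   \<and> i < l (tail (double Q) a) \<and> j < l (head (double Q) a)}"

definition rep_functions ::
    "('v, 'e) pre_digraph \<Rightarrow> ('v \<Rightarrow> nat) \<Rightarrow> ('e dedge coord, 'k::field_char_0) kpoly set" where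
  "rep_functions Q l = {u. \<forall>m\<in>Poly_Mapping.keys u. Poly_Mapping.keys m \<subseteq> coords Q l}"

definition bivector :: "'e dedge coord \<Rightarrow> 'e dedge coord \<Rightarrow> 'a::ring_1" where
  "bivector a b = (case (a, b) of ((e, i, j), (f, k, m)) \<Rightarrow>
                     if i = m \<and> j = k then bracket e f else 0)"

text \<open>\<open>bidiff Q l n u v\<close> is \<open>m (\<pi>\<^sup>n (u \<otimes> v))\<close>, where \<open>\<pi>\<close> is the sum of \<open>\<pi>(a, b) \<partial>\<^sub>a \<otimes> \<partial>\<^sub>b\<close>.\<close>

fun bidiff ::
    "('v, 'e) pre_digraph \<Rightarrow> ('v \<Rightarrow> nat) \<Rightarrow> nat \<Rightarrow> ('e dedge coord, 'k::field_char_0) kpoly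
      \<Rightarrow> ('e dedge coord, 'k) kpoly \<Rightarrow> ('e dedge coord, 'k) kpoly" where
  "bidiff Q l 0 u v = u * v"
| "bidiff Q l (Suc n) u v =
     (\<Sum>a\<in>coords Q l. \<Sum>b\<in>coords Q l. bivector a b * bidiff Q l n (pdiff a u) (pdiff b v))"

text \<open>The exponential series has finitely many nonzero terms, as the derivatives of \<open>u\<close> of
  order above its degree vanish; \<^const>\<open>Sum_any\<close> is the sum of the nonzero terms.\<close>

definition moyal ::
    "('v, 'e) pre_digraph \<Rightarrow> ('v \<Rightarrow> nat) \<Rightarrow> ('e dedge coord, 'k::field_char_0) kpoly
      \<Rightarrow> ('e dedge coord, 'k) kpoly \<Rightarrow> ('e dedge coord, 'k) kpoly" where
  "moyal Q l u v = Sum_any (\<lambda>n. cst (monom (1 / (2 ^ n * fact n)) n) * bidiff Q l n u v)"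

definition moyal_algebra ::
    "('v, 'e) pre_digraph \<Rightarrow> ('v \<Rightarrow> nat)
      \<Rightarrow> ('k::field_char_0 poly, ('e dedge coord, 'k) kpoly) module" where
  "moyal_algebra Q l = \<lparr> carrier = rep_functions Q l, monoid.mult = moyal Q l, one = 1,
                         zero = 0, add = (+), smult = (\<lambda>c u. cst c * u) \<rparr>"

definition gen_mat ::
    "('v, 'e) pre_digraph \<Rightarrow> ('v \<Rightarrow> nat) \<Rightarrow> 'e dedge \<Rightarrow> ('e dedge coord, 'k::field_char_0) kpoly mat"
where
  "gen_mat Q l a = mat (l (tail (double Q) a)) (l (head (double Q) a)) (\<lambda>(i, j). var (a, i, j))"

definition mat_trace :: "'a::comm_monoid_add mat \<Rightarrow> 'a" where
  "mat_trace A = (\<Sum>i<dim_row A. A $$ (i, i))"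

fun tr_necklace ::
    "('v, 'e) pre_digraph \<Rightarrow> ('v \<Rightarrow> nat) \<Rightarrow> ('v, 'e dedge) necklace
      \<Rightarrow> ('e dedge coord, 'k::field_char_0) kpoly" where
  "tr_necklace Q l (Triv v) = of_nat (l v)"
| "tr_necklace Q l (Cyc c) =
     (let w = rep_cyclic c in
      mat_trace (foldr (\<lambda>a A. gen_mat Q l a * A) w (1\<^sub>m (l (tail (double Q) (hd w))))))"

definition tr ::
    "('v, 'e) pre_digraph \<Rightarrow> ('v \<Rightarrow> nat) \<Rightarrow> ('v, 'e, 'k::field_char_0) nalg
      \<Rightarrow> ('e dedge coord, 'k) kpoly" where
  "tr Q l F = (\<Sum>P\<in>Poly_Mapping.keys F. cst (Poly_Mapping.lookup F P) * (\<Prod>n\<in>#P. tr_necklace Q l n))"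


section \<open>Differential operators\<close>

text \<open>
  Differential operators are functions on \<open>('e coord, 'k) kpoly\<close>, with composition as product.
  They act on polynomials in all variables of the type, of which those in \<open>D\<^sub>Q\<close> involve only
  the coordinates \<open>(M\<^sub>e)\<^sub>i\<^sub>j\<close> with \<open>e\<close> in \<open>Q\<close>; the algebra generated is the same as in the
  endomorphisms of the polynomials in these coordinates.
\<close>

type_synonym ('e, 'k) oper = "('e coord, 'k) kpoly \<Rightarrow> ('e coord, 'k) kpoly"

fun \<iota> :: "'e dedge coord \<Rightarrow> ('e, 'k::field_char_0) oper" where
  "\<iota> (Orig e, i, j) = (\<lambda>p. var (e, i, j) * p)"
| "\<iota> (Star e, i, j) = (\<lambda>p. - (cst (monom 1 1) * pdiff (e, j, i) p))"

inductive_set D_Q ::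
    "('v, 'e) pre_digraph \<Rightarrow> ('v \<Rightarrow> nat) \<Rightarrow> ('e, 'k::field_char_0) oper set"
  for Q :: "('v, 'e) pre_digraph" and l :: "'v \<Rightarrow> nat" where
  one: "id \<in> D_Q Q l"
| coord: "\<lbrakk>e \<in> arcs Q; i < l (tail Q e); j < l (head Q e)\<rbrakk>
    \<Longrightarrow> (\<lambda>p. var (e, i, j) * p) \<in> D_Q Q l"
| deriv: "\<lbrakk>e \<in> arcs Q; i < l (tail Q e); j < l (head Q e)\<rbrakk>
    \<Longrightarrow> (\<lambda>p. - (cst (monom 1 1) * pdiff (e, i, j) p)) \<in> D_Q Q l"
| add: "\<lbrakk>D \<in> D_Q Q l; E \<in> D_Q Q l\<rbrakk> \<Longrightarrow> (\<lambda>p. D p + E p) \<in> D_Q Q l"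
| smult: "D \<in> D_Q Q l \<Longrightarrow> (\<lambda>p. cst c * D p) \<in> D_Q Q l"
| comp: "\<lbrakk>D \<in> D_Q Q l; E \<in> D_Q Q l\<rbrakk> \<Longrightarrow> D \<circ> E \<in> D_Q Q l"

definition oper_prod :: "('e, 'k::field_char_0) oper list \<Rightarrow> ('e, 'k) oper" where
  "oper_prod Ds = foldr (\<circ>) Ds id"

text \<open>The average runs over the \<open>N!\<close> orderings of the \<open>N\<close> factors of the monomial \<open>m\<close>, listed in
  some order as \<open>xs\<close>.\<close>

definition symmetrize :: "('e dedge coord \<Rightarrow>\<^sub>0 nat) \<Rightarrow> ('e, 'k::field_char_0) oper" where
  "symmetrize m =
    (let xs = (SOME xs. (\<Sum>x\<leftarrow>xs. Poly_Mapping.single x 1) = m) in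
     (\<lambda>p. cst (monom (1 / fact (length xs)) 0)
       * (\<Sum>\<sigma> | \<sigma> permutes {..<length xs}. oper_prod (map \<iota> (permute_list \<sigma> xs)) p)))"

definition \<phi>\<^sub>W :: "('e dedge coord, 'k::field_char_0) kpoly \<Rightarrow> ('e, 'k) oper" where
  "\<phi>\<^sub>W u = (\<lambda>p. \<Sum>m\<in>Poly_Mapping.keys u. cst (Poly_Mapping.lookup u m) * symmetrize m p)"

text \<open>
  On a collection with \<open>N\<close> edges and heights, presented by words in pairs (edge, height), the
  edge of height \<open>k\<close> is \<open>inv_into X ht k\<close>.  An assignment \<open>s\<close> of matrix indices gives the
  row index \<open>s x\<close> and the column index \<open>s (x + 1)\<close> to the abstract edge \<open>x\<close>.
\<close>

definition rho_basis ::
    "('v, 'e) pre_digraph \<Rightarrow> ('v \<Rightarrow> nat) \<Rightarrow> ('v, 'e dedge \<times> nat) necklace multiset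
      \<Rightarrow> ('e, 'k::field_char_0) oper" where
  "rho_basis Q l PH =
    (let ws = fst (present PH); vs = snd (present PH);
         X = abs_edges ws;
         edge = (\<lambda>x. fst (pr ws x)); ht = (\<lambda>x. snd (pr ws x));
         el = (\<lambda>k. inv_into X ht k)
     in (\<lambda>p. (\<Prod>v\<leftarrow>vs. of_nat (l v)) *
          (\<Sum>s \<in> (\<Pi>\<^sub>E x\<in>X. {..<l (tail (double Q) (edge x))}).
             oper_prod (map (\<lambda>k. \<iota> (edge (el k), s (el k), s (nxt ws (el k)))) [1..<card X + 1]) p)))"

definition rho_free ::
    "('v, 'e) pre_digraph \<Rightarrow> ('v \<Rightarrow> nat) \<Rightarrow> ('v, 'e, 'k::field_char_0) hmod
      \<Rightarrow> ('e, 'k) oper" where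
  "rho_free Q l F = (\<lambda>p. \<Sum>PH\<in>Poly_Mapping.keys F. cst (Poly_Mapping.lookup F PH) * rho_basis Q l PH p)"

text \<open>Elements of \<open>A\<^sub>h\<close> are congruence classes; \<open>rho_free\<close> is constant on each of them, as it
  respects the relations.\<close>

definition \<rho>\<^sub>h ::
    "('v, 'e) pre_digraph \<Rightarrow> ('v \<Rightarrow> nat) \<Rightarrow> ('v, 'e, 'k::field_char_0) hmod set
      \<Rightarrow> ('e, 'k) oper" where
  "\<rho>\<^sub>h Q l \<alpha> = (THE D. \<forall>F\<in>\<alpha>. rho_free Q l F = D)"

end

theory Submission
  imports Defs
begin

text \<open>
  Both assertions rest on one formula: if \<open>f\<close> permutes the finite set \<open>X\<close>, then the sum over all index
  assignments \<open>s\<close> of the products of the matrix entries \<open>G x (s x) (s (f x))\<close> is the product, over the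
  orbits of \<open>f\<close>, of the traces of the products of the matrices along the orbit.  Cutting and gluing
  along \<open>J\<close> replaces the matrices of the edges in \<open>J\<close> by identity matrices, that is, it inserts the
  factors \<open>\<delta>\<close> which contractions by the bivector, or commutators of operators, produce.

  For the Moyal product, \<open>\<pi>\<^sup>n\<close> applied to a pair of monomials is a sum over ordered choices of \<open>n\<close>
  disjoint pairs of factors (Wick's formula), so that \<open>n!\<close> cancels and a sum over matchings remains.
  For the operators, an edge is labelled with its height, and the trace of a collection with heights
  is formed in commuting variables indexed by the labels; applying a linear map that orders each monomial by
  height gives the representation.  Hence the formula above applies although operators do not commute.
\<close>

text \<open>One quantity governs both assertions. \<open>bivector a b\<close> is the contraction of
  the Moyal product, and h times it is the commutator of \<open>\<iota> a\<close> and
  \<open>\<iota> b\<close>. For the entries at two abstract edges x and y that project to reverse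
  edges, it is a sign times two deltas: the row index of x equals the column index of y, and
  conversely. These are the two identity matrices that gluing along {x, y} puts in place of x and y.
  An identity matrix is square, so the tail of x has to be the head of y; this follows from
  reversal, but only for words that are closed walks, and therefore validity is carried along. The
  obstacle is that \<open>present\<close> selects an arbitrary presentation, of a product or of a
  collection with heights. No description of the selected words is ever obtained. Traces and
  operators are instead expressed by \<open>coll_value\<close>, which depends on the multiset of
  necklaces alone and can then be computed from any description at hand: a list of words, or the
  orbits of a gluing.\<close>

lemma sum_PiE_insert:
  assumes "y \<notin> A"
  shows "(\<Sum>s\<in>PiE (insert y A) B. g s) = (\<Sum>k\<in>B y. \<Sum>s\<in>PiE A B. g (s(y := k)))"
proof -
  have inj: "inj_on (\<lambda>(k, s). s(y := k)) (B y \<times> PiE A B)"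
  proof (rule inj_onI, clarify)
    fix k s k' s' assume *: "s \<in> PiE A B" "s' \<in> PiE A B" "s(y := k) = s'(y := k')"
    then have "k = k'" by (metis fun_upd_same)
    moreover have "s = s'"
    proof
      fix z show "s z = s' z"
        using PiE_arb[OF *(1) assms] PiE_arb[OF *(2) assms] fun_cong[OF *(3), of z]
        by (cases "z = y") simp_all
    qed
    ultimately show "k = k' \<and> s = s'" by simp
  qed
  have "(\<Sum>s\<in>PiE (insert y A) B. g s) = (\<Sum>(k, s)\<in>B y \<times> PiE A B. g (s(y := k)))"
    unfolding PiE_insert_eq by (subst sum.reindex[OF inj]) (simp add: case_prod_unfold)
  then show ?thesis by (simp add: sum.cartesian_product)
qed

lemma sum_PiE_Un:
  assumes "A \<inter> C = {}"
  shows "(\<Sum>s\<in>PiE A B. \<Sum>t\<in>PiE C B. g s t) = (\<Sum>u\<in>PiE (A \<union> C) B. g (restrict u A) (restrict u C))"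
  unfolding sum.cartesian_product case_prod_unfold
proof (rule sum.reindex_bij_witness[where i = "\<lambda>u. (restrict u A, restrict u C)"
      and j = "\<lambda>(s, t) x. if x \<in> A then s x else t x"], goal_cases)
  case (1 a)
  then show ?case using assms by (auto simp: fun_eq_iff PiE_iff extensional_def disjoint_iff)
next
  case (2 a)
  then show ?case by (auto simp: PiE_iff extensional_def split: prod.splits)
next
  case (3 b)
  then show ?case by (auto simp: PiE_iff extensional_def fun_eq_iff)
next
  case (4 b)
  then show ?case by (auto simp: PiE_iff extensional_def)
next
  case (5 a)
  then have "restrict (\<lambda>x. if x \<in> A then fst a x else snd a x) A = fst a"
    "restrict (\<lambda>x. if x \<in> A then fst a x else snd a x) C = snd a"
    using assms by (auto simp: fun_eq_iff PiE_iff extensional_def disjoint_iff)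
  then show ?case by (simp add: case_prod_unfold)
qed

text \<open>Distributivity for blocks of indices, later the words of a collection or the orbits of a
  gluing. The members of \<open>PiE\<close> are extensional, so a block sees its part of a global
  assignment as a restricted function.\<close>

lemma prod_sum_PiE_disjoint:
  fixes F :: "'i \<Rightarrow> ('a \<Rightarrow> 'b) \<Rightarrow> 'r::comm_semiring_1"
  assumes "finite I" "\<And>i j. i \<in> I \<Longrightarrow> j \<in> I \<Longrightarrow> i \<noteq> j \<Longrightarrow> A i \<inter> A j = {}"
  shows "(\<Prod>i\<in>I. \<Sum>s\<in>PiE (A i) B. F i s) = (\<Sum>s\<in>PiE (\<Union>i\<in>I. A i) B. \<Prod>i\<in>I. F i (restrict s (A i)))"
  using assms
proof (induction I rule: finite_induct)
  case (insert i I)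
  have IH: "(\<Prod>j\<in>I. \<Sum>s\<in>PiE (A j) B. F j s)
      = (\<Sum>s\<in>PiE (\<Union>j\<in>I. A j) B. \<Prod>j\<in>I. F j (restrict s (A j)))"
    by (rule insert.IH) (use insert.prems in auto)
  have disj: "A i \<inter> (\<Union>j\<in>I. A j) = {}" using insert by fastforce
  have "(\<Prod>j\<in>insert i I. \<Sum>s\<in>PiE (A j) B. F j s)
      = (\<Sum>s\<in>PiE (A i) B. \<Sum>t\<in>PiE (\<Union>j\<in>I. A j) B. F i s * (\<Prod>j\<in>I. F j (restrict t (A j))))"
    unfolding prod.insert[OF insert.hyps] IH sum_product by (rule refl)
  also have "\<dots> = (\<Sum>u\<in>PiE (A i \<union> (\<Union>j\<in>I. A j)) B. F i (restrict u (A i)) *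
      (\<Prod>j\<in>I. F j (restrict (restrict u (\<Union>j\<in>I. A j)) (A j))))"
    by (rule sum_PiE_Un[OF disj])
  also have "\<dots> = (\<Sum>u\<in>PiE (A i \<union> (\<Union>j\<in>I. A j)) B. F i (restrict u (A i)) *
      (\<Prod>j\<in>I. F j (restrict u (A j))))"
    by (intro sum.cong prod.cong arg_cong2[where f = "(*)"] refl)
      (auto simp: restrict_restrict Int_absorb1 UN_upper)
  finally show ?case by (simp only: prod.insert[OF insert.hyps] UN_insert)
qed simp

section \<open>Path sums\<close>

text \<open>The row dimension of the factor \<open>V x\<close> is \<open>d x\<close>; its column dimension is the row dimension
  of the following factor.\<close>

fun psum :: "('x \<Rightarrow> nat) \<Rightarrow> ('x \<Rightarrow> nat \<Rightarrow> nat \<Rightarrow> 'r::comm_ring_1) \<Rightarrow> 'x list \<Rightarrow> nat \<Rightarrow> nat \<Rightarrow> 'r" where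
  "psum d V [] i j = of_bool (i = j)"
| "psum d V [x] i j = V x i j"
| "psum d V (x # y # w) i j = (\<Sum>k<d y. V x i k * psum d V (y # w) k j)"

text \<open>The trace of the product along a cyclic word. The value 1 on the empty word is the empty
  product over no abstract edges, so that the formula for lists of words covers empty words
  too.\<close>

definition ctr :: "('x \<Rightarrow> nat) \<Rightarrow> ('x \<Rightarrow> nat \<Rightarrow> nat \<Rightarrow> 'r::comm_ring_1) \<Rightarrow> 'x list \<Rightarrow> 'r" where
  "ctr d V w = (if w = [] then 1 else \<Sum>i<d (hd w). psum d V w i i)"

lemma psum_append:
  assumes "u \<noteq> []" "w \<noteq> []"
  shows "psum d V (u @ w) i j = (\<Sum>k<d (hd w). psum d V u i k * psum d V w k j)"
  using assms(1)
proof (induction d V u i j rule: psum.induct)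
  case (2 d V x i j)
  then show ?case using assms(2) by (cases w) auto
next
  case (3 d V x y u i j)
  have "psum d V ((x # y # u) @ w) i j = (\<Sum>m<d y. V x i m * (\<Sum>k<d (hd w). psum d V (y # u) m k * psum d V w k j))"
    using 3 by simp
  also have "\<dots> = (\<Sum>k<d (hd w). \<Sum>m<d y. V x i m * psum d V (y # u) m k * psum d V w k j)"
    by (simp add: sum_distrib_left mult.assoc) (rule sum.swap)
  finally show ?case by (simp add: sum_distrib_right)
qed simp

text \<open>tr(AB) = tr(BA). Commutativity of the ring enters here, which is why traces cannot be
  formed directly from operators.\<close>

lemma ctr_append_commute: "ctr d V (u @ w) = ctr d V (w @ u)"
proof (cases "u = [] \<or> w = []")
  case False
  then have "ctr d V (u @ w) = (\<Sum>i<d (hd u). \<Sum>k<d (hd w). psum d V u i k * psum d V w k i)"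
    by (simp add: ctr_def psum_append)
  also have "\<dots> = (\<Sum>k<d (hd w). \<Sum>i<d (hd u). psum d V w k i * psum d V u i k)"
    by (subst sum.swap) (simp add: mult.commute)
  also have "\<dots> = ctr d V (w @ u)" using False by (simp add: ctr_def psum_append)
  finally show ?thesis .
qed auto

lemma ctr_rotate: "ctr d V (rotate n w) = ctr d V w"
  by (metis append_take_drop_id ctr_append_commute rotate_drop_take)

lemma psum_map: "psum d V (map g w) i j = psum (d \<circ> g) (V \<circ> g) w i j"
  by (induction "d \<circ> g" "V \<circ> g" w i j rule: psum.induct) auto

lemma ctr_map: "ctr d V (map g w) = ctr (d \<circ> g) (V \<circ> g) w"
  by (auto simp: ctr_def psum_map hd_map)

lemma psum_cong:
  assumes "\<And>x. x \<in> set w \<Longrightarrow> d x = d' x" "\<And>x. x \<in> set w \<Longrightarrow> V x = V' x"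
  shows "psum d V w i j = psum d' V' w i j"
  using assms by (induction d V w i j rule: psum.induct) auto

lemma ctr_cong:
  assumes "\<And>x. x \<in> set w \<Longrightarrow> d x = d' x" "\<And>x. x \<in> set w \<Longrightarrow> V x = V' x"
  shows "ctr d V w = ctr d' V' w"
  using assms psum_cong[of w d d' V V'] by (auto simp: ctr_def)

text \<open>The background \<open>s0\<close> supplies the two indices that are not summed: the row
  index of the first factor and the column index of the last. The final step may leave the path or
  return to \<open>x\<close>; the second case closes a cycle.\<close>

lemma sum_PiE_path:
  assumes "distinct (x # zs)" "successively (\<lambda>x y. f x = y) (x # zs)" "f (last (x # zs)) \<notin> set zs"
  shows "(\<Sum>s\<in>PiE (set zs) (\<lambda>y. {..<d y}). \<Prod>y\<in>set (x # zs).
      V y (override_on s0 s (set zs) y) (override_on s0 s (set zs) (f y)))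
    = psum d V (x # zs) (s0 x) (s0 (f (last (x # zs))))"
  using assms
proof (induction zs arbitrary: x s0)
  case (Cons y zs)
  have fx: "f x = y" using Cons by simp
  have xy: "x \<noteq> y" "x \<notin> set zs" "y \<notin> set zs" using Cons by auto
  \<comment> \<open>The value at \<open>y\<close> passes from the summed assignment to the
    background, as the induction hypothesis requires.\<close>
  have ov: "override_on s0 (s(y := k)) (set (y # zs)) = override_on (s0(y := k)) s (set zs)" for s :: "'a \<Rightarrow> nat" and k
    using xy by (auto simp: override_on_def fun_eq_iff)
  have last: "f (last (y # zs)) \<noteq> y" using Cons by auto
  have "(\<Sum>s\<in>PiE (set (y # zs)) (\<lambda>y. {..<d y}). \<Prod>z\<in>set (x # y # zs).
        V z (override_on s0 s (set (y # zs)) z) (override_on s0 s (set (y # zs)) (f z)))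
     = (\<Sum>k<d y. \<Sum>s\<in>PiE (set zs) (\<lambda>y. {..<d y}). \<Prod>z\<in>set (x # y # zs).
        V z (override_on s0 (s(y := k)) (set (y # zs)) z) (override_on s0 (s(y := k)) (set (y # zs)) (f z)))"
    by (subst (1) list.set, subst sum_PiE_insert) (use xy in auto)
  also have "\<dots> = (\<Sum>k<d y. \<Sum>s\<in>PiE (set zs) (\<lambda>y. {..<d y}). \<Prod>z\<in>set (x # y # zs).
        V z (override_on (s0(y := k)) s (set zs) z) (override_on (s0(y := k)) s (set zs) (f z)))"
    by (simp only: ov)
  also have "\<dots> = (\<Sum>k<d y. \<Sum>s\<in>PiE (set zs) (\<lambda>y. {..<d y}). V x (s0 x) k * (\<Prod>z\<in>set (y # zs).
        V z (override_on (s0(y := k)) s (set zs) z) (override_on (s0(y := k)) s (set zs) (f z))))"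
  proof (intro sum.cong refl)
    fix k s
    have "set (x # y # zs) = insert x (set (y # zs))" by simp
    moreover have "x \<notin> set (y # zs)" using xy by auto
    ultimately show "(\<Prod>z\<in>set (x # y # zs).
        V z (override_on (s0(y := k)) s (set zs) z) (override_on (s0(y := k)) s (set zs) (f z)))
       = V x (s0 x) k * (\<Prod>z\<in>set (y # zs).
        V z (override_on (s0(y := k)) s (set zs) z) (override_on (s0(y := k)) s (set zs) (f z)))"
      using xy fx by (simp only: prod.insert[OF List.finite_set]) simp
  qed
  also have "\<dots> = (\<Sum>k<d y. V x (s0 x) k * psum d V (y # zs) k (s0 (f (last (y # zs)))))"
  proof (intro sum.cong refl, goal_cases)
    case (1 k)
    have "(\<Sum>s\<in>PiE (set zs) (\<lambda>y. {..<d y}). \<Prod>z\<in>set (y # zs).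
        V z (override_on (s0(y := k)) s (set zs) z) (override_on (s0(y := k)) s (set zs) (f z)))
       = psum d V (y # zs) ((s0(y := k)) y) ((s0(y := k)) (f (last (y # zs))))"
      by (rule Cons.IH) (use Cons.prems in auto)
    then show ?case using last by (simp add: sum_distrib_left[symmetric])
  qed
  finally show ?case by simp
qed simp

definition cycles_through :: "('a \<Rightarrow> 'a) \<Rightarrow> 'a list \<Rightarrow> bool" where
  "cycles_through f zs \<longleftrightarrow> zs \<noteq> [] \<and> distinct zs \<and> successively (\<lambda>x y. f x = y) zs \<and> f (last zs) = hd zs"

lemma successively_image: "successively (\<lambda>x y. f x = y) zs \<Longrightarrow> z \<in> set zs \<Longrightarrow> f z \<in> insert (f (last zs)) (set zs)"
  by (induction zs rule: induct_list012) auto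

lemma cycles_through_image: "cycles_through f zs \<Longrightarrow> z \<in> set zs \<Longrightarrow> f z \<in> set zs"
  unfolding cycles_through_def using successively_image[of f zs z] by auto

lemma sum_PiE_cycle:
  assumes "cycles_through f zs"
  shows "(\<Sum>s\<in>PiE (set zs) (\<lambda>y. {..<d y}). \<Prod>y\<in>set zs. V y (s y) (s (f y))) = ctr d V zs"
proof -
  obtain x ws where zs: "zs = x # ws" using assms by (auto simp: cycles_through_def neq_Nil_conv)
  have x: "x \<notin> set ws" and last: "f (last zs) = x" using assms zs by (auto simp: cycles_through_def)
  have "(\<Sum>s\<in>PiE (set zs) (\<lambda>y. {..<d y}). \<Prod>y\<in>set zs. V y (s y) (s (f y)))
     = (\<Sum>k<d x. \<Sum>s\<in>PiE (set ws) (\<lambda>y. {..<d y}). \<Prod>y\<in>set zs. V y ((s(x := k)) y) ((s(x := k)) (f y)))"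
    unfolding zs list.set by (rule sum_PiE_insert) (rule x)
  \<comment> \<open>A constant background is enough: outside \<open>ws\<close> only the index at
    \<open>x\<close> is read, as the first row index and as the last column index.\<close>
  also have "\<dots> = (\<Sum>k<d x. \<Sum>s\<in>PiE (set ws) (\<lambda>y. {..<d y}). \<Prod>y\<in>set zs.
     V y (override_on (\<lambda>_. k) s (set ws) y) (override_on (\<lambda>_. k) s (set ws) (f y)))"
  proof (intro sum.cong prod.cong refl, goal_cases)
    case (1 k s y)
    then have "y \<in> set zs" "f y \<in> set zs" using cycles_through_image[OF assms] by auto
    moreover have "(s(x := k)) z = override_on (\<lambda>_. k) s (set ws) z" if "z \<in> set zs" for z
      using that x by (auto simp: zs override_on_def)
    ultimately show ?case by metis
  qed
  also have "\<dots> = (\<Sum>k<d x. psum d V zs k k)"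
  proof (intro sum.cong refl)
    fix k
    show "(\<Sum>s\<in>PiE (set ws) (\<lambda>y. {..<d y}). \<Prod>y\<in>set zs.
     V y (override_on (\<lambda>_. k) s (set ws) y) (override_on (\<lambda>_. k) s (set ws) (f y))) = psum d V zs k k"
      unfolding zs by (rule sum_PiE_path) (use assms zs in \<open>auto simp: cycles_through_def\<close>)
  qed
  finally show ?thesis by (simp add: ctr_def zs)
qed

text \<open>Along a run of identity matrices the row dimension is constant, hence it is that of the
  first remaining factor, or the final column dimension \<open>e\<close> if none remains.\<close>

lemma dim_filter:
  assumes "successively (\<lambda>x y. x \<in> J \<longrightarrow> d x = d y) zs" "zs \<noteq> []" "last zs \<in> J \<Longrightarrow> d (last zs) = e"
  shows "d (hd zs) = (if filter (\<lambda>x. x \<notin> J) zs = [] then e else d (hd (filter (\<lambda>x. x \<notin> J) zs)))"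
  using assms by (induction zs rule: induct_list012) (auto split: if_splits)

text \<open>An element of \<open>J\<close> contributes an identity matrix, which drops out of the product.\<close>

lemma psum_filter:
  fixes V :: "'x \<Rightarrow> nat \<Rightarrow> nat \<Rightarrow> 'r::comm_ring_1"
  assumes "successively (\<lambda>x y. x \<in> J \<longrightarrow> d x = d y) zs" "zs \<noteq> []" "last zs \<in> J \<Longrightarrow> d (last zs) = e"
    and "i < d (hd zs)" "j < e"
  shows "psum d (\<lambda>x i j. if x \<in> J then of_bool (i = j) else V x i j) zs i j
       = psum d V (filter (\<lambda>x. x \<notin> J) zs) i j"
  using assms
proof (induction zs arbitrary: i)
  case (Cons x zs)
  show ?case
  proof (cases zs)
    case Nil
    then show ?thesis by auto
  next
    case (Cons y ys)
    let ?W = "\<lambda>x i j. if x \<in> J then of_bool (i = j) else V x i j"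
    let ?F = "filter (\<lambda>x. x \<notin> J) zs"
    have IH: "psum d ?W zs k j = psum d V ?F k j" if "k < d y" for k
      using Cons.IH[of k] Cons.prems that Cons by simp
    have dim: "d y = (if ?F = [] then e else d (hd ?F))"
      using dim_filter[of J d zs e] Cons.prems Cons by simp
    have p: "psum d ?W (x # zs) i j = (\<Sum>k<d y. ?W x i k * psum d V ?F k j)"
      using IH Cons by auto
    show ?thesis
    proof (cases "x \<in> J")
      case True
      \<comment> \<open>The identity matrix is square, so \<open>i\<close> lies in the range of
        summation and exactly one term survives.\<close>
      then have i: "i < d y" using Cons.prems Cons by auto
      have "psum d ?W (x # zs) i j = (\<Sum>k<d y. if i = k then psum d V ?F k j else 0)"
        unfolding p using True by (intro sum.cong) auto
      also have "\<dots> = psum d V ?F i j" using i by simp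
      finally show ?thesis using True by simp
    next
      case False
      have "psum d ?W (x # zs) i j = (\<Sum>k<d y. V x i k * psum d V ?F k j)"
        unfolding p using False by simp
      also have "\<dots> = psum d V (x # ?F) i j"
      proof (cases ?F)
        case Nil
        \<comment> \<open>The remaining product is an identity matrix of size \<open>e\<close>, and
          by \<open>j < e\<close> the sum over \<open>k\<close> meets \<open>j\<close>.\<close>
        then show ?thesis using dim \<open>j < e\<close> by (simp add: of_bool_def if_distrib cong: if_cong)
      next
        case (Cons z zs')
        then show ?thesis using dim by simp
      qed
      finally show ?thesis using False by simp
    qed
  qed
qed simp

text \<open>If the whole cycle lies in \<open>J\<close>, the product is an identity matrix. Its
  trace, the dimension at the start, is the value of the trivial path that gluing puts in place of
  the orbit.\<close>

lemma ctr_filter: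
  fixes V :: "'x \<Rightarrow> nat \<Rightarrow> nat \<Rightarrow> 'r::comm_ring_1"
  assumes cyc: "cycles_through f zs" and J: "\<And>x. x \<in> set zs \<Longrightarrow> x \<in> J \<Longrightarrow> d (f x) = d x"
  shows "ctr d (\<lambda>x i j. if x \<in> J then of_bool (i = j) else V x i j) zs
       = (if filter (\<lambda>x. x \<notin> J) zs = [] then of_nat (d (hd zs)) else ctr d V (filter (\<lambda>x. x \<notin> J) zs))"
proof -
  have ne: "zs \<noteq> []" and last: "f (last zs) = hd zs" using cyc by (auto simp: cycles_through_def)
  have succ: "successively (\<lambda>x y. x \<in> J \<longrightarrow> d x = d y) zs"
  proof (rule successively_mono)
    show "successively (\<lambda>x y. f x = y) zs" using cyc by (simp add: cycles_through_def)
  qed (use J in auto)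
  have e: "last zs \<in> J \<Longrightarrow> d (last zs) = d (hd zs)" using J[of "last zs"] ne last by auto
  have "ctr d (\<lambda>x i j. if x \<in> J then of_bool (i = j) else V x i j) zs
      = (\<Sum>i<d (hd zs). psum d V (filter (\<lambda>x. x \<notin> J) zs) i i)"
    using ne by (auto simp: ctr_def intro!: sum.cong psum_filter[OF succ ne e])
  then show ?thesis
    using dim_filter[OF succ ne e] by (auto simp: ctr_def split: if_splits)
qed

section \<open>Orbits of a map that is injective on a finite set\<close>

lemma funpow_image: "f ` X \<subseteq> X \<Longrightarrow> x \<in> X \<Longrightarrow> (f ^^ n) x \<in> X"
  by (induction n) auto

lemma inj_on_funpow: "inj_on f X \<Longrightarrow> f ` X \<subseteq> X \<Longrightarrow> inj_on (f ^^ n) X"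
proof (induction n)
  case (Suc n)
  then show ?case using funpow_image[of f X _ n]
    by (auto simp: inj_on_def)
qed simp

text \<open>Pigeonhole: two iterates agree, and injectivity on \<open>X\<close> cancels the earlier
  one.\<close>

lemma funpow_returns:
  assumes "finite X" "inj_on f X" "f ` X \<subseteq> X" "x \<in> X"
  shows "\<exists>n>0. (f ^^ n) x = x"
proof -
  have "\<not> inj_on (\<lambda>n. (f ^^ n) x) (UNIV :: nat set)"
  proof
    assume "inj_on (\<lambda>n. (f ^^ n) x) (UNIV :: nat set)"
    moreover have "range (\<lambda>n. (f ^^ n) x) \<subseteq> X" using funpow_image[OF assms(3,4)] by auto
    ultimately show False using finite_subset[OF _ assms(1)] finite_imageD by blast
  qed
  then obtain a b where "a \<noteq> b" "(f ^^ a) x = (f ^^ b) x" by (auto simp: inj_on_def)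
  then obtain a b where ab: "a < b" "(f ^^ a) x = (f ^^ b) x" by (metis linorder_neqE_nat)
  then have "(f ^^ a) x = (f ^^ a) ((f ^^ (b - a)) x)" by (simp flip: funpow_add[unfolded o_def, THEN fun_cong])
  then have "(f ^^ (b - a)) x = x"
    using inj_on_funpow[OF assms(2,3), of a] funpow_image[OF assms(3,4)] assms(4) by (metis inj_onD)
  then show ?thesis using ab by (intro exI[of _ "b - a"]) auto
qed

lemma successively_support: "successively (\<lambda>x y. f x = y) (map (\<lambda>i. (f ^^ i) x) [0..<n])"
  by (auto simp: successively_conv_nth)

lemma cycles_through_support:
  assumes "\<exists>n>0. (f ^^ n) x = x"
  shows "cycles_through f (support f x)" "set (support f x) = orbit f x" "hd (support f x) = x"
proof -
  let ?n = "least_power f x"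
  have n: "(f ^^ ?n) x = x" "?n > 0" using assms least_powerI by metis+
  have "inj_on (\<lambda>i. (f ^^ i) x) {0..<?n}"
  proof (rule inj_on_funpow_least[OF n(1)])
    fix m assume "0 < m" "m < ?n"
    then show "(f ^^ m) x \<noteq> x" using least_power_le[of m f x] by linarith
  qed
  moreover have "f (last (support f x)) = x"
    using n by (cases ?n) auto
  ultimately show "cycles_through f (support f x)" 
    using n successively_support[of f x ?n] by (simp add: cycles_through_def distinct_map hd_map)
  show "set (support f x) = orbit f x" using orbit_altdef_bounded[OF n] by auto
  show "hd (support f x) = x" using n by (simp add: hd_map)
qed

text \<open>The first claim concerns the element chosen by \<open>SOME\<close> because
  \<open>orbit_necklace\<close> reads the word of an orbit from that element.\<close>

lemma orbit_partition:
  assumes X: "finite X" "inj_on f X" "f ` X \<subseteq> X"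
  shows "C \<in> orbit f ` X \<Longrightarrow> z = (SOME z. z \<in> C) \<Longrightarrow>
      z \<in> C \<and> C \<subseteq> X \<and> cycles_through f (support f z) \<and> set (support f z) = C \<and> hd (support f z) = z"
    and "C \<in> orbit f ` X \<Longrightarrow> D \<in> orbit f ` X \<Longrightarrow> C \<noteq> D \<Longrightarrow> C \<inter> D = {}"
    and "\<Union> (orbit f ` X) = X"
proof -
  have self: "x \<in> orbit f x" if "x \<in> X" for x
    using funpow_returns[OF X that] by (force simp: orbit_altdef)
  have sub: "orbit f x \<subseteq> X" if "x \<in> X" for x
    using funpow_image[OF X(3) that] by (auto simp: orbit_altdef)
  have eq: "orbit f z = orbit f x" if "z \<in> orbit f x" "x \<in> X" for x z
    using self[OF that(2)] that(1) orbit_swap orbit_trans by (metis subsetI subset_antisym)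
  show "z \<in> C \<and> C \<subseteq> X \<and> cycles_through f (support f z) \<and> set (support f z) = C \<and> hd (support f z) = z"
    if C: "C \<in> orbit f ` X" and z: "z = (SOME z. z \<in> C)" for C z
  proof -
    obtain x where x: "x \<in> X" "C = orbit f x" using C by auto
    have zC: "z \<in> C" unfolding z by (rule someI[of _ x]) (simp add: x self)
    then have "z \<in> X" "orbit f z = C" using sub eq x by auto
    then show ?thesis using zC sub x cycles_through_support[OF funpow_returns[OF X]] by metis
  qed
  show "C \<inter> D = {}" if "C \<in> orbit f ` X" "D \<in> orbit f ` X" "C \<noteq> D" for C D
    using that eq by blast
  show "\<Union> (orbit f ` X) = X" using self sub by blast
qed

section \<open>The permutation of the abstract edges\<close>

lemma finite_abs_edges [simp]: "finite (abs_edges ws)"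
proof -
  have "abs_edges ws = (SIGMA i:{..<length ws}. {..<length (ws ! i)})"
    by (auto simp: abs_edges_def)
  then show ?thesis by simp
qed

lemma nxt_in_abs_edges: "z \<in> abs_edges ws \<Longrightarrow> nxt ws z \<in> abs_edges ws"
  by (auto simp: abs_edges_def nxt_def intro: mod_less_divisor)

lemma inj_on_nxt: "inj_on (nxt ws) (abs_edges ws)"
  by (rule inj_onI) (auto simp: abs_edges_def nxt_def mod_Suc split: if_splits)

text \<open>\<open>glue_step\<close> is \<open>nxt\<close> after \<open>\<phi>\<close> extended by
  the identity outside \<open>J\<close>. The extension is an involution of the abstract edges, and
  \<open>nxt\<close> is injective on them.\<close>

lemma glue_step_permutes:
  assumes "J \<subseteq> abs_edges ws" "\<And>z. z \<in> J \<Longrightarrow> \<phi> z \<in> J \<and> \<phi> (\<phi> z) = z"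
  shows "inj_on (glue_step ws J \<phi>) (abs_edges ws)" "glue_step ws J \<phi> ` abs_edges ws \<subseteq> abs_edges ws"
proof -
  have img: "(if z \<in> J then \<phi> z else z) \<in> abs_edges ws" if "z \<in> abs_edges ws" for z
    using assms(1) assms(2)[of z] that by (cases "z \<in> J") auto
  have eq: "glue_step ws J \<phi> z = nxt ws (if z \<in> J then \<phi> z else z)" for z
    by (simp add: glue_step_def)
  show "glue_step ws J \<phi> ` abs_edges ws \<subseteq> abs_edges ws"
    unfolding image_subset_iff eq using nxt_in_abs_edges[OF img] by (rule ballI)
  show "inj_on (glue_step ws J \<phi>) (abs_edges ws)"
  proof (rule inj_onI)
    fix x y assume "x \<in> abs_edges ws" "y \<in> abs_edges ws" "glue_step ws J \<phi> x = glue_step ws J \<phi> y"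
    then have "(if x \<in> J then \<phi> x else x) = (if y \<in> J then \<phi> y else y)"
      using inj_onD[OF inj_on_nxt _ img img, of x y] by (simp only: eq)
    \<comment> \<open>In the two mixed cases \<open>\<phi>\<close> would carry an element of
      \<open>J\<close> out of \<open>J\<close>.\<close>
    then consider "x \<in> J" "y \<in> J" "\<phi> x = \<phi> y" | "x \<in> J" "y \<notin> J" "\<phi> x = y"
      | "x \<notin> J" "y \<in> J" "x = \<phi> y" | "x = y"
      by (auto split: if_splits)
    then show "x = y"
    proof cases
      case 1
      have "\<phi> (\<phi> x) = \<phi> (\<phi> y)" using 1(3) by (rule arg_cong)
      then show ?thesis using assms(2)[OF 1(1)] assms(2)[OF 1(2)] by (metis (no_types))
    qed (use assms(2)[of x] assms(2)[of y] in blast)+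
  qed
qed

section \<open>Values of collections\<close>

fun necklace_value ::
    "('x \<Rightarrow> nat) \<Rightarrow> ('x \<Rightarrow> nat \<Rightarrow> nat \<Rightarrow> 'r::comm_ring_1) \<Rightarrow> ('v \<Rightarrow> nat) \<Rightarrow> ('v, 'x) necklace \<Rightarrow> 'r" where
  "necklace_value d V l (Triv v) = of_nat (l v)"
| "necklace_value d V l (Cyc c) = ctr d V (rep_cyclic c)"

text \<open>Polymorphic in the labels on purpose. With edges as labels and coordinates as entries it
  is the trace of a collection; with pairs (edge, height) as labels it is the commutative polynomial
  from which the ordered operators are obtained.\<close>

definition coll_value ::
    "('x \<Rightarrow> nat) \<Rightarrow> ('x \<Rightarrow> nat \<Rightarrow> nat \<Rightarrow> 'r::comm_ring_1) \<Rightarrow> ('v \<Rightarrow> nat) \<Rightarrow> ('v, 'x) necklace multiset \<Rightarrow> 'r" where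
  "coll_value d V l P = (\<Prod>n\<in>#P. necklace_value d V l n)"

lemma rep_abs_cyclic: "\<exists>n. rep_cyclic (abs_cyclic w) = rotate n w"
  using Quotient3_abs_rep[OF Quotient3_cyclic, of "abs_cyclic w"]
  unfolding cyclic.abs_eq_iff[of w "rep_cyclic (abs_cyclic w)", symmetric] by simp

lemma ctr_rep_abs [simp]: "ctr d V (rep_cyclic (abs_cyclic w)) = ctr d V w"
  using rep_abs_cyclic[of w] ctr_rotate by metis

lemma coll_value_coll_prod:
  "coll_value d V l (coll (ws, vs)) = (\<Prod>v\<leftarrow>vs. of_nat (l v)) * (\<Prod>w\<leftarrow>ws. ctr d V w)"
  by (simp add: coll_value_def coll_def image_mset.compositionality o_def
      prod_mset_prod_list[symmetric] mult.commute)

lemma cycles_through_word: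
  assumes "i < length ws" "ws ! i \<noteq> []"
  shows "cycles_through (nxt ws) (map (Pair i) [0..<length (ws ! i)])"
proof -
  have "successively (\<lambda>x y. nxt ws x = y) (map (Pair i) [0..<length (ws ! i)])"
    by (auto simp: successively_conv_nth nxt_def)
  moreover obtain m where "length (ws ! i) = Suc m" using assms by (cases "ws ! i") auto
  ultimately show ?thesis
    by (simp add: cycles_through_def distinct_map inj_on_def nxt_def hd_map del: upt_Suc) simp
qed

text \<open>The words are the cycles of \<open>nxt\<close>, so the cycle formula applies to each of
  them and the product of sums is distributed. The left side depends on the multiset alone, hence
  the right side is the same for all its presentations.\<close>

lemma coll_value_coll:
  "coll_value d V l (coll (ws, vs)) = (\<Prod>v\<leftarrow>vs. of_nat (l v)) *
     (\<Sum>s\<in>PiE (abs_edges ws) (\<lambda>x. {..<d (pr ws x)}). \<Prod>x\<in>abs_edges ws. V (pr ws x) (s x) (s (nxt ws x)))"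
proof -
  let ?zs = "\<lambda>i. map (Pair i) [0..<length (ws ! i)]"
  let ?B = "\<lambda>x. {..<(d \<circ> pr ws) x}"
  let ?F = "\<lambda>i s. \<Prod>y\<in>set (?zs i). (V \<circ> pr ws) y (s y) (s (nxt ws y))"
  have Un: "(\<Union>i\<in>{..<length ws}. set (?zs i)) = abs_edges ws" by (auto simp: abs_edges_def)
  have word: "ctr d V (ws ! i) = (\<Sum>s\<in>PiE (set (?zs i)) ?B. ?F i s)" if "i < length ws" for i
  proof (cases "ws ! i = []")
    case False
    have "ws ! i = map (pr ws) (?zs i)" by (auto simp: pr_def intro: nth_equalityI)
    then have "ctr d V (ws ! i) = ctr (d \<circ> pr ws) (V \<circ> pr ws) (?zs i)" by (metis ctr_map)
    also have "\<dots> = (\<Sum>s\<in>PiE (set (?zs i)) ?B. ?F i s)"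
      by (rule sum_PiE_cycle[OF cycles_through_word[OF that False], symmetric])
    finally show ?thesis .
  qed (simp add: ctr_def)
  have "(\<Prod>w\<leftarrow>ws. ctr d V w) = (\<Prod>i\<in>{..<length ws}. ctr d V (ws ! i))"
    by (simp add: prod.list_conv_set_nth atLeast0LessThan)
  also have "\<dots> = (\<Prod>i\<in>{..<length ws}. \<Sum>s\<in>PiE (set (?zs i)) ?B. ?F i s)"
    using word by simp
  also have "\<dots> = (\<Sum>s\<in>PiE (\<Union>i\<in>{..<length ws}. set (?zs i)) ?B. \<Prod>i\<in>{..<length ws}. ?F i (restrict s (set (?zs i))))"
    by (rule prod_sum_PiE_disjoint) auto
  also have "\<dots> = (\<Sum>s\<in>PiE (abs_edges ws) ?B. \<Prod>x\<in>abs_edges ws. (V \<circ> pr ws) x (s x) (s (nxt ws x)))"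
  proof (rule sum.cong)
    fix s
    \<comment> \<open>\<open>nxt\<close> stays within the word, so each block reads only its own
      indices.\<close>
    have "?F i (restrict s (set (?zs i))) = ?F i s" if "i < length ws" for i
    proof (rule prod.cong)
      fix y assume y: "y \<in> set (?zs i)"
      then have "ws ! i \<noteq> []" by auto
      then have "nxt ws y \<in> set (?zs i)" using cycles_through_image[OF cycles_through_word] that y by blast
      then show "(V \<circ> pr ws) y (restrict s (set (?zs i)) y) (restrict s (set (?zs i)) (nxt ws y))
        = (V \<circ> pr ws) y (s y) (s (nxt ws y))" using y by simp
    qed simp
    then have "(\<Prod>i\<in>{..<length ws}. ?F i (restrict s (set (?zs i)))) = (\<Prod>i\<in>{..<length ws}. ?F i s)"
      by (rule prod.cong[OF refl]) (simp only: lessThan_iff)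
    also have "\<dots> = (\<Prod>x\<in>(\<Union>i\<in>{..<length ws}. set (?zs i)). (V \<circ> pr ws) x (s x) (s (nxt ws x)))"
      by (rule prod.UNION_disjoint[symmetric]) auto
    finally show "(\<Prod>i\<in>{..<length ws}. ?F i (restrict s (set (?zs i))))
       = (\<Prod>x\<in>abs_edges ws. (V \<circ> pr ws) x (s x) (s (nxt ws x)))" unfolding Un .
  qed (use Un in simp)
  finally show ?thesis by (simp add: coll_value_coll_prod o_def)
qed

definition row_dim :: "('v, 'e) pre_digraph \<Rightarrow> ('v \<Rightarrow> nat) \<Rightarrow> 'e dedge \<Rightarrow> nat" where
  "row_dim Q l a = l (tail (double Q) a)"

text \<open>The same argument, with the orbits of \<open>glue_step\<close> as cycles. The column
  index of \<open>z\<close> in \<open>J\<close> is the index at \<open>nxt ws (\<phi> z)\<close>; by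
  the condition on dimensions both indices of the delta have the same range, so that the delta is an
  identity matrix and drops out.\<close>

lemma coll_value_cut_glue:
  fixes V :: "'y \<Rightarrow> nat \<Rightarrow> nat \<Rightarrow> 'r::comm_ring_1"
  assumes J: "J \<subseteq> abs_edges ws" "\<And>z. z \<in> J \<Longrightarrow> \<phi> z \<in> J \<and> \<phi> (\<phi> z) = z"
    and dim: "\<And>z. z \<in> J \<Longrightarrow> row_dim Q l (pr ws (nxt ws (\<phi> z))) = row_dim Q l (pr ws z)"
    and lab: "\<And>x. x \<in> abs_edges ws - J \<Longrightarrow> d (lab x) = row_dim Q l (pr ws x)"
  shows "coll_value d V l (cut_glue Q (ws, vs) J \<phi> lab) = (\<Prod>v\<leftarrow>vs. of_nat (l v)) *
     (\<Sum>s\<in>PiE (abs_edges ws) (\<lambda>x. {..<row_dim Q l (pr ws x)}). \<Prod>x\<in>abs_edges ws.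
        if x \<in> J then of_bool (s x = s (nxt ws (\<phi> x))) else V (lab x) (s x) (s (nxt ws x)))"
proof -
  let ?X = "abs_edges ws" let ?f = "glue_step ws J \<phi>"
  let ?N = "orbit_necklace Q ws J \<phi> lab" let ?O = "orbit ?f ` ?X"
  let ?B = "\<lambda>x. {..<row_dim Q l (pr ws x)}"
  define G where "G = (\<lambda>x i j. if x \<in> J then of_bool (i = j) else V (lab x) i j)"
  let ?F = "\<lambda>C s. \<Prod>y\<in>C. G y (s y) (s (?f y))"
  have f: "inj_on ?f ?X" "?f ` ?X \<subseteq> ?X"
    using glue_step_permutes[of J ws \<phi>] J by blast+
  note orb = orbit_partition[OF finite_abs_edges f]
  have neck: "necklace_value d V l (?N C) = (\<Sum>s\<in>PiE C ?B. ?F C s)" if C: "C \<in> ?O" for C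
  proof -
    define z where "z = (SOME z. z \<in> C)"
    define zs where "zs = support ?f z"
    define ys where "ys = filter (\<lambda>x. x \<notin> J) zs"
    have z: "C \<subseteq> ?X" "cycles_through ?f zs" "set zs = C" "hd zs = z"
      using orb(1)[OF C z_def] by (auto simp: zs_def)
    have "necklace_value d V l (?N C)
        = (if ys = [] then of_nat (row_dim Q l (pr ws (hd zs))) else ctr (\<lambda>x. row_dim Q l (pr ws x)) (\<lambda>x. V (lab x)) ys)"
    proof (cases "ys = []")
      case True
      then have "?N C = Triv (tail (double Q) (pr ws z))"
        by (simp only: orbit_necklace_def Let_def z_def[symmetric] zs_def[symmetric] ys_def[symmetric] if_True simp_thms)
      then show ?thesis using True z by (simp add: row_dim_def)
    next
      case False
      then have N: "?N C = Cyc (abs_cyclic (map lab ys))"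
        by (simp only: orbit_necklace_def Let_def z_def[symmetric] zs_def[symmetric] ys_def[symmetric] if_False)
      have "ctr d V (map lab ys) = ctr (\<lambda>x. row_dim Q l (pr ws x)) (\<lambda>x. V (lab x)) ys"
        unfolding ctr_map using lab z by (intro ctr_cong) (auto simp: ys_def)
      then show ?thesis using False N by (simp only: necklace_value.simps ctr_rep_abs if_False)
    qed
    also have "\<dots> = ctr (\<lambda>x. row_dim Q l (pr ws x)) G zs"
      unfolding ys_def G_def
      by (rule ctr_filter[OF z(2), symmetric]) (use dim in \<open>auto simp: glue_step_def\<close>)
    also have "\<dots> = (\<Sum>s\<in>PiE C ?B. ?F C s)"
      using sum_PiE_cycle[OF z(2), where d = "\<lambda>x. row_dim Q l (pr ws x)" and V = G] z(3) by simp
    finally show ?thesis .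
  qed
  have "coll_value d V l (cut_glue Q (ws, vs) J \<phi> lab)
      = (\<Prod>v\<leftarrow>vs. of_nat (l v)) * (\<Prod>C\<in>?O. necklace_value d V l (?N C))"
    by (simp add: coll_value_def cut_glue_def image_mset.compositionality o_def
      prod_mset_prod_list[symmetric] mult.commute prod_unfold_prod_mset)
  also have "(\<Prod>C\<in>?O. necklace_value d V l (?N C)) = (\<Prod>C\<in>?O. \<Sum>s\<in>PiE C ?B. ?F C s)"
    using neck by simp
  also have "\<dots> = (\<Sum>s\<in>PiE (\<Union>C\<in>?O. C) ?B. \<Prod>C\<in>?O. ?F C (restrict s C))"
    by (rule prod_sum_PiE_disjoint) (use orb(2) in auto)
  also have "\<dots> = (\<Sum>s\<in>PiE ?X ?B. \<Prod>x\<in>?X. G x (s x) (s (?f x)))"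
  proof (rule sum.cong)
    fix s
    have "?F C (restrict s C) = ?F C s" if C: "C \<in> ?O" for C
    proof (rule prod.cong)
      fix y assume "y \<in> C"
      moreover from this have "?f y \<in> C" using C by (auto intro: orbit.step)
      ultimately show "G y (restrict s C y) (restrict s C (?f y)) = G y (s y) (s (?f y))" by simp
    qed simp
    then have "(\<Prod>C\<in>?O. ?F C (restrict s C)) = (\<Prod>C\<in>?O. ?F C s)"
      by (rule prod.cong[OF refl])
    also have "\<dots> = (\<Prod>x\<in>(\<Union>C\<in>?O. C). G x (s x) (s (?f x)))"
    proof (rule prod.UNION_disjoint[symmetric])
      show "\<forall>C\<in>?O. finite C" using orb(3) finite_abs_edges[of ws] by (metis Union_upper finite_subset)
    qed (use orb(2) in auto)
    finally show "(\<Prod>C\<in>?O. ?F C (restrict s C)) = (\<Prod>x\<in>?X. G x (s x) (s (?f x)))"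
      using orb(3) by simp
  qed (use orb(3) in simp)
  also have "\<dots> = (\<Sum>s\<in>PiE ?X ?B. \<Prod>x\<in>?X.
        if x \<in> J then of_bool (s x = s (nxt ws (\<phi> x))) else V (lab x) (s x) (s (nxt ws x)))"
    by (intro sum.cong prod.cong) (auto simp: G_def glue_step_def)
  finally show ?thesis .
qed

section \<open>Linear extension\<close>

text \<open>The k[h]-linear extension of values on a basis. \<open>pdiff\<close>, \<open>tr\<close>
  and, at a fixed argument, \<open>rho_free\<close> and \<open>\<phi>\<^sub>W\<close> have this
  form, so linearity is proved once for all of them.\<close>

definition lin :: "('a \<Rightarrow> 'm \<Rightarrow>\<^sub>0 'c) \<Rightarrow> ('a \<Rightarrow>\<^sub>0 'c) \<Rightarrow> ('m::comm_monoid_add \<Rightarrow>\<^sub>0 'c::comm_ring_1)" where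
  "lin L u = (\<Sum>m\<in>Poly_Mapping.keys u. cst (Poly_Mapping.lookup u m) * L m)"

lemma cst_0 [simp]: "cst 0 = 0"
  and cst_1 [simp]: "cst (1::'c::{zero_neq_one}) = 1"
  and cst_add: "cst (a + b) = cst a + (cst b :: 'm::zero \<Rightarrow>\<^sub>0 'd::comm_ring_1)"
  and cst_uminus: "cst (- a) = - (cst a :: 'm::zero \<Rightarrow>\<^sub>0 'd::comm_ring_1)"
  by (simp_all add: cst_def single_add single_uminus)

lemma cst_mult: "cst (a * b) = cst a * (cst b :: 'm::comm_monoid_add \<Rightarrow>\<^sub>0 'd::comm_ring_1)"
  by (simp add: cst_def mult_single)

lemma cst_of_nat: "cst (of_nat n) = (of_nat n :: 'm::comm_monoid_add \<Rightarrow>\<^sub>0 'd::comm_ring_1)"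
  by (simp add: cst_def)

lemma cst_of_bool: "cst (of_bool b) = (of_bool b :: 'm::comm_monoid_add \<Rightarrow>\<^sub>0 'd::comm_ring_1)"
  by (cases b) simp_all

lemma cst_prod_list: "(\<Prod>v\<leftarrow>vs. of_nat (l v)) = (cst (\<Prod>v\<leftarrow>vs. of_nat (l v)) :: 'm::comm_monoid_add \<Rightarrow>\<^sub>0 'd::comm_ring_1)"
  by (induction vs) (simp_all add: cst_mult cst_of_nat)

lemma lookup_cst_mult: "Poly_Mapping.lookup (cst c * u) m = c * Poly_Mapping.lookup u m"
  for u :: "'m::comm_monoid_add \<Rightarrow>\<^sub>0 'd::comm_ring_1"
proof -
  have "cst c * u = Poly_Mapping.map ((*) c) u"
    by (simp add: cst_def mult_map_scale_conv_mult)
  then show ?thesis by (auto simp: Poly_Mapping.map.rep_eq when_def)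
qed

lemma cst_mult_single: "cst c * Poly_Mapping.single m e = Poly_Mapping.single m (c * e)"
  for m :: "'m::comm_monoid_add" and e :: "'d::comm_ring_1"
  by (simp add: cst_def mult_single)

lemma poly_mapping_eq_sum_single: "u = (\<Sum>m\<in>Poly_Mapping.keys u. Poly_Mapping.single m (Poly_Mapping.lookup u m))"
  by (rule poly_mapping_eqI)
    (simp add: lookup_sum lookup_single when_def sum.delta in_keys_iff)

lemma lin_superset:
  assumes "finite S" "Poly_Mapping.keys u \<subseteq> S"
  shows "lin L u = (\<Sum>m\<in>S. cst (Poly_Mapping.lookup u m) * L m)"
  unfolding lin_def using assms
  by (intro sum.mono_neutral_left) (auto simp: in_keys_iff)

lemma lin_zero [simp]: "lin L 0 = 0"
  by (simp add: lin_def)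

lemma lin_add: "lin L (u + v) = lin L u + lin L v"
proof -
  let ?S = "Poly_Mapping.keys u \<union> Poly_Mapping.keys v"
  have "lin L (u + v) = (\<Sum>m\<in>?S. cst (Poly_Mapping.lookup (u + v) m) * L m)"
    by (rule lin_superset) (use keys_add[of u v] in auto)
  also have "\<dots> = (\<Sum>m\<in>?S. cst (Poly_Mapping.lookup u m) * L m) + (\<Sum>m\<in>?S. cst (Poly_Mapping.lookup v m) * L m)"
    by (simp add: lookup_add cst_add distrib_right sum.distrib)
  finally show ?thesis by (subst (1 2) lin_superset[where S = ?S]) auto
qed

lemma lin_cst: "lin L (cst c * u) = cst c * lin L u"
  for u :: "'a::comm_monoid_add \<Rightarrow>\<^sub>0 'd::comm_ring_1"
proof -
  have "lin L (cst c * u) = (\<Sum>m\<in>Poly_Mapping.keys u. cst (Poly_Mapping.lookup (cst c * u) m) * L m)"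
    by (rule lin_superset) (auto simp: in_keys_iff lookup_cst_mult)
  then show ?thesis by (simp add: lin_def lookup_cst_mult cst_mult sum_distrib_left mult.assoc)
qed

lemma lin_sum: "lin L (\<Sum>i\<in>I. u i) = (\<Sum>i\<in>I. lin L (u i))"
  by (induction I rule: infinite_finite_induct) (simp_all add: lin_add)

lemma lin_diff: "lin L (u - v) = lin L u - lin L v"
  using lin_add[of L "u - v" v] by (simp add: algebra_simps)

lemma lin_single: "lin L (Poly_Mapping.single m c) = cst c * L m"
  by (simp add: lin_def)

section \<open>Derivatives of monomials\<close>

lemma prod_var: "(\<Prod>x\<in>X. var (c x)) = Poly_Mapping.single (\<Sum>x\<in>X. Poly_Mapping.single (c x) 1) 1"
  by (induction X rule: infinite_finite_induct) (simp_all add: var_def mult_single)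

lemma pdiff_eq_lin:
  "pdiff x p = lin (\<lambda>m. Poly_Mapping.single (m - Poly_Mapping.single x 1) (of_nat (Poly_Mapping.lookup m x))) p"
  by (simp add: pdiff_def lin_def cst_mult_single mult.commute)

lemma pdiff_sum: "pdiff a (\<Sum>i\<in>I. u i) = (\<Sum>i\<in>I. pdiff a (u i))"
  by (simp add: pdiff_eq_lin lin_sum)

lemma pdiff_cst: "pdiff a (cst c * u) = cst c * pdiff a u"
  by (simp add: pdiff_eq_lin lin_cst)

lemma single_sum: "Poly_Mapping.single m (\<Sum>x\<in>X. f x) = (\<Sum>x\<in>X. Poly_Mapping.single m (f x))"
  by (induction X rule: infinite_finite_induct) (simp_all add: single_add)

text \<open>Leibniz rule over positions instead of coordinates: \<open>c\<close> may repeat values,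
  and the exponent of \<open>a\<close> counts the positions with value \<open>a\<close>. Keeping
  positions apart is what later makes a contraction a pair of abstract edges.\<close>

lemma pdiff_prod_var:
  fixes c :: "'x \<Rightarrow> 'y"
  assumes "finite X"
  shows "pdiff a (\<Prod>x\<in>X. var (c x) :: ('y, 'k::field_char_0) kpoly) = (\<Sum>x\<in>X. cst (of_bool (c x = a)) * (\<Prod>y\<in>X - {x}. var (c y)))"
proof -
  let ?m = "\<lambda>X. \<Sum>x\<in>X. Poly_Mapping.single (c x) (1::nat)"
  have "pdiff a (\<Prod>x\<in>X. var (c x) :: ('y, 'k) kpoly) = Poly_Mapping.single (?m X - Poly_Mapping.single a 1) (of_nat (Poly_Mapping.lookup (?m X) a))"
    by (simp add: pdiff_eq_lin prod_var lin_single)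
  also have "Poly_Mapping.lookup (?m X) a = (\<Sum>x\<in>X. of_bool (c x = a))"
    unfolding lookup_sum by (intro sum.cong) (auto simp: lookup_single)
  also have "Poly_Mapping.single (?m X - Poly_Mapping.single a 1) (of_nat (\<Sum>x\<in>X. of_bool (c x = a)))
      = (\<Sum>x\<in>X. Poly_Mapping.single (?m X - Poly_Mapping.single a 1) (of_bool (c x = a) :: 'k poly))"
    unfolding of_nat_sum of_nat_of_bool by (rule single_sum)
  also have "\<dots> = (\<Sum>x\<in>X. cst (of_bool (c x = a)) * (\<Prod>y\<in>X - {x}. var (c y)))"
  proof (intro sum.cong refl)
    fix x assume "x \<in> X"
    \<comment> \<open>If \<open>c x = a\<close>, the truncated subtraction of exponents removes
      exactly this summand; otherwise the coefficient is 0.\<close>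
    then have "?m X = Poly_Mapping.single (c x) 1 + ?m (X - {x})" using assms by (rule sum.remove[rotated])
    then show "Poly_Mapping.single (?m X - Poly_Mapping.single a 1) (of_bool (c x = a) :: 'k poly)
        = cst (of_bool (c x = a)) * (\<Prod>y\<in>X - {x}. var (c y))"
      by (cases "c x = a") (simp_all add: prod_var)
  qed
  finally show ?thesis .
qed

section \<open>The Moyal product of monomials\<close>

lemma sum_swap_past_two:
  "(\<Sum>q\<in>B. \<Sum>i\<in>I. \<Sum>j\<in>K. g q i j) = (\<Sum>i\<in>I. \<Sum>j\<in>K. \<Sum>q\<in>B. g q i j)"
  by (subst sum.swap, rule sum.cong[OF refl], rule sum.swap)

lemma sum_swap_pairs:
  "(\<Sum>p\<in>A. \<Sum>q\<in>B. \<Sum>i\<in>I. \<Sum>j\<in>K. g p q i j) = (\<Sum>i\<in>I. \<Sum>j\<in>K. \<Sum>p\<in>A. \<Sum>q\<in>B. g p q i j)"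
  by (subst sum_swap_past_two[symmetric], rule sum.cong[OF refl], rule sum_swap_past_two)

lemma bidiff_bilinear:
  "bidiff Q l n (\<Sum>i\<in>I. cst (a i) * u i) (\<Sum>j\<in>K. cst (b j) * v j)
     = (\<Sum>i\<in>I. \<Sum>j\<in>K. cst (a i * b j) * bidiff Q l n (u i) (v j))"
proof (induction n arbitrary: u v)
  case 0
  then show ?case by (simp add: sum_product cst_mult ac_simps)
next
  case (Suc n)
  have "bidiff Q l (Suc n) (\<Sum>i\<in>I. cst (a i) * u i) (\<Sum>j\<in>K. cst (b j) * v j)
     = (\<Sum>p\<in>coords Q l. \<Sum>q\<in>coords Q l. \<Sum>i\<in>I. \<Sum>j\<in>K.
         cst (a i * b j) * (bivector p q * bidiff Q l n (pdiff p (u i)) (pdiff q (v j))))"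
    by (simp only: bidiff.simps pdiff_sum pdiff_cst Suc sum_distrib_left mult.left_commute)
  also have "\<dots> = (\<Sum>i\<in>I. \<Sum>j\<in>K. \<Sum>p\<in>coords Q l. \<Sum>q\<in>coords Q l.
         cst (a i * b j) * (bivector p q * bidiff Q l n (pdiff p (u i)) (pdiff q (v j))))"
    by (rule sum_swap_pairs)
  finally show ?case by (simp add: sum_distrib_left)
qed

text \<open>Partial matchings, kept as sets of pairs so that one more contraction is an
  \<open>insert\<close>.\<close>

definition matchings :: "'a set \<Rightarrow> 'b set \<Rightarrow> ('a \<times> 'b) set set" where
  "matchings X Y = {M. M \<subseteq> X \<times> Y \<and> inj_on fst M \<and> inj_on snd M}"

lemma finite_matchings: "finite X \<Longrightarrow> finite Y \<Longrightarrow> finite (matchings X Y)"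
  by (rule finite_subset[of _ "Pow (X \<times> Y)"]) (auto simp: matchings_def)

lemma finite_in_matchings: "finite X \<Longrightarrow> finite Y \<Longrightarrow> M \<in> matchings X Y \<Longrightarrow> finite M"
  by (auto simp: matchings_def intro: finite_subset[of _ "X \<times> Y"])

lemma insert_matching:
  assumes "x \<in> X" "y \<in> Y" "M \<in> matchings (X - {x}) (Y - {y})"
  shows "insert (x, y) M \<in> matchings X Y" "(x, y) \<notin> M"
  using assms by (fastforce simp: matchings_def inj_on_def)+

lemma remove_matching:
  assumes "M \<in> matchings X Y" "(x, y) \<in> M"
  shows "M - {(x, y)} \<in> matchings (X - {x}) (Y - {y})"
  using assms by (fastforce simp: matchings_def inj_on_def)

definition wick :: "('x \<Rightarrow> 'y \<Rightarrow> 'r) \<Rightarrow> ('x \<Rightarrow> 'r) \<Rightarrow> ('y \<Rightarrow> 'r) \<Rightarrow> 'x set \<Rightarrow> 'y set \<Rightarrow> ('x \<times> 'y) set \<Rightarrow> 'r::comm_ring_1" where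
  "wick \<pi> u v X Y M = (\<Prod>(x, y)\<in>M. \<pi> x y) * (\<Prod>x\<in>X - fst ` M. u x) * (\<Prod>y\<in>Y - snd ` M. v y)"

lemma wick_insert:
  assumes "finite M" "(x, y) \<notin> M"
  shows "wick \<pi> u v X Y (insert (x, y) M) = \<pi> x y * wick \<pi> u v (X - {x}) (Y - {y}) M"
proof -
  have "X - fst ` insert (x, y) M = X - {x} - fst ` M" "Y - snd ` insert (x, y) M = Y - {y} - snd ` M" by auto
  then show ?thesis using assms by (simp add: wick_def mult.assoc)
qed

text \<open>A matching of size \<open>n + 1\<close> arises from each of its \<open>n + 1\<close> edges, whence the factorial below.\<close>

lemma sum_matchings_Suc:
  fixes \<pi> :: "'x \<Rightarrow> 'y \<Rightarrow> 'r::comm_ring_1"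
  assumes fin: "finite X" "finite Y"
  shows "(\<Sum>x\<in>X. \<Sum>y\<in>Y. \<pi> x y * (\<Sum>M | M \<in> matchings (X - {x}) (Y - {y}) \<and> card M = n. wick \<pi> u v (X - {x}) (Y - {y}) M))
    = of_nat (Suc n) * (\<Sum>M | M \<in> matchings X Y \<and> card M = Suc n. wick \<pi> u v X Y M)"
proof -
  let ?A = "\<lambda>(x, y). {M \<in> matchings (X - {x}) (Y - {y}). card M = n}"
  let ?C = "{M \<in> matchings X Y. card M = Suc n}"
  have finA: "finite (?A q)" for q by (cases q) (simp add: finite_matchings fin)
  have finC: "finite ?C" by (simp add: finite_matchings fin)
  have finM: "finite M" if "M \<in> matchings X Y \<or> M \<in> matchings (X - {x}) (Y - {y})" for M x y
    using that finite_in_matchings fin by blast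
  have main: "\<pi> x y * (\<Sum>M\<in>?A (x, y). wick \<pi> u v (X - {x}) (Y - {y}) M) = (\<Sum>M\<in>?A (x, y). wick \<pi> u v X Y (insert (x, y) M))"
    for x y
    unfolding sum_distrib_left
  proof (rule sum.cong[OF refl])
    fix M assume "M \<in> ?A (x, y)"
    then have M: "M \<in> matchings (X - {x}) (Y - {y})" by simp
    then have "(x, y) \<notin> M" by (auto simp: matchings_def)
    with M show "\<pi> x y * wick \<pi> u v (X - {x}) (Y - {y}) M = wick \<pi> u v X Y (insert (x, y) M)"
      using finM[of M x y] by (simp add: wick_insert)
  qed
  have "(\<Sum>x\<in>X. \<Sum>y\<in>Y. \<pi> x y * (\<Sum>M\<in>?A (x, y). wick \<pi> u v (X - {x}) (Y - {y}) M))
      = (\<Sum>q\<in>X \<times> Y. \<Sum>M\<in>?A q. wick \<pi> u v X Y (insert q M))"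
    unfolding main by (simp only: sum.cartesian_product case_prod_unfold prod.collapse)
  also have "\<dots> = (\<Sum>(q, M)\<in>Sigma (X \<times> Y) ?A. wick \<pi> u v X Y (insert q M))"
    by (rule sum.Sigma) (use fin finA in auto)
  \<comment> \<open>Both sides run over the matchings of size \<open>n + 1\<close> with one marked
    pair \<open>q\<close>.\<close>
  also have "\<dots> = (\<Sum>(M, q)\<in>Sigma ?C (\<lambda>M. M). wick \<pi> u v X Y M)"
  proof (rule sum.reindex_bij_witness[where i = "\<lambda>(M, q). (q, M - {q})" and j = "\<lambda>(q, M). (insert q M, q)"], goal_cases)
    case (1 a)
    then obtain x y M where a: "a = ((x, y), M)" "x \<in> X" "y \<in> Y" "M \<in> matchings (X - {x}) (Y - {y})" by auto
    then show ?case using insert_matching[of x X y Y M] by simp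
  next
    case (2 a)
    then obtain x y M where a: "a = ((x, y), M)" "x \<in> X" "y \<in> Y" "M \<in> matchings (X - {x}) (Y - {y})" "card M = n" by auto
    then show ?case using insert_matching[of x X y Y M] finM[of M x y] by simp
  next
    case (3 b)
    then show ?case by auto
  next
    case (4 b)
    then obtain x y M where b: "b = (M, (x, y))" "M \<in> matchings X Y" "(x, y) \<in> M" "card M = Suc n" by auto
    then have "x \<in> X" "y \<in> Y" by (auto simp: matchings_def)
    then show ?case using b remove_matching[of M X Y x y] finM[of M x y] by (simp add: card_Diff_singleton)
  qed auto
  also have "\<dots> = (\<Sum>M\<in>?C. \<Sum>q\<in>M. wick \<pi> u v X Y M)"
    by (rule sum.Sigma[symmetric]) (use finC finM in auto)
  also have "\<dots> = (\<Sum>M\<in>?C. of_nat (Suc n) * wick \<pi> u v X Y M)" by (intro sum.cong) auto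
  finally show ?thesis by (simp add: sum_distrib_left)
qed

lemma sum_of_bool_eq:
  assumes "finite A" "a \<in> A"
  shows "(\<Sum>x\<in>A. of_bool (a = x) * f x) = (f a :: 'r::comm_ring_1)"
  using assms by (simp add: of_bool_def if_distrib[of "\<lambda>x. x * _"] cong: if_cong)

lemma sum_of_bool_eq2:
  assumes "finite A" "a \<in> A" "b \<in> A"
  shows "(\<Sum>p\<in>A. \<Sum>q\<in>A. of_bool (a = p) * (of_bool (b = q) * g p q)) = (g a b :: 'r::comm_ring_1)"
  by (simp only: sum_distrib_left[symmetric] sum_of_bool_eq[OF assms(1,2)] sum_of_bool_eq[OF assms(1,3)])

text \<open>By the Leibniz rule each application of the bivector contracts one position of
  \<open>X\<close> with one of \<open>Y\<close>; the factorial counts the orders in which the pairs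
  of a matching can be contracted.\<close>

lemma bidiff_prod_var:
  fixes c :: "'x \<Rightarrow> 'e dedge coord" and d :: "'y \<Rightarrow> 'e dedge coord"
  assumes "finite (coords Q l)" "finite X" "finite Y" "c ` X \<subseteq> coords Q l" "d ` Y \<subseteq> coords Q l"
  shows "bidiff Q l n (\<Prod>x\<in>X. var (c x)) (\<Prod>y\<in>Y. var (d y) :: ('e dedge coord, 'k::field_char_0) kpoly)
    = of_nat (fact n) * (\<Sum>M | M \<in> matchings X Y \<and> card M = n.
        wick (\<lambda>x y. bivector (c x) (d y)) (\<lambda>x. var (c x)) (\<lambda>y. var (d y)) X Y M)"
  using assms(2-)
proof (induction n arbitrary: X Y)
  case 0
  then have "{M. M \<in> matchings X Y \<and> card M = 0} = {{}}"
    using finite_in_matchings[of X Y] by (auto simp: matchings_def)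
  then show ?case by (simp add: wick_def)
next
  case (Suc n)
  let ?C = "coords Q l" let ?\<pi> = "\<lambda>x y. bivector (c x) (d y) :: ('e dedge coord, 'k) kpoly"
  let ?S = "\<lambda>x y. \<Sum>M | M \<in> matchings (X - {x}) (Y - {y}) \<and> card M = n.
        wick ?\<pi> (\<lambda>x. var (c x)) (\<lambda>y. var (d y)) (X - {x}) (Y - {y}) M"
  have inner: "bidiff Q l n (pdiff a (\<Prod>x\<in>X. var (c x))) (pdiff b (\<Prod>y\<in>Y. var (d y)))
     = (\<Sum>x\<in>X. \<Sum>y\<in>Y. cst (of_bool (c x = a) * of_bool (d y = b)) * (of_nat (fact n) * ?S x y))" for a b
    unfolding pdiff_prod_var[OF Suc.prems(1)] pdiff_prod_var[OF Suc.prems(2)] bidiff_bilinear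
    by (intro sum.cong arg_cong2[where f = "(*)"] refl Suc.IH) (use Suc.prems in auto)
  have "bidiff Q l (Suc n) (\<Prod>x\<in>X. var (c x)) (\<Prod>y\<in>Y. var (d y))
     = (\<Sum>a\<in>?C. \<Sum>b\<in>?C. bivector a b * (\<Sum>x\<in>X. \<Sum>y\<in>Y. of_bool (c x = a) * (of_bool (d y = b) *
          (of_nat (fact n) * ?S x y))))"
    by (simp only: bidiff.simps inner cst_mult cst_of_bool mult.assoc)
  also have "\<dots> = (\<Sum>a\<in>?C. \<Sum>b\<in>?C. \<Sum>x\<in>X. \<Sum>y\<in>Y. of_bool (c x = a) * (of_bool (d y = b) *
          (bivector a b * (of_nat (fact n) * ?S x y))))"
    by (simp only: sum_distrib_left ac_simps)
  also have "\<dots> = (\<Sum>x\<in>X. \<Sum>y\<in>Y. \<Sum>a\<in>?C. \<Sum>b\<in>?C. of_bool (c x = a) * (of_bool (d y = b) *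
          (bivector a b * (of_nat (fact n) * ?S x y))))"
    by (rule sum_swap_pairs)
  \<comment> \<open>The deltas of the Leibniz rule collapse the sums over coordinates to the pair
    \<open>c x\<close>, \<open>d y\<close>, which lies in their range.\<close>
  also have "\<dots> = (\<Sum>x\<in>X. \<Sum>y\<in>Y. ?\<pi> x y * (of_nat (fact n) * ?S x y))"
    by (intro sum.cong refl sum_of_bool_eq2 assms(1)) (use Suc.prems in auto)
  also have "\<dots> = of_nat (fact n) * (\<Sum>x\<in>X. \<Sum>y\<in>Y. ?\<pi> x y * ?S x y)"
    by (simp add: sum_distrib_left ac_simps)
  finally show ?case unfolding sum_matchings_Suc[OF Suc.prems(1,2)]
    by (simp only: fact_Suc of_nat_mult of_nat_id mult.assoc mult.left_commute)
qed

lemma sum_by_card: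
  assumes "finite A" "\<And>M. M \<in> A \<Longrightarrow> card M \<le> N"
  shows "(\<Sum>n\<le>N. \<Sum>M | M \<in> A \<and> card M = n. f n M) = (\<Sum>M\<in>A. f (card M) M)"
proof -
  have "(\<Sum>n\<le>N. \<Sum>M | M \<in> A \<and> card M = n. f n M) = (\<Sum>n\<le>N. \<Sum>M | M \<in> A \<and> card M = n. f (card M) M)"
    by (intro sum.cong) auto
  also have "\<dots> = (\<Sum>M\<in>A. f (card M) M)"
    by (rule sum.group) (use assms in auto)
  finally show ?thesis .
qed

lemma matching_card_le: "finite X \<Longrightarrow> finite Y \<Longrightarrow> M \<in> matchings X Y \<Longrightarrow> card M \<le> card X"
  by (rule card_inj_on_le[where f = fst]) (auto simp: matchings_def)

text \<open>\<open>Sum_any\<close> is 0 when infinitely many terms are nonzero, so computations with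
  \<open>moyal\<close> start from a bound on the order of the nonvanishing terms.\<close>

lemma moyal_eq_sum:
  assumes "\<And>n. n > N \<Longrightarrow> bidiff Q l n u v = 0"
  shows "moyal Q l u v = (\<Sum>n\<le>N. cst (monom (1 / (2 ^ n * fact n)) n) * bidiff Q l n u v)"
  unfolding moyal_def
proof (rule Sum_any.expand_superset)
  show "{n. cst (monom (1 / (2 ^ n * fact n)) n) * bidiff Q l n u v \<noteq> 0} \<subseteq> {..N}"
    using assms by clarsimp (metis mult_zero_right not_le)
qed simp

lemma bidiff_prod_var_zero:
  assumes "finite (coords Q l)" "finite X" "finite Y" "c ` X \<subseteq> coords Q l" "d ` Y \<subseteq> coords Q l" "n > card X"
  shows "bidiff Q l n (\<Prod>x\<in>X. var (c x)) (\<Prod>y\<in>Y. var (d y)) = 0"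
proof -
  have "{M. M \<in> matchings X Y \<and> card M = n} = {}"
    using matching_card_le[OF assms(2,3)] assms(6) by force
  then show ?thesis by (simp only: bidiff_prod_var[OF assms(1-5)] sum.empty mult_zero_right)
qed

lemma moyal_prod_var:
  fixes c :: "'x \<Rightarrow> 'e dedge coord" and d :: "'y \<Rightarrow> 'e dedge coord"
  assumes "finite (coords Q l)" "finite X" "finite Y" "c ` X \<subseteq> coords Q l" "d ` Y \<subseteq> coords Q l"
  shows "moyal Q l (\<Prod>x\<in>X. var (c x)) (\<Prod>y\<in>Y. var (d y) :: ('e dedge coord, 'k::field_char_0) kpoly)
    = (\<Sum>M\<in>matchings X Y. cst (monom (1 / 2 ^ card M) (card M)) *
        wick (\<lambda>x y. bivector (c x) (d y)) (\<lambda>x. var (c x)) (\<lambda>y. var (d y)) X Y M)"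
proof -
  let ?w = "wick (\<lambda>x y. bivector (c x) (d y)) (\<lambda>x. var (c x)) (\<lambda>y. var (d y)) X Y :: _ \<Rightarrow> ('e dedge coord, 'k) kpoly"
  have coef: "cst (monom (1 / (2 ^ n * fact n)) n) * (of_nat (fact n) * z) = cst (monom (1 / 2 ^ n :: 'k) n) * z"
    for n and z :: "('e dedge coord, 'k) kpoly"
  proof -
    have "monom (1 / (2 ^ n * fact n)) n * of_nat (fact n) = (monom (1 / 2 ^ n) n :: 'k poly)"
      by (simp add: of_nat_poly smult_monom)
    then show ?thesis by (metis cst_mult cst_of_nat mult.assoc)
  qed
  have "moyal Q l (\<Prod>x\<in>X. var (c x)) (\<Prod>y\<in>Y. var (d y))
      = (\<Sum>n\<le>card X. cst (monom (1 / (2 ^ n * fact n)) n) *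
          bidiff Q l n (\<Prod>x\<in>X. var (c x)) (\<Prod>y\<in>Y. var (d y) :: ('e dedge coord, 'k) kpoly))"
    by (rule moyal_eq_sum) (rule bidiff_prod_var_zero[OF assms])
  also have "\<dots> = (\<Sum>n\<le>card X. \<Sum>M | M \<in> matchings X Y \<and> card M = n. cst (monom (1 / 2 ^ n) n) * ?w M)"
    unfolding bidiff_prod_var[OF assms] coef sum_distrib_left ..
  also have "\<dots> = (\<Sum>M\<in>matchings X Y. cst (monom (1 / 2 ^ card M) (card M)) * ?w M)"
    by (rule sum_by_card[where f = "\<lambda>n M. cst (monom (1 / 2 ^ n) n) * ?w M"])
      (simp_all add: finite_matchings matching_card_le[OF assms(2,3)] assms(2,3))
  finally show ?thesis .
qed

lemma moyal_bilinear:
  fixes u :: "'i \<Rightarrow> ('e dedge coord, 'k::field_char_0) kpoly"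
  assumes "finite I" "finite K"
    and van: "\<And>i j n. i \<in> I \<Longrightarrow> j \<in> K \<Longrightarrow> n > N i \<Longrightarrow> bidiff Q l n (u i) (v j) = 0"
  shows "moyal Q l (\<Sum>i\<in>I. cst (a i) * u i) (\<Sum>j\<in>K. cst (b j) * v j)
     = (\<Sum>i\<in>I. \<Sum>j\<in>K. cst (a i * b j) * moyal Q l (u i) (v j))"
proof -
  \<comment> \<open>A common upper bound for the orders of all the factors; the sum serves for empty
    \<open>I\<close> as well.\<close>
  define B where "B = sum N I"
  have le: "N i \<le> B" if "i \<in> I" for i
    unfolding B_def using that assms(1) by (intro member_le_sum) auto
  let ?e = "\<lambda>n. cst (monom (1 / (2 ^ n * fact n)) n)"
  have 1: "moyal Q l (u i) (v j) = (\<Sum>n\<le>B. ?e n * bidiff Q l n (u i) (v j))" if "i \<in> I" "j \<in> K" for i j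
    by (rule moyal_eq_sum) (use van[OF that] le[OF that(1)] in auto)
  have "moyal Q l (\<Sum>i\<in>I. cst (a i) * u i) (\<Sum>j\<in>K. cst (b j) * v j)
      = (\<Sum>n\<le>B. ?e n * bidiff Q l n (\<Sum>i\<in>I. cst (a i) * u i) (\<Sum>j\<in>K. cst (b j) * v j))"
  proof (rule moyal_eq_sum)
    fix n assume "n > B"
    then have "bidiff Q l n (u i) (v j) = 0" if "i \<in> I" "j \<in> K" for i j
      using van[OF that] le[OF that(1)] by auto
    then show "bidiff Q l n (\<Sum>i\<in>I. cst (a i) * u i) (\<Sum>j\<in>K. cst (b j) * v j) = 0"
      by (simp add: bidiff_bilinear)
  qed
  also have "\<dots> = (\<Sum>n\<le>B. \<Sum>i\<in>I. \<Sum>j\<in>K. cst (a i * b j) * (?e n * bidiff Q l n (u i) (v j)))"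
    by (simp only: bidiff_bilinear sum_distrib_left mult.left_commute)
  also have "\<dots> = (\<Sum>i\<in>I. \<Sum>j\<in>K. \<Sum>n\<le>B. cst (a i * b j) * (?e n * bidiff Q l n (u i) (v j)))"
    by (rule sum_swap_past_two)
  also have "\<dots> = (\<Sum>i\<in>I. \<Sum>j\<in>K. cst (a i * b j) * moyal Q l (u i) (v j))"
    by (intro sum.cong refl) (simp add: 1 sum_distrib_left)
  finally show ?thesis .
qed

section \<open>Closed walks\<close>

lemma coll_surj: "\<exists>p. coll p = P"
proof (induction P)
  case empty
  have "coll ([], []) = {#}" by (simp add: coll_def)
  then show ?case by blast
next
  case (add n P)
  then obtain ws vs where p: "coll (ws, vs) = P" by auto
  show ?case
  proof (cases n)
    case (Triv v)
    then have "coll (ws, v # vs) = add_mset n P" using p by (auto simp: coll_def)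
    then show ?thesis by blast
  next
    case (Cyc c)
    then have "coll (rep_cyclic c # ws, vs) = add_mset n P"
      using p Quotient3_abs_rep[OF Quotient3_cyclic, of c] by (auto simp: coll_def)
    then show ?thesis by blast
  qed
qed

lemma coll_present: "coll (present P) = P"
  unfolding present_def using coll_surj by (rule someI_ex)

lemma wf_digraph_double: "wf_digraph Q \<Longrightarrow> wf_digraph (double Q)"
  by (auto simp: wf_digraph_def double_def)

lemma rev_edge_rev_edge [simp]: "rev_edge (rev_edge a) = a"
  by (cases a) simp_all

lemma tail_rev_edge: "tail (double Q) (rev_edge a) = head (double Q) a"
  by (cases a) (simp_all add: double_def)

lemma head_rev_edge: "head (double Q) (rev_edge a) = tail (double Q) a"
  by (cases a) (simp_all add: double_def)

lemma finite_coords: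
  assumes "fin_digraph Q"
  shows "finite (coords Q l)"
proof -
  interpret fin_digraph Q by fact
  have "coords Q l \<subseteq> (SIGMA a:arcs (double Q). {..<l (tail (double Q) a)} \<times> {..<l (head (double Q) a)})"
    by (auto simp: coords_def)
  moreover have "finite (arcs (double Q))" by (simp add: double_def)
  ultimately show ?thesis by (auto intro: finite_subset)
qed

definition closed_walk :: "('v, 'e) pre_digraph \<Rightarrow> 'e dedge list \<Rightarrow> bool" where
  "closed_walk Q w \<longleftrightarrow> w \<noteq> [] \<and> (\<exists>u. pre_digraph.awalk (double Q) u w u)"

fun necklace_ok :: "('v, 'e) pre_digraph \<Rightarrow> ('v, 'e dedge) necklace \<Rightarrow> bool" where
  "necklace_ok Q (Triv v) \<longleftrightarrow> v \<in> verts Q"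
| "necklace_ok Q (Cyc c) \<longleftrightarrow> closed_walk Q (rep_cyclic c)"

context
  fixes Q :: "('v, 'e) pre_digraph"
  assumes Q: "wf_digraph Q"
begin

interpretation D: wf_digraph "double Q"
  using Q by (rule wf_digraph_double)

text \<open>Moving the first arc to the end shifts the base point to the head of that arc.\<close>

lemma closed_walk_rotate1: "closed_walk Q w \<Longrightarrow> closed_walk Q (rotate1 w)"
proof -
  assume "closed_walk Q w"
  then obtain x ys u where w: "w = x # ys" and u: "D.awalk u (x # ys) u"
    by (auto simp: closed_walk_def neq_Nil_conv)
  then have "D.awalk (head (double Q) x) (ys @ [x]) (head (double Q) x)"
    by (auto simp: D.awalk_Cons_iff D.awalk_Nil_iff intro!: D.awalk_appendI[of _ ys u] D.arc_implies_awalk)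
  then show ?thesis by (auto simp: closed_walk_def w)
qed

lemma closed_walk_rotate: "closed_walk Q w \<Longrightarrow> closed_walk Q (rotate n w)"
  by (induction n) (simp_all add: closed_walk_rotate1)

lemma closed_walk_rotate_iff: "closed_walk Q (rotate n w) \<longleftrightarrow> closed_walk Q w"
proof
  assume "closed_walk Q (rotate n w)"
  moreover obtain m where "w = rotate m (rotate n w)"
    using equivp_symp[OF rotate_equivp, of "rotate n w" w] by auto
  ultimately show "closed_walk Q w" using closed_walk_rotate by metis
qed (rule closed_walk_rotate)

lemma necklace_ok_abs: "necklace_ok Q (Cyc (abs_cyclic w)) \<longleftrightarrow> closed_walk Q w"
  using rep_abs_cyclic[of w] closed_walk_rotate_iff by auto

text \<open>Validity depends only on the multiset of necklaces, since rotations preserve closed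
  walks. Hence the presentation that \<open>present\<close> happens to choose is valid
  again.\<close>

lemma valid_pres_iff: "p \<in> valid_pres Q \<longleftrightarrow> (\<forall>n\<in>#coll p. necklace_ok Q n)"
proof (cases p)
  case (Pair ws vs)
  have "(\<forall>n\<in>#coll (ws, vs). necklace_ok Q n) \<longleftrightarrow> (\<forall>w\<in>set ws. closed_walk Q w) \<and> (\<forall>v\<in>set vs. v \<in> verts Q)"
    by (simp add: coll_def ball_Un necklace_ok_abs del: necklace_ok.simps(2))
  then show ?thesis by (auto simp: Pair valid_pres_def closed_walk_def)
qed

lemma present_valid: "P \<in> coll ` valid_pres Q \<Longrightarrow> present P \<in> valid_pres Q"
  unfolding valid_pres_iff by (elim imageE) (simp only: coll_present valid_pres_iff)

lemma awalk_nth: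
  "D.awalk u w v \<Longrightarrow> i < length w \<Longrightarrow> w ! i \<in> arcs (double Q) \<and>
    head (double Q) (w ! i) = (if Suc i < length w then tail (double Q) (w ! Suc i) else v)"
proof (induction w arbitrary: u i)
  case (Cons x w)
  then show ?case
    by (cases i; cases w) (auto simp: D.awalk_Cons_iff D.awalk_Nil_iff)
qed simp

text \<open>At the last letter of a word \<open>nxt\<close> wraps around to the first, and there the
  equality is the closedness of the walk.\<close>

lemma valid_pres_step:
  assumes "(ws, vs) \<in> valid_pres Q" "x \<in> abs_edges ws"
  shows "pr ws x \<in> arcs (double Q)" "tail (double Q) (pr ws (nxt ws x)) = head (double Q) (pr ws x)"
proof -
  obtain i j where x: "x = (i, j)" "i < length ws" "j < length (ws ! i)" using assms(2) by (auto simp: abs_edges_def)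
  then have "ws ! i \<in> set ws" by simp
  then obtain u where u: "D.awalk u (ws ! i) u" using assms(1) by (auto simp: valid_pres_def)
  then have "tail (double Q) (ws ! i ! 0) = u" using x by (cases "ws ! i") (auto simp: D.awalk_Cons_iff)
  then show "pr ws x \<in> arcs (double Q)" "tail (double Q) (pr ws (nxt ws x)) = head (double Q) (pr ws x)"
    using awalk_nth[OF u x(3)] x by (auto simp: pr_def nxt_def mod_Suc split: if_splits)
qed

section \<open>Traces as path sums\<close>

text \<open>\<open>psum\<close> knows row dimensions only. Along a walk the column dimension of each
  factor is the row dimension of the next, which makes the two products agree.\<close>

lemma gen_mat_product:
  fixes l :: "'v \<Rightarrow> nat"
  assumes "D.awalk u w v"
  defines "M \<equiv> foldr (\<lambda>a A. gen_mat Q l a * A) w (1\<^sub>m (l v)) :: ('e dedge coord, 'k::field_char_0) kpoly mat"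
  shows "M \<in> carrier_mat (l u) (l v) \<and>
    (\<forall>i<l u. \<forall>j<l v. M $$ (i, j) = psum (row_dim Q l) (\<lambda>a i j. var (a, i, j)) w i j)"
  using assms(1) unfolding M_def
proof (induction w arbitrary: u)
  case Nil
  then show ?case by (auto simp: D.awalk_Nil_iff)
next
  case (Cons x w)
  let ?M = "foldr (\<lambda>a A. gen_mat Q l a * A) w (1\<^sub>m (l v)) :: ('e dedge coord, 'k) kpoly mat"
  have x: "u = tail (double Q) x" "D.awalk (head (double Q) x) w v"
    using Cons.prems by (auto simp: D.awalk_Cons_iff)
  note IH = Cons.IH[OF x(2)]
  have G: "(gen_mat Q l x :: ('e dedge coord, 'k) kpoly mat) \<in> carrier_mat (l u) (l (head (double Q) x))" by (simp add: gen_mat_def x)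
  have "(gen_mat Q l x * ?M) $$ (i, j) = psum (row_dim Q l) (\<lambda>a i j. var (a, i, j)) (x # w) i j"
    if ij: "i < l u" "j < l v" for i j
  proof (cases w)
    case Nil
    then have "v = head (double Q) x" using x by (simp add: D.awalk_Nil_iff)
    \<comment> \<open>The identity matrix at the end of the fold disappears here, in accordance with
      the one-letter clause of \<open>psum\<close>.\<close>
    then have "gen_mat Q l x * ?M = gen_mat Q l x" using right_mult_one_mat[OF G] Nil by simp
    then show ?thesis using ij x Nil \<open>v = _\<close> by (simp add: gen_mat_def)
  next
    case (Cons y ys)
    have d: "l (head (double Q) x) = row_dim Q l y" using x Cons by (simp add: D.awalk_Cons_iff row_dim_def)
    have "(gen_mat Q l x * ?M) $$ (i, j) = (\<Sum>k<l (head (double Q) x). gen_mat Q l x $$ (i, k) * ?M $$ (k, j))"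
      using IH G carrier_matD[OF G] ij by (subst index_mult_mat) (auto simp: scalar_prod_def atLeast0LessThan)
    also have "\<dots> = (\<Sum>k<row_dim Q l y. var (x, i, k) * psum (row_dim Q l) (\<lambda>a i j. var (a, i, j)) w k j)"
      unfolding d[symmetric] using IH ij x by (intro sum.cong) (auto simp: gen_mat_def)
    finally show ?thesis using Cons by simp
  qed
  then show ?case using IH G by auto
qed

lemma tr_necklace_eq:
  assumes "necklace_ok Q n"
  shows "(tr_necklace Q l n :: ('e dedge coord, 'k::field_char_0) kpoly) = necklace_value (row_dim Q l) (\<lambda>a i j. var (a, i, j)) l n"
proof (cases n)
  case (Cyc c)
  let ?w = "rep_cyclic c"
  obtain u where w: "?w \<noteq> []" and u: "D.awalk u ?w u" using assms Cyc by (auto simp: closed_walk_def)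
  have t: "tail (double Q) (hd ?w) = u" using w u by (cases ?w) (auto simp: D.awalk_Cons_iff)
  show ?thesis using gen_mat_product[OF u, of l, where 'k = 'k] w t Cyc
    by (auto simp: Let_def mat_trace_def ctr_def row_dim_def intro!: sum.cong)
qed simp

lemma prod_tr_necklace_eq:
  assumes "\<And>n. n \<in># P \<Longrightarrow> necklace_ok Q n"
  shows "(\<Prod>n\<in>#P. tr_necklace Q l n) = coll_value (row_dim Q l) (\<lambda>a i j. var (a, i, j)) l P"
  unfolding coll_value_def using assms by (intro arg_cong[of _ _ prod_mset] image_mset_cong tr_necklace_eq)

lemma prod_tr_necklace_coll:
  assumes "(ws, vs) \<in> valid_pres Q"
  shows "(\<Prod>n\<in>#coll (ws, vs). tr_necklace Q l n) = (\<Prod>v\<leftarrow>vs. of_nat (l v)) *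
    (\<Sum>s\<in>PiE (abs_edges ws) (\<lambda>x. {..<row_dim Q l (pr ws x)}).
       \<Prod>x\<in>abs_edges ws. var (pr ws x, s x, s (nxt ws x)))"
  using assms by (subst prod_tr_necklace_eq) (simp_all add: valid_pres_iff coll_value_coll)

lemma coords_of_indices:
  assumes "(ws, vs) \<in> valid_pres Q" "s \<in> PiE (abs_edges ws) (\<lambda>x. {..<row_dim Q l (pr ws x)})" "x \<in> abs_edges ws"
  shows "(pr ws x, s x, s (nxt ws x)) \<in> coords Q l"
proof -
  have "s x < row_dim Q l (pr ws x)" "s (nxt ws x) < row_dim Q l (pr ws (nxt ws x))"
    using assms(2,3) nxt_in_abs_edges[OF assms(3)] by (auto simp: PiE_iff)
  then show ?thesis using valid_pres_step[OF assms(1,3)] by (simp add: coords_def row_dim_def)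
qed

text \<open>The edges in \<open>J\<close> act as trivial paths.\<close>

lemma awalk_filter:
  assumes "successively (\<lambda>x y. if x \<in> J then t x = t y else head (double Q) (e x) = t y) zs" "zs \<noteq> []"
    and "if last zs \<in> J then t (last zs) = v else head (double Q) (e (last zs)) = v"
    and "\<And>x. x \<in> set zs \<Longrightarrow> e x \<in> arcs (double Q) \<and> t x = tail (double Q) (e x)"
  shows "D.awalk (t (hd zs)) (map e (filter (\<lambda>x. x \<notin> J) zs)) v"
  using assms
proof (induction zs rule: induct_list012)
  case (2 x)
  then show ?case by (auto simp: D.awalk_Cons_iff D.awalk_Nil_iff)
next
  case (3 x y zs)
  have last: "last (x # y # zs) = last (y # zs)" by simp
  have "D.awalk (t (hd (y # zs))) (map e (filter (\<lambda>x. x \<notin> J) (y # zs))) v"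
    by (rule "3.IH"(2)) (use "3.prems"[unfolded last] in simp_all)
  with "3.prems" show ?case by (cases "x \<in> J") (auto simp: D.awalk_Cons_iff)
qed simp

text \<open>The matrix traces of a glued collection become path sums only along closed walks, so
  closedness has to survive the gluing.\<close>

lemma cut_glue_ok:
  assumes valid: "(ws, vs) \<in> valid_pres Q"
    and J: "J \<subseteq> abs_edges ws" "\<And>z. z \<in> J \<Longrightarrow> \<phi> z \<in> J \<and> \<phi> (\<phi> z) = z"
    and rev: "\<And>z. z \<in> J \<Longrightarrow> pr ws (\<phi> z) = rev_edge (pr ws z)"
    and n: "n \<in># cut_glue Q (ws, vs) J \<phi> (pr ws)"
  shows "necklace_ok Q n"
proof -
  let ?X = "abs_edges ws" let ?f = "glue_step ws J \<phi>"
  have f: "inj_on ?f ?X" "?f ` ?X \<subseteq> ?X"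
    using glue_step_permutes[of J ws \<phi>] J by blast+
  consider v where "v \<in> set vs" "n = Triv v" | C where "C \<in> orbit ?f ` ?X" "n = orbit_necklace Q ws J \<phi> (pr ws) C"
    using n by (auto simp: cut_glue_def)
  then show ?thesis
  proof cases
    case 1
    then show ?thesis using valid by (auto simp: valid_pres_def)
  next
    case (2 C)
    define z where "z = (SOME z. z \<in> C)"
    define zs where "zs = support ?f z"
    define ys where "ys = filter (\<lambda>x. x \<notin> J) zs"
    note o = orbit_partition(1)[OF finite_abs_edges f 2(1) z_def]
    have z: "z \<in> ?X" "set zs \<subseteq> ?X" "cycles_through ?f zs" "hd zs = z"
      using o by (auto simp: zs_def)
    show ?thesis
    proof (cases "ys = []")
      case True
      then have "n = Triv (tail (double Q) (pr ws z))"
        unfolding 2(2)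
        by (simp only: orbit_necklace_def Let_def z_def[symmetric] zs_def[symmetric] ys_def[symmetric] if_True simp_thms)
      then show ?thesis using valid_pres_step(1)[OF valid z(1)] D.tail_in_verts[of "pr ws z"]
        by (simp add: double_def)
    next
      case False
      then have n: "n = Cyc (abs_cyclic (map (pr ws) ys))"
        unfolding 2(2)
        by (simp only: orbit_necklace_def Let_def z_def[symmetric] zs_def[symmetric] ys_def[symmetric] if_False)
      let ?t = "\<lambda>x. tail (double Q) (pr ws x)"
      \<comment> \<open>For \<open>x\<close> in \<open>J\<close> the next edge starts at the head of
        the edge at \<open>\<phi> x\<close>, which is the tail of the edge at \<open>x\<close>
        because the two are reverse: passing \<open>x\<close> does not move.\<close>
      have step: "if x \<in> J then ?t x = ?t y else head (double Q) (pr ws x) = ?t y" if "x \<in> ?X" "?f x = y" for x y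
      proof (cases "x \<in> J")
        case True
        then have "\<phi> x \<in> ?X" using J by blast
        then show ?thesis using True that(2) valid_pres_step(2)[OF valid, of "\<phi> x"] rev[OF True]
          by (auto simp: glue_step_def head_rev_edge)
      next
        case False
        then show ?thesis using that valid_pres_step(2)[OF valid that(1)] by (auto simp: glue_step_def)
      qed
      have "zs \<noteq> []" "last zs \<in> ?X" using z by (auto simp: cycles_through_def)
      have "D.awalk (?t (hd zs)) (map (pr ws) (filter (\<lambda>x. x \<notin> J) zs)) (?t (hd zs))"
      proof (rule awalk_filter)
        show "successively (\<lambda>x y. if x \<in> J then ?t x = ?t y else head (double Q) (pr ws x) = ?t y) zs"
        proof (rule successively_mono)
          show "successively (\<lambda>x y. ?f x = y) zs" using z(3) by (simp add: cycles_through_def)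
        qed (use step z(2) in blast)
        show "if last zs \<in> J then ?t (last zs) = ?t (hd zs) else head (double Q) (pr ws (last zs)) = ?t (hd zs)"
          using z(3) \<open>last zs \<in> ?X\<close> by (intro step) (auto simp: cycles_through_def)
      qed (use \<open>zs \<noteq> []\<close> valid_pres_step(1)[OF valid] z(2) in auto)
      then have "closed_walk Q (map (pr ws) ys)" using False by (auto simp: closed_walk_def ys_def)
      then show ?thesis unfolding n necklace_ok_abs .
    qed
  qed
qed

end

section \<open>Matchings and gluings\<close>

text \<open>With the sign read off from the second edge, the sign of a contraction is the one in the
  product, which counts the chosen edges of the second factor that lie in the quiver.\<close>

lemma bracket_eq: "bracket e f = (if f = rev_edge e then if is_orig f then - 1 else 1 else 0)"
  by (cases e; cases f) (auto simp: bracket_def)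

definition gluings :: "('a \<Rightarrow> 'a \<Rightarrow> bool) \<Rightarrow> 'a set \<Rightarrow> 'a set \<Rightarrow> ('a set \<times> 'a set \<times> ('a \<Rightarrow> 'a)) set" where
  "gluings R X Y = {(A, B, \<phi>). A \<subseteq> X \<and> B \<subseteq> Y \<and> \<phi> \<in> A \<rightarrow>\<^sub>E B \<and> bij_betw \<phi> A B \<and> (\<forall>x\<in>A. R x (\<phi> x))}"

lemma matching_graph:
  assumes "(A, B, \<phi>) \<in> gluings R X Y"
  shows "(\<lambda>x. (x, \<phi> x)) ` A \<in> {M \<in> matchings X Y. \<forall>(x, y)\<in>M. R x y}"
    "fst ` (\<lambda>x. (x, \<phi> x)) ` A = A" "snd ` (\<lambda>x. (x, \<phi> x)) ` A = B" "card ((\<lambda>x. (x, \<phi> x)) ` A) = card A"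
proof -
  have *: "A \<subseteq> X" "B \<subseteq> Y" "inj_on \<phi> A" "\<phi> ` A = B" "\<forall>x\<in>A. R x (\<phi> x)"
    using assms by (auto simp: gluings_def bij_betw_def)
  then show "(\<lambda>x. (x, \<phi> x)) ` A \<in> {M \<in> matchings X Y. \<forall>(x, y)\<in>M. R x y}"
    by (auto simp: matchings_def inj_on_def)
  show "fst ` (\<lambda>x. (x, \<phi> x)) ` A = A" "snd ` (\<lambda>x. (x, \<phi> x)) ` A = B"
    using *(4) by (auto simp: image_image)
  show "card ((\<lambda>x. (x, \<phi> x)) ` A) = card A" by (rule card_image) (auto simp: inj_on_def)
qed

text \<open>A triple corresponds to the graph of its bijection: \<open>A\<close> and
  \<open>B\<close> are the projections of the graph, and extensionality makes \<open>\<phi>\<close>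
  unique.\<close>

lemma sum_matchings_eq_gluings:
  "(\<Sum>M | M \<in> matchings X Y \<and> (\<forall>(x, y)\<in>M. R x y). g M)
     = (\<Sum>(A, B, \<phi>)\<in>gluings R X Y. g ((\<lambda>x. (x, \<phi> x)) ` A))"
proof -
  let ?T = "gluings R X Y" let ?i = "\<lambda>(A, B, \<phi>). (\<lambda>x. (x, \<phi> x)) ` A"
  have inj: "inj_on ?i ?T"
  proof (rule inj_onI)
    fix a b assume ab: "a \<in> ?T" "b \<in> ?T" "?i a = ?i b"
    obtain A B \<phi> A' B' \<phi>' where eq: "a = (A, B, \<phi>)" "b = (A', B', \<phi>')" by (cases a, cases b)
    have *: "(A, B, \<phi>) \<in> ?T" "(A', B', \<phi>') \<in> ?T" "(\<lambda>x. (x, \<phi> x)) ` A = (\<lambda>x. (x, \<phi>' x)) ` A'"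
      using ab by (simp_all add: eq)
    have A: "A = A'" "B = B'" using matching_graph(2,3)[OF *(1)] matching_graph(2,3)[OF *(2)] *(3) by metis+
    have "\<phi> = \<phi>'"
    proof (rule extensionalityI[of _ A])
      show "\<phi> \<in> extensional A" "\<phi>' \<in> extensional A"
        using *(1,2) A by (auto simp: gluings_def PiE_def)
      fix x assume "x \<in> A"
      then have "(x, \<phi> x) \<in> (\<lambda>x. (x, \<phi>' x)) ` A'" using *(3) by blast
      then show "\<phi> x = \<phi>' x" by auto
    qed
    then show "a = b" using A eq by simp
  qed
  have "?i ` ?T = {M \<in> matchings X Y. \<forall>(x, y)\<in>M. R x y}"
  proof
    show "?i ` ?T \<subseteq> {M \<in> matchings X Y. \<forall>(x, y)\<in>M. R x y}"
    proof (rule image_subsetI)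
      fix a assume "a \<in> ?T"
      moreover obtain A B \<phi> where "a = (A, B, \<phi>)" by (cases a)
      ultimately show "?i a \<in> {M \<in> matchings X Y. \<forall>(x, y)\<in>M. R x y}"
        using matching_graph(1)[of A B \<phi> R X Y] by (simp only: prod.case)
    qed
    show "{M \<in> matchings X Y. \<forall>(x, y)\<in>M. R x y} \<subseteq> ?i ` ?T"
    proof
      fix M assume M: "M \<in> {M \<in> matchings X Y. \<forall>(x, y)\<in>M. R x y}"
      then have "inj_on fst M" "inj_on snd M" by (auto simp: matchings_def)
      then have uniq: "(x, y) \<in> M \<Longrightarrow> (x, y') \<in> M \<Longrightarrow> y = y'" "(x, y) \<in> M \<Longrightarrow> (x', y) \<in> M \<Longrightarrow> x = x'" for x x' y y'
        using inj_onD[of fst M "(x, y)" "(x, y')"] inj_onD[of snd M "(x, y)" "(x', y)"] by auto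
      define \<phi> where "\<phi> = (\<lambda>x\<in>fst ` M. THE y. (x, y) \<in> M)"
      have phi: "\<phi> x = y" if "(x, y) \<in> M" for x y
      proof -
        have "(THE y. (x, y) \<in> M) = y"
          using that uniq(1) by (intro the_equality) auto
        then show ?thesis using that by (force simp: \<phi>_def)
      qed
      have graph: "(\<lambda>x. (x, \<phi> x)) ` (fst ` M) = M"
        using phi by force
      have "bij_betw \<phi> (fst ` M) (snd ` M)"
      proof (rule bij_betw_imageI)
        show "inj_on \<phi> (fst ` M)"
        proof (rule inj_onI)
          fix x x' assume "x \<in> fst ` M" "x' \<in> fst ` M" and eq: "\<phi> x = \<phi> x'"
          then obtain y y' where M: "(x, y) \<in> M" "(x', y') \<in> M" by auto
          then have "y = y'" using eq phi by simp
          then show "x = x'" using M uniq(2) by blast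
        qed
        show "\<phi> ` fst ` M = snd ` M" using phi by force
      qed
      moreover have "\<phi> \<in> fst ` M \<rightarrow>\<^sub>E snd ` M"
      proof (rule PiE_I)
        show "\<phi> x \<in> snd ` M" if "x \<in> fst ` M" for x using that phi by force
      qed (simp add: \<phi>_def)
      ultimately have "(fst ` M, snd ` M, \<phi>) \<in> ?T"
        using M phi by (fastforce simp: gluings_def matchings_def)
      then show "M \<in> ?i ` ?T" using graph by (intro image_eqI[of _ _ "(fst ` M, snd ` M, \<phi>)"]) auto
    qed
  qed
  then show ?thesis
    using sum.reindex[OF inj, of g] by (simp add: case_prod_unfold o_def)
qed

lemma wick_cong:
  assumes "M \<subseteq> X \<times> Y" "\<And>x y. x \<in> X \<Longrightarrow> y \<in> Y \<Longrightarrow> \<pi> x y = \<pi>' x y"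
    "\<And>x. x \<in> X \<Longrightarrow> u x = u' x" "\<And>y. y \<in> Y \<Longrightarrow> v y = v' y"
  shows "wick \<pi> u v X Y M = wick \<pi>' u' v' X Y M"
  unfolding wick_def using assms by (intro arg_cong2[where f = "(*)"] prod.cong) auto

definition involution_of :: "'a set \<Rightarrow> ('a \<Rightarrow> 'a) \<Rightarrow> 'a \<Rightarrow> 'a" where
  "involution_of A \<phi> z = (if z \<in> A then \<phi> z else inv_into A \<phi> z)"

lemma involution_of:
  assumes "bij_betw \<phi> A B" "A \<inter> B = {}"
  shows "z \<in> A \<Longrightarrow> involution_of A \<phi> z = \<phi> z" "z \<in> A \<Longrightarrow> involution_of A \<phi> (\<phi> z) = z"
    "z \<in> A \<union> B \<Longrightarrow> involution_of A \<phi> z \<in> A \<union> B \<and> involution_of A \<phi> (involution_of A \<phi> z) = z"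
proof -
  have A: "\<phi> z \<in> B" "\<phi> z \<notin> A" "inv_into A \<phi> (\<phi> z) = z" if "z \<in> A" for z
    using that assms by (auto simp: bij_betw_def)
  have B: "inv_into A \<phi> z \<in> A" "\<phi> (inv_into A \<phi> z) = z" if "z \<in> B" for z
    using that assms by (auto simp: bij_betw_def inv_into_into f_inv_into_f)
  show "z \<in> A \<Longrightarrow> involution_of A \<phi> z = \<phi> z" "z \<in> A \<Longrightarrow> involution_of A \<phi> (\<phi> z) = z"
    using A by (auto simp: involution_of_def)
  show "z \<in> A \<union> B \<Longrightarrow> involution_of A \<phi> z \<in> A \<union> B \<and> involution_of A \<phi> (involution_of A \<phi> z) = z"
    using A B by (auto simp: involution_of_def)
qed

lemma prod_of_bool: "finite A \<Longrightarrow> (\<Prod>x\<in>A. of_bool (P x)) = (of_bool (\<forall>x\<in>A. P x) :: 'r::comm_semiring_1)"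
  by (induction A rule: finite_induct) auto

text \<open>For the reverse edges at \<open>x\<close> and \<open>\<phi> x\<close> the bivector is a
  sign times two deltas, one for each edge. They are the factors that
  \<open>coll_value_cut_glue\<close> gives to the elements of \<open>A\<close> and of
  \<open>B\<close>.\<close>

lemma wick_gluing:
  fixes ws :: "'e dedge list list" and s :: "nat \<times> nat \<Rightarrow> nat" and k :: "'e dedge coord \<Rightarrow> 'r::comm_ring_1"
  assumes fin: "finite X" "finite Y" and XY: "X \<inter> Y = {}"
    and T: "(A, B, \<phi>) \<in> gluings (\<lambda>x y. pr ws y = rev_edge (pr ws x)) X Y"
  defines "c \<equiv> \<lambda>x. (pr ws x, s x, s (nxt ws x))"
  shows "wick (\<lambda>x y. bivector (c x) (c y)) (\<lambda>x. k (c x)) (\<lambda>y. k (c y)) X Y ((\<lambda>x. (x, \<phi> x)) ` A)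
    = (- 1) ^ card {y \<in> B. is_orig (pr ws y)} *
      (\<Prod>x\<in>X \<union> Y. if x \<in> A \<union> B then of_bool (s x = s (nxt ws (involution_of A \<phi> x))) else k (c x))"
proof -
  have AB: "A \<subseteq> X" "B \<subseteq> Y" "bij_betw \<phi> A B" "\<And>x. x \<in> A \<Longrightarrow> pr ws (\<phi> x) = rev_edge (pr ws x)"
    using T by (auto simp: gluings_def)
  have finAB: "finite A" "finite B" and disj: "A \<inter> B = {}"
    using AB fin XY by (auto intro: finite_subset)
  note inv = involution_of[OF AB(3) disj]
  let ?e = "\<lambda>y. if is_orig (pr ws y) then - 1 else 1 :: 'r"
  let ?b = "\<lambda>x. of_bool (s x = s (nxt ws (involution_of A \<phi> x))) :: 'r"
  \<comment> \<open>The sign and the second delta are written as functions of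
    \<open>\<phi> x\<close>, so that their products over \<open>A\<close> can be reindexed over
    \<open>B\<close>.\<close>
  have biv: "bivector (c x) (c (\<phi> x)) = ?e (\<phi> x) * (?b x * ?b (\<phi> x))" if "x \<in> A" for x
    using AB(4)[OF that] inv(1,2)[OF that] by (auto simp: c_def bivector_def bracket_eq)
  have "(\<Prod>(x, y)\<in>(\<lambda>x. (x, \<phi> x)) ` A. bivector (c x) (c y)) = (\<Prod>x\<in>A. bivector (c x) (c (\<phi> x)) :: 'r)"
    by (subst prod.reindex) (auto simp: inj_on_def)
  also have "\<dots> = (\<Prod>x\<in>A. ?e (\<phi> x)) * ((\<Prod>x\<in>A. ?b x) * (\<Prod>x\<in>A. ?b (\<phi> x)))"
    using biv by (simp add: prod.distrib)
  also have "\<dots> = (\<Prod>y\<in>B. ?e y) * ((\<Prod>x\<in>A. ?b x) * (\<Prod>y\<in>B. ?b y))"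
    using prod.reindex_bij_betw[OF AB(3), of ?e] prod.reindex_bij_betw[OF AB(3), of ?b] by simp
  also have "(\<Prod>y\<in>B. ?e y) = (- 1) ^ card {y \<in> B. is_orig (pr ws y)}"
    using finAB by (simp add: prod.If_cases Int_def)
  finally have biv: "(\<Prod>(x, y)\<in>(\<lambda>x. (x, \<phi> x)) ` A. bivector (c x) (c y))
    = (- 1) ^ card {y \<in> B. is_orig (pr ws y)} * ((\<Prod>x\<in>A. ?b x) * (\<Prod>y\<in>B. ?b y))" .
  let ?G = "\<lambda>x. if x \<in> A \<union> B then ?b x else k (c x)"
  have "(\<Prod>x\<in>X \<union> Y. ?G x) = (\<Prod>x\<in>X. ?G x) * (\<Prod>y\<in>Y. ?G y)"
    by (rule prod.union_disjoint) (use fin XY in auto)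
  also have "(\<Prod>x\<in>X. ?G x) = (\<Prod>x\<in>X - A. ?G x) * (\<Prod>x\<in>A. ?G x)"
    by (rule prod.subset_diff[OF AB(1) fin(1)])
  also have "(\<Prod>y\<in>Y. ?G y) = (\<Prod>y\<in>Y - B. ?G y) * (\<Prod>y\<in>B. ?G y)"
    by (rule prod.subset_diff[OF AB(2) fin(2)])
  also have "(\<Prod>x\<in>X - A. ?G x) = (\<Prod>x\<in>X - A. k (c x))"
    by (rule prod.cong) (use XY AB(2) in auto)
  also have "(\<Prod>y\<in>Y - B. ?G y) = (\<Prod>y\<in>Y - B. k (c y))"
    by (rule prod.cong) (use XY AB(1) in auto)
  finally show ?thesis
    unfolding wick_def biv matching_graph(2,3)[OF T] by (simp add: ac_simps)
qed

lemma wick_not_reversing: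
  fixes u :: "nat \<times> nat \<Rightarrow> 'r::comm_ring_1"
  assumes "finite M" "(x, y) \<in> M" "pr ws y \<noteq> rev_edge (pr ws x)"
  shows "wick (\<lambda>x y. bivector (pr ws x, s x, s (nxt ws x)) (pr ws y, s y, s (nxt ws y))) u v X Y M = 0"
proof -
  have "(\<Prod>(x, y)\<in>M. bivector (pr ws x, s x, s (nxt ws x)) (pr ws y, s y, s (nxt ws y))) = (0 :: 'r)"
    by (rule prod_zero[OF assms(1)], rule bexI[OF _ assms(2)]) (use assms(3) in \<open>simp add: bivector_def bracket_eq\<close>)
  then show ?thesis by (simp add: wick_def)
qed

section \<open>Traces of products\<close>

lemma sum_PiE_reindex:
  assumes "inj_on h A"
  shows "(\<Sum>s\<in>PiE (h ` A) B. g s) = (\<Sum>s\<in>PiE A (\<lambda>x. B (h x)). g (\<lambda>y\<in>h ` A. s (inv_into A h y)))"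
proof (rule sum.reindex_bij_witness[where i = "\<lambda>s. \<lambda>y\<in>h ` A. s (inv_into A h y)" and j = "\<lambda>s. \<lambda>x\<in>A. s (h x)"], goal_cases)
  case (1 a)
  have "(\<lambda>y\<in>h ` A. (\<lambda>x\<in>A. a (h x)) (inv_into A h y)) y = a y" for y
    using 1 by (cases "y \<in> h ` A") (auto simp: inv_into_into f_inv_into_f PiE_iff extensional_def)
  then show ?case by blast
next
  case (2 a)
  then show ?case by (auto simp: PiE_iff)
next
  case (3 b)
  have "(\<lambda>x\<in>A. (\<lambda>y\<in>h ` A. b (inv_into A h y)) (h x)) x = b x" for x
    using 3 assms by (cases "x \<in> A") (auto simp: PiE_iff extensional_def)
  then show ?case by blast
next
  case (4 b)
  then show ?case using assms by (auto simp: PiE_iff)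
next
  case (5 a)
  have "(\<lambda>y\<in>h ` A. (\<lambda>x\<in>A. a (h x)) (inv_into A h y)) y = a y" for y
    using 5 by (cases "y \<in> h ` A") (auto simp: inv_into_into f_inv_into_f PiE_iff extensional_def)
  then have "(\<lambda>y\<in>h ` A. (\<lambda>x\<in>A. a (h x)) (inv_into A h y)) = a" by blast
  then show ?case by simp
qed

definition shift :: "nat \<Rightarrow> nat \<times> nat \<Rightarrow> nat \<times> nat" where
  "shift k = (\<lambda>(i, j). (k + i, j))"

lemma abs_edges_append: "abs_edges (ws @ ws') = abs_edges ws \<union> shift (length ws) ` abs_edges ws'"
proof (rule subset_antisym)
  show "abs_edges (ws @ ws') \<subseteq> abs_edges ws \<union> shift (length ws) ` abs_edges ws'"
  proof (rule subrelI)
    fix i j assume ij: "(i, j) \<in> abs_edges (ws @ ws')"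
    show "(i, j) \<in> abs_edges ws \<union> shift (length ws) ` abs_edges ws'"
    proof (cases "i < length ws")
      case True
      then show ?thesis using ij by (simp add: abs_edges_def nth_append)
    next
      case False
      then have "(i, j) = shift (length ws) (i - length ws, j)" "(i - length ws, j) \<in> abs_edges ws'"
        using ij by (auto simp: abs_edges_def shift_def nth_append)
      then show ?thesis by (intro UnI2 image_eqI)
    qed
  qed
  show "abs_edges ws \<union> shift (length ws) ` abs_edges ws' \<subseteq> abs_edges (ws @ ws')"
    by (auto simp: abs_edges_def shift_def nth_append)
qed

lemma abs_edges_disjoint: "abs_edges ws \<inter> shift (length ws) ` abs_edges ws' = {}"
  by (auto simp: abs_edges_def shift_def)

lemma nxt_pr_append:
  "x \<in> abs_edges ws \<Longrightarrow> nxt (ws @ ws') x = nxt ws x" "x \<in> abs_edges ws \<Longrightarrow> pr (ws @ ws') x = pr ws x"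
  "nxt (ws @ ws') (shift (length ws) y) = shift (length ws) (nxt ws' y)" "pr (ws @ ws') (shift (length ws) y) = pr ws' y"
  by (auto simp: abs_edges_def nxt_def pr_def shift_def nth_append split: prod.splits)

text \<open>The second factor gets indices on its edges inside the concatenated list, disjoint from
  those of the first factor; two independent assignments then merge into one.\<close>

lemma coll_value_coll_shift:
  fixes V :: "'x \<Rightarrow> nat \<Rightarrow> nat \<Rightarrow> 'r::comm_ring_1"
  defines "Y \<equiv> \<lambda>ws ws'. shift (length ws) ` abs_edges ws'"
  shows "coll_value d V l (coll (ws', vs)) = (\<Prod>v\<leftarrow>vs. of_nat (l v)) *
     (\<Sum>s\<in>PiE (Y ws ws') (\<lambda>x. {..<d (pr (ws @ ws') x)}).
        \<Prod>y\<in>Y ws ws'. V (pr (ws @ ws') y) (s y) (s (nxt (ws @ ws') y)))"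
proof -
  have inj: "inj_on (shift (length ws)) (abs_edges ws')" by (auto simp: inj_on_def shift_def)
  show ?thesis unfolding coll_value_coll Y_def sum_PiE_reindex[OF inj] prod.reindex[OF inj]
    by (intro arg_cong2[where f = "(*)"] sum.cong prod.cong refl)
      (simp_all add: nxt_pr_append inv_into_f_f[OF inj] nxt_in_abs_edges)
qed

section \<open>The product of collections and the Moyal product\<close>

context
  fixes Q :: "('v, 'e) pre_digraph" and l :: "'v \<Rightarrow> nat"
  assumes Q: "fin_digraph Q"
begin

interpretation Q: fin_digraph Q by (rule Q)

abbreviation "trace_prod P \<equiv> (\<Prod>n\<in>#P. tr_necklace Q l n)"

lemma bidiff_trace_prod_zero:
  assumes "(ws, vs) \<in> valid_pres Q" "(ws', vs') \<in> valid_pres Q" "n > card (abs_edges ws)"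
  shows "bidiff Q l n (trace_prod (coll (ws, vs))) (trace_prod (coll (ws', vs')) :: ('e dedge coord, 'k::field_char_0) kpoly) = 0"
proof -
  have "bidiff Q l n (\<Prod>x\<in>abs_edges ws. var (pr ws x, s x, s (nxt ws x)))
      (\<Prod>x\<in>abs_edges ws'. var (pr ws' x, t x, t (nxt ws' x)) :: ('e dedge coord, 'k) kpoly) = 0"
    if "s \<in> PiE (abs_edges ws) (\<lambda>x. {..<row_dim Q l (pr ws x)})" "t \<in> PiE (abs_edges ws') (\<lambda>x. {..<row_dim Q l (pr ws' x)})" for s t
    by (rule bidiff_prod_var_zero[OF finite_coords[OF Q]])
      (use coords_of_indices[OF Q.wf_digraph assms(1) that(1)] coords_of_indices[OF Q.wf_digraph assms(2) that(2)] assms(3) in auto)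
  then show ?thesis
    unfolding prod_tr_necklace_coll[OF Q.wf_digraph assms(1)] prod_tr_necklace_coll[OF Q.wf_digraph assms(2)]
      cst_prod_list sum_distrib_left bidiff_bilinear
    by simp
qed

text \<open>The Moyal side is a sum over assignments and matchings. After the two sums are
  exchanged, the sum over assignments for a fixed matching is, up to its coefficient, the trace of
  one glued collection.\<close>

lemma tr_star_pres:
  assumes p: "(ws1, vs1) \<in> valid_pres Q" and r: "(ws2, vs2) \<in> valid_pres Q"
  shows "tr Q l (star_pres Q (ws1, vs1) (ws2, vs2)) =
    moyal Q l (trace_prod (coll (ws1, vs1))) (trace_prod (coll (ws2, vs2)) :: ('e dedge coord, 'k::field_char_0) kpoly)"
proof -
  define ws where "ws = ws1 @ ws2"
  define X where "X = abs_edges ws1"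
  define Y where "Y = shift (length ws1) ` abs_edges ws2"
  define c where "c = (\<lambda>(s :: nat \<times> nat \<Rightarrow> nat) x. (pr ws x, s x, s (nxt ws x)))"
  define B where "B = (\<lambda>x. {..<row_dim Q l (pr ws x)})"
  define w where "w = (\<lambda>s t. wick (\<lambda>x y. bivector (c s x) (c t y)) (\<lambda>x. var (c s x)) (\<lambda>y. var (c t y)) X Y
    :: _ \<Rightarrow> ('e dedge coord, 'k) kpoly)"
  define R where "R = (\<lambda>x y. pr ws y = rev_edge (pr ws x))"
  let ?G = "gluings R X Y" let ?g = "\<lambda>A \<phi>. (\<lambda>x. (x, \<phi> x)) ` A :: ((nat \<times> nat) \<times> (nat \<times> nat)) set"
  let ?N = "\<lambda>vs. \<Prod>v\<leftarrow>vs. of_nat (l v) :: 'k poly"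
  let ?e = "\<lambda>M. monom (1 / 2 ^ card M) (card M) :: 'k poly"
  have fin: "finite X" "finite Y" and XY: "X \<inter> Y = {}" "X \<union> Y = abs_edges ws"
    by (simp_all add: X_def Y_def ws_def abs_edges_disjoint abs_edges_append)
  have valid: "(ws, vs1 @ vs2) \<in> valid_pres Q" using p r by (auto simp: valid_pres_def ws_def)
  have nX: "nxt ws x \<in> X" if "x \<in> X" for x
    using that nxt_in_abs_edges[of x ws1] by (simp add: X_def ws_def nxt_pr_append)
  have nY: "nxt ws y \<in> Y" if y: "y \<in> Y" for y
  proof -
    obtain z where "z \<in> abs_edges ws2" "y = shift (length ws1) z" using y by (auto simp only: Y_def)
    then show ?thesis using nxt_in_abs_edges[of z ws2] by (simp add: Y_def ws_def nxt_pr_append)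
  qed
  have T1: "trace_prod (coll (ws1, vs1)) = (\<Sum>s\<in>PiE X B. cst (?N vs1) * (\<Prod>x\<in>X. var (c s x)))"
    unfolding prod_tr_necklace_coll[OF Q.wf_digraph p] cst_prod_list sum_distrib_left X_def c_def B_def ws_def
    by (intro sum.cong PiE_cong prod.cong arg_cong2[where f = "(*)"]) (auto simp: nxt_pr_append)
  have "trace_prod (coll (ws2, vs2)) = coll_value (row_dim Q l) (\<lambda>a i j. var (a, i, j)) l (coll (ws2, vs2))"
    by (rule prod_tr_necklace_eq[OF Q.wf_digraph]) (use r in \<open>auto simp: valid_pres_iff[OF Q.wf_digraph]\<close>)
  then have T2: "trace_prod (coll (ws2, vs2)) = (\<Sum>t\<in>PiE Y B. cst (?N vs2) * (\<Prod>y\<in>Y. var (c t y)))"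
    unfolding coll_value_coll_shift[where ws = ws1] cst_prod_list sum_distrib_left Y_def c_def B_def ws_def .
  have cX: "c s x \<in> coords Q l" if "s \<in> PiE X B" "x \<in> X" for s x
    using coords_of_indices[OF Q.wf_digraph p, of s l x] that
    by (auto simp: c_def X_def B_def ws_def nxt_pr_append PiE_iff)
  have cY: "c t y \<in> coords Q l" if "t \<in> PiE Y B" "y \<in> Y" for t y
  proof -
    have "t y < row_dim Q l (pr ws y)" "t (nxt ws y) < row_dim Q l (pr ws (nxt ws y))"
      using that nY by (auto simp: PiE_iff B_def)
    moreover have "y \<in> abs_edges ws" using that XY by auto
    ultimately show ?thesis using valid_pres_step[OF Q.wf_digraph valid, of y]
      by (simp add: coords_def row_dim_def c_def)
  qed
  have zero: "w s s M = 0" if M: "M \<in> matchings X Y" "\<not> (\<forall>(x, y)\<in>M. R x y)" for s M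
  proof -
    obtain x y where xy: "(x, y) \<in> M" "pr ws y \<noteq> rev_edge (pr ws x)" using M(2) by (auto simp: R_def)
    show ?thesis unfolding w_def c_def
      by (rule wick_not_reversing[OF finite_in_matchings[OF fin M(1)] xy])
  qed
  have "moyal Q l (trace_prod (coll (ws1, vs1))) (trace_prod (coll (ws2, vs2)))
      = (\<Sum>s\<in>PiE X B. \<Sum>t\<in>PiE Y B. cst (?N vs1 * ?N vs2) * (moyal Q l (\<Prod>x\<in>X. var (c s x)) (\<Prod>y\<in>Y. var (c t y)) :: ('e dedge coord, 'k) kpoly))"
    unfolding T1 T2
  proof (rule moyal_bilinear[where N = "\<lambda>_. card X"])
    show "finite (PiE X B)" "finite (PiE Y B)" using fin by (auto simp: B_def intro: finite_PiE)
    show "bidiff Q l n (\<Prod>x\<in>X. var (c s x)) (\<Prod>y\<in>Y. var (c t y)) = 0"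
      if "s \<in> PiE X B" "t \<in> PiE Y B" "card X < n" for s t n
      by (rule bidiff_prod_var_zero[OF finite_coords[OF Q] fin]) (use that cX cY in auto)
  qed
  also have "\<dots> = (\<Sum>s\<in>PiE X B. \<Sum>t\<in>PiE Y B. cst (?N vs1 * ?N vs2) * (\<Sum>M\<in>matchings X Y. cst (?e M) * w s t M))"
  proof (intro sum.cong refl arg_cong2[where f = "(*)"])
    fix s t assume "s \<in> PiE X B" "t \<in> PiE Y B"
    then show "moyal Q l (\<Prod>x\<in>X. var (c s x)) (\<Prod>y\<in>Y. var (c t y)) = (\<Sum>M\<in>matchings X Y. cst (?e M) * w s t M)"
      unfolding w_def by (intro moyal_prod_var[OF finite_coords[OF Q] fin]) (use cX cY in auto)
  qed
  also have "\<dots> = (\<Sum>s\<in>PiE (X \<union> Y) B. cst (?N vs1 * ?N vs2) * (\<Sum>M\<in>matchings X Y. cst (?e M) * w (restrict s X) (restrict s Y) M))"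
    by (rule sum_PiE_Un[OF XY(1)])
  \<comment> \<open>\<open>nxt\<close> preserves \<open>X\<close> and \<open>Y\<close>, so both
    restrictions of the assignment can be replaced by the assignment itself.\<close>
  also have "\<dots> = (\<Sum>s\<in>PiE (X \<union> Y) B. cst (?N vs1 * ?N vs2) * (\<Sum>M\<in>matchings X Y. cst (?e M) * w s s M))"
    unfolding w_def
    by (intro sum.cong arg_cong2[where f = "(*)"] refl wick_cong)
      (auto simp: matchings_def c_def nX nY)
  \<comment> \<open>A matched pair of edges that are not reverse to each other has bracket 0 and
    kills its matching.\<close>
  also have "\<dots> = (\<Sum>s\<in>PiE (X \<union> Y) B. cst (?N vs1 * ?N vs2) * (\<Sum>M | M \<in> matchings X Y \<and> (\<forall>(x, y)\<in>M. R x y). cst (?e M) * w s s M))"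
    by (intro sum.cong arg_cong2[where f = "(*)"] refl sum.mono_neutral_right finite_matchings fin)
      (use zero in auto)
  also have "\<dots> = (\<Sum>s\<in>PiE (X \<union> Y) B. cst (?N vs1 * ?N vs2) * (\<Sum>(A, C, \<phi>)\<in>?G. cst (?e (?g A \<phi>)) * w s s (?g A \<phi>)))"
    unfolding sum_matchings_eq_gluings ..
  also have "\<dots> = (\<Sum>(A, C, \<phi>)\<in>?G. cst (?e (?g A \<phi>)) * (cst (?N vs1 * ?N vs2) * (\<Sum>s\<in>PiE (X \<union> Y) B. w s s (?g A \<phi>))))"
    by (simp only: sum_distrib_left case_prod_unfold sum.swap[of _ ?G] mult.left_commute)
  also have "\<dots> = (\<Sum>(A, C, \<phi>)\<in>?G. cst (monom ((- 1) ^ card {y \<in> C. is_orig (pr ws y)} / 2 ^ card A) (card A)) *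
      trace_prod (cut_glue Q (ws, vs1 @ vs2) (A \<union> C) (involution_of A \<phi>) (pr ws)))"
  proof (intro sum.cong refl, clarify)
    fix A C \<phi> assume T: "(A, C, \<phi>) \<in> ?G"
    have AC: "A \<subseteq> X" "C \<subseteq> Y" "bij_betw \<phi> A C" "\<And>x. x \<in> A \<Longrightarrow> pr ws (\<phi> x) = rev_edge (pr ws x)"
      using T by (auto simp: gluings_def R_def)
    have disj: "A \<inter> C = {}" using AC XY by auto
    note inv = involution_of[OF AC(3) disj]
    have sub: "A \<union> C \<subseteq> abs_edges ws" using AC XY by auto
    have rev: "pr ws (involution_of A \<phi> z) = rev_edge (pr ws z)" if "z \<in> A \<union> C" for z
    proof (cases "z \<in> A")
      case False
      then have "z \<in> \<phi> ` A" using that bij_betw_imp_surj_on[OF AC(3)] by simp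
      then obtain x where "x \<in> A" "z = \<phi> x" by blast
      then show ?thesis using AC(4) inv(2) by simp
    qed (use AC(4) inv(1) in simp)
    have dim: "row_dim Q l (pr ws (nxt ws (involution_of A \<phi> z))) = row_dim Q l (pr ws z)" if "z \<in> A \<union> C" for z
    proof -
      have "involution_of A \<phi> z \<in> abs_edges ws" using inv(3)[OF that] sub by blast
      then show ?thesis using valid_pres_step(2)[OF Q.wf_digraph valid] rev[OF that]
        by (simp add: row_dim_def head_rev_edge)
    qed
    have "trace_prod (cut_glue Q (ws, vs1 @ vs2) (A \<union> C) (involution_of A \<phi>) (pr ws))
       = coll_value (row_dim Q l) (\<lambda>a i j. var (a, i, j) :: ('e dedge coord, 'k) kpoly) l (cut_glue Q (ws, vs1 @ vs2) (A \<union> C) (involution_of A \<phi>) (pr ws))"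
      by (rule prod_tr_necklace_eq[OF Q.wf_digraph], rule cut_glue_ok[OF Q.wf_digraph valid sub inv(3) rev])
    also have "\<dots> = cst (?N vs1 * ?N vs2) * (\<Sum>s\<in>PiE (X \<union> Y) B. \<Prod>x\<in>X \<union> Y.
        if x \<in> A \<union> C then of_bool (s x = s (nxt ws (involution_of A \<phi> x))) else var (c s x))"
      by (subst coll_value_cut_glue[OF sub inv(3) dim])
        (simp_all add: B_def c_def XY cst_mult cst_prod_list row_dim_def cong: if_cong)
    finally have glue: "trace_prod (cut_glue Q (ws, vs1 @ vs2) (A \<union> C) (involution_of A \<phi>) (pr ws))
      = cst (?N vs1 * ?N vs2) * (\<Sum>s\<in>PiE (X \<union> Y) B. \<Prod>x\<in>X \<union> Y.
        if x \<in> A \<union> C then of_bool (s x = s (nxt ws (involution_of A \<phi> x))) else var (c s x) :: ('e dedge coord, 'k) kpoly)" .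
    let ?\<sigma> = "(- 1) ^ card {y \<in> C. is_orig (pr ws y)}"
    have "w s s (?g A \<phi>) = ?\<sigma> * (\<Prod>x\<in>X \<union> Y.
        if x \<in> A \<union> C then of_bool (s x = s (nxt ws (involution_of A \<phi> x))) else var (c s x))" for s
      unfolding w_def c_def by (rule wick_gluing[OF fin XY(1) T[unfolded R_def]])
    then have 1: "cst (?N vs1 * ?N vs2) * (\<Sum>s\<in>PiE (X \<union> Y) B. w s s (?g A \<phi>))
      = ?\<sigma> * trace_prod (cut_glue Q (ws, vs1 @ vs2) (A \<union> C) (involution_of A \<phi>) (pr ws))"
      unfolding glue by (simp add: sum_distrib_left[symmetric])
    have 2: "cst (?e (?g A \<phi>)) * ?\<sigma> = (cst (monom (?\<sigma> / 2 ^ card A) (card A)) :: ('e dedge coord, 'k) kpoly)"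
    proof -
      have m1: "[:- 1 :: 'k:] = - 1" by (simp add: one_pCons)
      have sgn: "(- 1) ^ n = (cst (monom ((- 1) ^ n) 0) :: ('e dedge coord, 'k) kpoly)" for n
        by (cases "even n") (simp_all add: monom_0 m1 cst_uminus flip: one_pCons)
      show ?thesis unfolding sgn cst_mult[symmetric] mult_monom matching_graph(4)[OF T] by simp
    qed
    show "cst (?e (?g A \<phi>)) * (cst (?N vs1 * ?N vs2) * (\<Sum>s\<in>PiE (X \<union> Y) B. w s s (?g A \<phi>)))
      = cst (monom (?\<sigma> / 2 ^ card A) (card A)) *
      trace_prod (cut_glue Q (ws, vs1 @ vs2) (A \<union> C) (involution_of A \<phi>) (pr ws))"
      unfolding 1 mult.assoc[symmetric] 2 ..
  qed
  also have "\<dots> = tr Q l (star_pres Q (ws1, vs1) (ws2, vs2))"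
  proof -
    have "star_pres Q (ws1, vs1) (ws2, vs2) = (\<Sum>(A, C, \<phi>)\<in>?G. Poly_Mapping.single
        (cut_glue Q (ws, vs1 @ vs2) (A \<union> C) (involution_of A \<phi>) (pr ws))
        (monom ((- 1) ^ card {y \<in> C. is_orig (pr ws y)} / 2 ^ card A :: 'k) (card A)))"
      unfolding star_pres_def Let_def gluings_def R_def ws_def X_def Y_def shift_def involution_of_def fst_conv snd_conv ..
    then show ?thesis
      unfolding tr_def lin_def[symmetric]
      by (simp only: lin_sum case_prod_unfold lin_single)
  qed
  finally show ?thesis by simp
qed

text \<open>Bilinear extension of the case of two collections. For each pair the order of
  nonvanishing terms is bounded by the number of edges of the first collection.\<close>

lemma tr_star:
  assumes "F \<in> symL Q" "G \<in> symL Q"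
  shows "tr Q l (star Q F G) = (moyal Q l (tr Q l F) (tr Q l G) :: ('e dedge coord, 'k::field_char_0) kpoly)"
proof -
  have pres: "present P \<in> valid_pres Q" if "P \<in> coll ` valid_pres Q" for P
    by (rule present_valid[OF Q.wf_digraph that])
  have F: "P \<in> coll ` valid_pres Q" if "P \<in> Poly_Mapping.keys F" for P using that assms by (auto simp: symL_def)
  have G: "P \<in> coll ` valid_pres Q" if "P \<in> Poly_Mapping.keys G" for P using that assms by (auto simp: symL_def)
  have "tr Q l (star Q F G) = (\<Sum>P\<in>Poly_Mapping.keys F. \<Sum>R\<in>Poly_Mapping.keys G.
      cst (Poly_Mapping.lookup F P * Poly_Mapping.lookup G R) * tr Q l (star_pres Q (present P) (present R)))"
    unfolding star_def tr_def[of Q l] lin_def[symmetric] by (simp only: lin_sum lin_cst)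
  also have "\<dots> = (\<Sum>P\<in>Poly_Mapping.keys F. \<Sum>R\<in>Poly_Mapping.keys G.
      cst (Poly_Mapping.lookup F P * Poly_Mapping.lookup G R) * moyal Q l (trace_prod P) (trace_prod R))"
  proof (intro sum.cong arg_cong2[where f = "(*)"] refl)
    fix P R assume "P \<in> Poly_Mapping.keys F" "R \<in> Poly_Mapping.keys G"
    then show "tr Q l (star_pres Q (present P) (present R)) =
        (moyal Q l (trace_prod P) (trace_prod R) :: ('e dedge coord, 'k) kpoly)"
      using tr_star_pres[of "fst (present P)" "snd (present P)" "fst (present R)" "snd (present R)", where 'k = 'k]
        pres F G by (simp add: coll_present)
  qed
  also have "\<dots> = moyal Q l (\<Sum>P\<in>Poly_Mapping.keys F. cst (Poly_Mapping.lookup F P) * trace_prod P)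
      (\<Sum>R\<in>Poly_Mapping.keys G. cst (Poly_Mapping.lookup G R) * trace_prod R)"
  proof (rule moyal_bilinear[symmetric, where N = "\<lambda>P. card (abs_edges (fst (present P)))"])
    fix P R n assume "P \<in> Poly_Mapping.keys F" "R \<in> Poly_Mapping.keys G" "card (abs_edges (fst (present P))) < n"
    then show "bidiff Q l n (trace_prod P) (trace_prod R :: ('e dedge coord, 'k) kpoly) = 0"
      using bidiff_trace_prod_zero[of "fst (present P)" "snd (present P)" "fst (present R)" "snd (present R)" n, where 'k = 'k]
        pres F G by (simp add: coll_present)
  qed simp_all
  finally show ?thesis unfolding tr_def .
qed

end

section \<open>Heights of the edges of a collection\<close>

fun necklace_labels :: "('v, 'x) necklace \<Rightarrow> 'x multiset" where
  "necklace_labels (Triv v) = {#}"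
| "necklace_labels (Cyc c) = mset (rep_cyclic c)"

text \<open>An invariant of the multiset, from which the heights occurring in whatever presentation
  \<open>present\<close> selects are known.\<close>

definition coll_labels :: "('v, 'x) necklace multiset \<Rightarrow> 'x multiset" where
  "coll_labels P = (\<Sum>n\<in>#P. necklace_labels n)"

lemma mset_rotate: "mset (rotate n w) = mset w"
  by (metis append_take_drop_id mset_append rotate_drop_take union_commute)

lemma necklace_labels_abs: "necklace_labels (Cyc (abs_cyclic w)) = mset w"
  using rep_abs_cyclic[of w] by (auto simp: mset_rotate)

lemma image_mset_mset_set_eq_sum: "image_mset f (mset_set A) = (\<Sum>x\<in>A. {#f x#})"
  by (induction A rule: infinite_finite_induct) auto

lemma coll_labels_coll:
  fixes ws :: "'x list list"
  shows "coll_labels (coll (ws, vs)) = image_mset (pr ws) (mset_set (abs_edges ws))"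
proof -
  let ?W = "\<lambda>i. Pair i ` {..<length (ws ! i)}"
  have Un: "abs_edges ws = (\<Union>i\<in>{..<length ws}. ?W i)" by (auto simp: abs_edges_def)
  have word: "mset w = (\<Sum>j<length w. {#w ! j#})" for w :: "'x list"
    by (metis image_mset_mset_set_eq_sum lessThan_atLeast0 map_nth mset_map mset_upt)
  have "coll_labels (coll (ws, vs)) = (\<Sum>w\<leftarrow>ws. mset w)"
    by (simp add: coll_labels_def coll_def image_mset.compositionality o_def
        necklace_labels_abs[unfolded necklace_labels.simps] sum_mset_sum_list flip: mset_map)
  also have "\<dots> = (\<Sum>i<length ws. mset (ws ! i))"
    by (simp add: sum.list_conv_set_nth atLeast0LessThan)
  also have "\<dots> = (\<Sum>i<length ws. \<Sum>x\<in>?W i. {#pr ws x#})"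
    by (subst word) (simp add: sum.reindex inj_on_def pr_def)
  also have "\<dots> = (\<Sum>x\<in>abs_edges ws. {#pr ws x#})"
    unfolding Un by (rule sum.UNION_disjoint[symmetric]) auto
  finally show ?thesis by (simp add: image_mset_mset_set_eq_sum)
qed

text \<open>The orbits partition the abstract edges, so each edge outside \<open>J\<close>
  contributes its label exactly once; distinct heights thus stay distinct after gluing.\<close>

lemma coll_labels_cut_glue:
  assumes "J \<subseteq> abs_edges ws" "\<And>z. z \<in> J \<Longrightarrow> \<phi> z \<in> J \<and> \<phi> (\<phi> z) = z"
  shows "coll_labels (cut_glue Q (ws, vs) J \<phi> lab) = image_mset lab (mset_set (abs_edges ws - J))"
proof -
  let ?X = "abs_edges ws" let ?f = "glue_step ws J \<phi>"
  let ?N = "orbit_necklace Q ws J \<phi> lab" let ?O = "orbit ?f ` ?X"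
  let ?g = "\<lambda>x. if x \<in> J then {#} else {#lab x#}"
  have f: "inj_on ?f ?X" "?f ` ?X \<subseteq> ?X"
    using glue_step_permutes[of J ws \<phi>] assms by blast+
  note orb = orbit_partition[OF finite_abs_edges f]
  have neck: "necklace_labels (?N C) = (\<Sum>x\<in>C. ?g x)" if C: "C \<in> ?O" for C
  proof -
    define z where "z = (SOME z. z \<in> C)"
    define zs where "zs = support ?f z"
    define ys where "ys = filter (\<lambda>x. x \<notin> J) zs"
    have z: "distinct zs" "set zs = C"
      using orb(1)[OF C z_def] by (auto simp: zs_def cycles_through_def)
    have "necklace_labels (?N C) = mset (map lab ys)"
    proof (cases "ys = []")
      case True
      then have "?N C = Triv (tail (double Q) (pr ws z))"
        by (simp only: orbit_necklace_def Let_def z_def[symmetric] zs_def[symmetric] ys_def[symmetric] if_True simp_thms)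
      then show ?thesis using True by simp
    next
      case False
      then have N: "?N C = Cyc (abs_cyclic (map lab ys))"
        by (simp only: orbit_necklace_def Let_def z_def[symmetric] zs_def[symmetric] ys_def[symmetric] if_False)
      show ?thesis unfolding N by (rule necklace_labels_abs)
    qed
    also have "\<dots> = (\<Sum>x\<in>set ys. {#lab x#})"
      using mset_set_set[of ys] z by (simp add: ys_def flip: image_mset_mset_set_eq_sum)
    also have "\<dots> = (\<Sum>x\<in>set zs. ?g x)"
      by (rule sum.mono_neutral_cong_left) (auto simp: ys_def)
    finally show ?thesis using z by simp
  qed
  have "coll_labels (cut_glue Q (ws, vs) J \<phi> lab) = (\<Sum>C\<in>?O. necklace_labels (?N C))"
    by (simp add: coll_labels_def cut_glue_def image_mset.compositionality o_def sum_unfold_sum_mset)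
  also have "\<dots> = (\<Sum>C\<in>?O. \<Sum>x\<in>C. ?g x)"
    by (rule sum.cong[OF refl neck])
  also have "\<dots> = (\<Sum>x\<in>(\<Union>C\<in>?O. C). ?g x)"
  proof (rule sum.UNION_disjoint[symmetric])
    show "\<forall>C\<in>?O. finite C" using orb(3) finite_abs_edges[of ws] by (metis Union_upper finite_subset)
  qed (use orb(2) in auto)
  also have "(\<Union>C\<in>?O. C) = ?X" using orb(3) by simp
  also have "(\<Sum>x\<in>?X. ?g x) = (\<Sum>x\<in>?X - J. {#lab x#})"
    by (rule sum.mono_neutral_cong_right) auto
  finally show ?thesis by (simp add: image_mset_mset_set_eq_sum)
qed

lemma bij_betw_of_image_mset:
  assumes "finite X" "finite Y" "image_mset f (mset_set X) = mset_set Y"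
  shows "bij_betw f X Y"
proof -
  have "f ` X = Y"
    using arg_cong[OF assms(3), of set_mset] assms(1,2) by simp
  moreover have "card X = card Y"
    using arg_cong[OF assms(3), of size] by simp
  ultimately show ?thesis using assms(1) by (metis bij_betw_def eq_card_imp_inj_on)
qed

section \<open>Ordered products of operators\<close>

text \<open>
  The operator of a monomial in which every edge carries a height multiplies the factors in the
  order of their heights.  Thereby \<open>rho_basis\<close> becomes a linear image of a trace in commuting
  variables.
\<close>

definition ordered_op :: "(('e dedge \<times> nat) coord \<Rightarrow>\<^sub>0 nat) \<Rightarrow> ('e, 'k::field_char_0) oper" where
  "ordered_op m = oper_prod (map (\<lambda>k. (\<lambda>((a, h), i, j). \<iota> (a, i, j))
      (THE c. c \<in> Poly_Mapping.keys m \<and> snd (fst c) = k)) [1..<card (Poly_Mapping.keys m) + 1])"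

definition height_order :: "'x set \<Rightarrow> ('x \<Rightarrow> nat) \<Rightarrow> 'x list" where
  "height_order X H = map (inv_into X H) [1..<card X + 1]"

lemma keys_sum_single:
  assumes "finite X"
  shows "Poly_Mapping.keys (\<Sum>x\<in>X. Poly_Mapping.single (c x) (1::nat)) = c ` X"
proof -
  have "Poly_Mapping.lookup (\<Sum>x\<in>X. Poly_Mapping.single (c x) (1::nat)) a = 0 \<longleftrightarrow> a \<notin> c ` X" for a
    using assms by (auto simp: lookup_sum lookup_single when_def)
  then show ?thesis by (auto simp: in_keys_iff)
qed

text \<open>Distinct heights make the coordinates distinct even where edges and indices repeat, so
  the set of keys of the monomial recovers all its factors.\<close>

lemma ordered_op_monomial:
  assumes X: "finite X" and H: "bij_betw H X {1..card X}"
  shows "ordered_op (\<Sum>x\<in>X. Poly_Mapping.single ((e x, H x), s x, t x) 1)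
    = (oper_prod (map (\<lambda>x. \<iota> (e x, s x, t x)) (height_order X H)) :: ('e, 'k::field_char_0) oper)"
proof -
  let ?c = "\<lambda>x. ((e x, H x), s x, t x)"
  have inj: "inj_on H X" using H by (simp add: bij_betw_def)
  then have card: "card (?c ` X) = card X" by (intro card_image) (auto simp: inj_on_def)
  have "(THE c. c \<in> ?c ` X \<and> snd (fst c) = k) = ?c (inv_into X H k)" if "k \<in> {1..card X}" for k
  proof -
    have k: "inv_into X H k \<in> X" "H (inv_into X H k) = k"
      using that H by (auto simp: bij_betw_def inv_into_into f_inv_into_f)
    then show ?thesis using inj by (intro the_equality) (auto simp: inj_on_def)
  qed
  then show ?thesis
    unfolding ordered_op_def height_order_def keys_sum_single[OF X] card map_map
    by (intro arg_cong[of _ _ oper_prod] map_cong) auto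
qed

definition heights_ok :: "('v, 'x \<times> nat) necklace multiset \<Rightarrow> bool" where
  "heights_ok P \<longleftrightarrow> image_mset snd (coll_labels P) = mset_set {1..size (coll_labels P)}"

text \<open>\<open>rho_basis\<close> is defined through an arbitrary presentation, the right side
  through the multiset. Hence any description of the collection can be used to compute it, in
  particular its origin as a result of cutting and gluing.\<close>

lemma rho_basis_eq_lin:
  fixes f :: "('e coord, 'k::field_char_0) kpoly"
  assumes "heights_ok PH"
  shows "rho_basis Q l PH f = lin (\<lambda>m. ordered_op m f)
    (coll_value (\<lambda>a. row_dim Q l (fst a)) (\<lambda>a i j. var (a, i, j)) l PH)"
proof -
  obtain ws vs where p: "present PH = (ws, vs)" by (cases "present PH")
  then have PH: "PH = coll (ws, vs)" using coll_present[of PH] by simp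
  let ?X = "abs_edges ws" let ?H = "\<lambda>x. snd (pr ws x)"
  let ?S = "PiE ?X (\<lambda>x. {..<row_dim Q l (fst (pr ws x))})"
  have H: "bij_betw ?H ?X {1..card ?X}"
    using assms by (intro bij_betw_of_image_mset)
      (simp_all add: heights_ok_def PH coll_labels_coll image_mset.compositionality o_def)
  have mono: "lin (\<lambda>m. ordered_op m f) (\<Prod>x\<in>?X. var (pr ws x, s x, s (nxt ws x)) :: (_, 'k) kpoly)
      = oper_prod (map (\<lambda>x. \<iota> (fst (pr ws x), s x, s (nxt ws x))) (height_order ?X ?H)) f" for s
  proof -
    have "(\<Sum>x\<in>?X. Poly_Mapping.single (pr ws x, s x, s (nxt ws x)) (1::nat))
      = (\<Sum>x\<in>?X. Poly_Mapping.single ((fst (pr ws x), ?H x), s x, s (nxt ws x)) 1)" by simp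
    then show ?thesis
      unfolding prod_var lin_single cst_1 mult_1
      using ordered_op_monomial[OF finite_abs_edges H, of "\<lambda>x. fst (pr ws x)" s "\<lambda>x. s (nxt ws x)", where 'k = 'k]
      by simp
  qed
  have "lin (\<lambda>m. ordered_op m f) (coll_value (\<lambda>a. row_dim Q l (fst a)) (\<lambda>a i j. var (a, i, j)) l PH)
     = (\<Prod>v\<leftarrow>vs. of_nat (l v)) * (\<Sum>s\<in>?S. oper_prod (map (\<lambda>x. \<iota> (fst (pr ws x), s x, s (nxt ws x))) (height_order ?X ?H)) f)"
    unfolding PH coll_value_coll cst_prod_list lin_cst lin_sum mono ..
  then show ?thesis
    unfolding rho_basis_def Let_def p fst_conv snd_conv height_order_def row_dim_def map_map o_def by simp
qed

lemma lin_ordered_op_prod_var: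
  fixes f :: "('e coord, 'k::field_char_0) kpoly"
  assumes "finite X" "bij_betw H X {1..card X}"
  shows "lin (\<lambda>m. ordered_op m f) (\<Prod>x\<in>X. var ((e x, H x), s x, t x))
    = oper_prod (map (\<lambda>x. \<iota> (e x, s x, t x)) (height_order X H)) f"
  unfolding prod_var lin_single cst_1 mult_1 ordered_op_monomial[OF assms] ..

lemma heights_okI:
  assumes "coll_labels P = image_mset lab (mset_set X)" "finite X" "bij_betw (\<lambda>x. snd (lab x)) X {1..card X}"
  shows "heights_ok P"
  using assms by (simp add: heights_ok_def image_mset.compositionality o_def image_mset_mset_set bij_betw_def)

lemma rho_basis_with_heights:
  fixes f :: "('e coord, 'k::field_char_0) kpoly"
  assumes H: "bij_betw H (abs_edges ws) {1..card (abs_edges ws)}"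
  shows "rho_basis Q l (with_heights (ws, vs) H) f = cst (\<Prod>v\<leftarrow>vs. of_nat (l v)) *
    (\<Sum>s\<in>PiE (abs_edges ws) (\<lambda>x. {..<row_dim Q l (pr ws x)}).
      oper_prod (map (\<lambda>x. \<iota> (pr ws x, s x, s (nxt ws x))) (height_order (abs_edges ws) H)) f)"
proof -
  let ?wl = "map (\<lambda>i. map (\<lambda>j. (ws ! i ! j, H (i, j))) [0..<length (ws ! i)]) [0..<length ws]"
  have X: "abs_edges ?wl = abs_edges ws" by (auto simp: abs_edges_def)
  have pr: "pr ?wl x = (pr ws x, H x)" and nxt: "nxt ?wl x = nxt ws x" if "x \<in> abs_edges ws" for x
    using that by (auto simp: abs_edges_def pr_def nxt_def)
  have wh: "with_heights (ws, vs) H = coll (?wl, vs)" by (simp add: with_heights_def)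
  have "heights_ok (with_heights (ws, vs) H)"
    unfolding wh by (rule heights_okI[OF coll_labels_coll finite_abs_edges], rule iffD1[OF bij_betw_cong H[folded X]])
      (simp add: X pr)
  moreover have "coll_value (\<lambda>a. row_dim Q l (fst a)) (\<lambda>a i j. var (a, i, j)) l (with_heights (ws, vs) H)
    = cst (\<Prod>v\<leftarrow>vs. of_nat (l v)) * (\<Sum>s\<in>PiE (abs_edges ws) (\<lambda>x. {..<row_dim Q l (pr ws x)}).
        \<Prod>x\<in>abs_edges ws. var ((pr ws x, H x), s x, s (nxt ws x)) :: (('e dedge \<times> nat) coord, 'k) kpoly)"
    unfolding wh coll_value_coll cst_prod_list X
    by (intro arg_cong2[where f = "(*)"] sum.cong PiE_cong prod.cong refl) (simp_all add: pr nxt)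
  ultimately show ?thesis
    by (simp only: rho_basis_eq_lin lin_cst lin_sum lin_ordered_op_prod_var[OF finite_abs_edges H])
qed

text \<open>The deltas are scalars, so they pass through the linear map that orders monomials; the
  ordered product is left with the surviving edges.\<close>

lemma rho_basis_cut_glue:
  fixes f :: "('e coord, 'k::field_char_0) kpoly"
  assumes J: "J \<subseteq> abs_edges ws" "\<And>z. z \<in> J \<Longrightarrow> \<phi> z \<in> J \<and> \<phi> (\<phi> z) = z"
    and dim: "\<And>z. z \<in> J \<Longrightarrow> row_dim Q l (pr ws (nxt ws (\<phi> z))) = row_dim Q l (pr ws z)"
    and h: "bij_betw h (abs_edges ws - J) {1..card (abs_edges ws - J)}"
  shows "rho_basis Q l (cut_glue Q (ws, vs) J \<phi> (\<lambda>z. (pr ws z, h z))) f = cst (\<Prod>v\<leftarrow>vs. of_nat (l v)) *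
    (\<Sum>s\<in>PiE (abs_edges ws) (\<lambda>x. {..<row_dim Q l (pr ws x)}).
      cst (of_bool (\<forall>z\<in>J. s z = s (nxt ws (\<phi> z)))) *
      oper_prod (map (\<lambda>x. \<iota> (pr ws x, s x, s (nxt ws x))) (height_order (abs_edges ws - J) h)) f)"
proof -
  let ?P = "cut_glue Q (ws, vs) J \<phi> (\<lambda>z. (pr ws z, h z))" let ?X = "abs_edges ws"
  have fin: "finite (?X - J)" "finite J" using finite_subset[OF J(1)] by auto
  have "heights_ok ?P"
    by (rule heights_okI[OF coll_labels_cut_glue[OF J] fin(1)]) (use h in simp_all)
  moreover have "coll_value (\<lambda>a. row_dim Q l (fst a)) (\<lambda>a i j. var (a, i, j)) l ?P
    = cst (\<Prod>v\<leftarrow>vs. of_nat (l v)) * (\<Sum>s\<in>PiE ?X (\<lambda>x. {..<row_dim Q l (pr ws x)}).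
        cst (of_bool (\<forall>z\<in>J. s z = s (nxt ws (\<phi> z)))) *
        (\<Prod>x\<in>?X - J. var ((pr ws x, h x), s x, s (nxt ws x))) :: (('e dedge \<times> nat) coord, 'k) kpoly)"
  proof -
    have "coll_value (\<lambda>a. row_dim Q l (fst a)) (\<lambda>a i j. var (a, i, j)) l ?P
      = (\<Prod>v\<leftarrow>vs. of_nat (l v)) * (\<Sum>s\<in>PiE ?X (\<lambda>x. {..<row_dim Q l (pr ws x)}). \<Prod>x\<in>?X.
        if x \<in> J then of_bool (s x = s (nxt ws (\<phi> x))) else var ((pr ws x, h x), s x, s (nxt ws x))
          :: (('e dedge \<times> nat) coord, 'k) kpoly)"
      by (rule coll_value_cut_glue[OF J dim, where lab = "\<lambda>z. (pr ws z, h z)"]) simp_all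
    also have "\<dots> = cst (\<Prod>v\<leftarrow>vs. of_nat (l v)) * (\<Sum>s\<in>PiE ?X (\<lambda>x. {..<row_dim Q l (pr ws x)}).
        cst (of_bool (\<forall>z\<in>J. s z = s (nxt ws (\<phi> z)))) *
        (\<Prod>x\<in>?X - J. var ((pr ws x, h x), s x, s (nxt ws x))))"
      unfolding cst_prod_list
    proof (intro arg_cong2[where f = "(*)"] sum.cong refl)
      fix s
      let ?G = "\<lambda>x. if x \<in> J then of_bool (s x = s (nxt ws (\<phi> x))) else var ((pr ws x, h x), s x, s (nxt ws x))
        :: (('e dedge \<times> nat) coord, 'k) kpoly"
      have "(\<Prod>x\<in>?X. ?G x) = (\<Prod>x\<in>?X - J. ?G x) * (\<Prod>x\<in>J. ?G x)"
        by (rule prod.subset_diff[OF J(1) finite_abs_edges])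
      also have "(\<Prod>x\<in>?X - J. ?G x) = (\<Prod>x\<in>?X - J. var ((pr ws x, h x), s x, s (nxt ws x)))"
        by (rule prod.cong) auto
      also have "(\<Prod>x\<in>J. ?G x) = (\<Prod>x\<in>J. of_bool (s x = s (nxt ws (\<phi> x))))"
        by (rule prod.cong) auto
      also have "\<dots> = cst (of_bool (\<forall>z\<in>J. s z = s (nxt ws (\<phi> z))))"
        unfolding cst_of_bool by (rule prod_of_bool[OF fin(2)])
      finally show "(\<Prod>x\<in>?X. ?G x) = cst (of_bool (\<forall>z\<in>J. s z = s (nxt ws (\<phi> z)))) *
          (\<Prod>x\<in>?X - J. var ((pr ws x, h x), s x, s (nxt ws x)))"
        by (simp only: mult.commute)
    qed
    finally show ?thesis .
  qed
  ultimately show ?thesis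
    by (simp only: rho_basis_eq_lin lin_cst lin_sum lin_ordered_op_prod_var[OF fin(1) h])
qed

section \<open>Commutators\<close>

lemma pdiff_single: "pdiff a (Poly_Mapping.single m 1) = Poly_Mapping.single (m - Poly_Mapping.single a 1) (of_nat (Poly_Mapping.lookup m a))"
  by (simp add: pdiff_eq_lin lin_single)

lemma pdiff_add: "pdiff a (u + v) = pdiff a u + pdiff a v"
  by (simp add: pdiff_eq_lin lin_add)

lemma kpoly_eq_sum_monomials: "u = (\<Sum>m\<in>Poly_Mapping.keys u. cst (Poly_Mapping.lookup u m) * Poly_Mapping.single m 1)"
  for u :: "('x, 'k::field_char_0) kpoly"
  by (subst poly_mapping_eq_sum_single) (simp add: cst_mult_single)

lemma pdiff_var_mult:
  fixes u :: "('x, 'k::field_char_0) kpoly"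
  shows "pdiff a (var b * u) = of_bool (a = b) * u + var b * pdiff a u"
proof -
  have mono: "pdiff a (var b * Poly_Mapping.single m 1) =
    of_bool (a = b) * Poly_Mapping.single m 1 + var b * pdiff a (Poly_Mapping.single m (1 :: 'k poly))" for m
  proof (cases "Poly_Mapping.lookup m a = 0")
    case True
    then show ?thesis
      by (cases "a = b") (simp_all add: var_def mult_single pdiff_single lookup_add lookup_single)
  next
    case False
    \<comment> \<open>The exponent of \<open>a\<close> in \<open>m\<close> is positive, so the
      truncated subtraction is exact.\<close>
    have "Poly_Mapping.single b 1 + m - Poly_Mapping.single a 1 = Poly_Mapping.single b 1 + (m - Poly_Mapping.single a (1::nat))"
      by (rule poly_mapping_eqI) (use False in \<open>auto simp: lookup_add lookup_minus lookup_single when_def\<close>)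
    moreover have "Poly_Mapping.single a 1 + (m - Poly_Mapping.single a (1::nat)) = m"
      by (rule poly_mapping_eqI) (use False in \<open>auto simp: lookup_add lookup_minus lookup_single when_def\<close>)
    ultimately show ?thesis
      by (cases "a = b") (simp_all add: var_def mult_single pdiff_single lookup_add lookup_single single_add flip: One_nat_def)
  qed
  let ?c = "\<lambda>m. cst (Poly_Mapping.lookup u m) :: ('x, 'k) kpoly" let ?m = "\<lambda>m. Poly_Mapping.single m 1 :: ('x, 'k) kpoly"
  let ?K = "Poly_Mapping.keys u"
  have "pdiff a (var b * (\<Sum>m\<in>?K. ?c m * ?m m)) = (\<Sum>m\<in>?K. ?c m * pdiff a (var b * ?m m))"
    by (simp only: sum_distrib_left mult.left_commute[of "var b"] pdiff_sum pdiff_cst)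
  also have "\<dots> = of_bool (a = b) * (\<Sum>m\<in>?K. ?c m * ?m m) + var b * (\<Sum>m\<in>?K. ?c m * pdiff a (?m m))"
    by (simp only: mono sum_distrib_left distrib_left sum.distrib mult.left_commute)
  also have "(\<Sum>m\<in>?K. ?c m * pdiff a (?m m)) = pdiff a (\<Sum>m\<in>?K. ?c m * ?m m)"
    by (simp only: pdiff_sum pdiff_cst)
  finally show ?thesis by (simp only: kpoly_eq_sum_monomials[symmetric])
qed

lemma pdiff_commute:
  fixes u :: "('x, 'k::field_char_0) kpoly"
  shows "pdiff a (pdiff b u) = pdiff b (pdiff a u)"
proof (cases "a = b")
  case False
  have single: "pdiff a (Poly_Mapping.single m (of_nat n :: 'k poly)) = of_nat n * pdiff a (Poly_Mapping.single m 1)" for m n and a :: 'x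
  proof -
    have "Poly_Mapping.single m (of_nat n) = cst (of_nat n) * Poly_Mapping.single m (1 :: 'k poly)"
      by (simp only: cst_mult_single mult_1_right)
    then show ?thesis using pdiff_cst[of a "of_nat n" "Poly_Mapping.single m (1 :: 'k poly)"]
      by (simp only: cst_of_nat)
  qed
  have mono: "pdiff a (pdiff b (Poly_Mapping.single m 1)) = pdiff b (pdiff a (Poly_Mapping.single m (1 :: 'k poly)))" for m
    unfolding pdiff_single[of b m] pdiff_single[of a m] single
    using False by (simp add: pdiff_single lookup_minus lookup_single diff_diff_add add.commute mult.commute mult_single
        flip: single_of_nat)
  let ?c = "\<lambda>m. cst (Poly_Mapping.lookup u m) :: ('x, 'k) kpoly" let ?m = "\<lambda>m. Poly_Mapping.single m 1 :: ('x, 'k) kpoly"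
  have "pdiff a (pdiff b (\<Sum>m\<in>Poly_Mapping.keys u. ?c m * ?m m)) = pdiff b (pdiff a (\<Sum>m\<in>Poly_Mapping.keys u. ?c m * ?m m))"
    by (simp only: pdiff_sum pdiff_cst mono)
  then show ?thesis by (simp only: kpoly_eq_sum_monomials[symmetric])
qed simp

text \<open>Coordinates commute, derivatives commute, and the commutator of a coordinate with minus
  h times its derivative is h. A starred edge differentiates by the transposed entry, whence the
  index condition of the bivector.\<close>

lemma iota_commutator:
  fixes f :: "('e coord, 'k::field_char_0) kpoly"
  shows "\<iota> a (\<iota> b f) - \<iota> b (\<iota> a f) = cst (monom (bivector a b) 1) * f"
proof -
  obtain e i j where a: "a = (e, i, j)" by (cases a)
  obtain g k m where b: "b = (g, k, m)" by (cases b)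
  have neg: "pdiff c (- u) = - pdiff c u" for c and u :: "('e coord, 'k) kpoly"
    using pdiff_cst[of c "- 1" u] by (simp add: cst_uminus)
  show ?thesis
    unfolding a b
    by (cases e; cases g)
      (auto simp: bivector_def bracket_def pdiff_var_mult pdiff_cst neg pdiff_commute cst_uminus distrib_left mult.left_commute
        simp flip: minus_monom)
qed

definition op_linear :: "('e, 'k::field_char_0) oper \<Rightarrow> bool" where
  "op_linear D \<longleftrightarrow> (\<forall>u v. D (u + v) = D u + D v) \<and> (\<forall>c u. D (cst c * u) = cst c * D u)"

lemma op_linear_diff: "op_linear D \<Longrightarrow> D (u - v) = D u - D v"
  unfolding op_linear_def by (metis add_diff_cancel diff_add_cancel)

lemma op_linear_iota: "op_linear (\<iota> a)"
  by (cases a rule: \<iota>.cases) (auto simp: op_linear_def pdiff_add pdiff_cst distrib_left mult.left_commute)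

lemma oper_prod_Nil [simp]: "oper_prod [] = id"
  and oper_prod_Cons [simp]: "oper_prod (D # Ds) = D \<circ> oper_prod Ds"
  by (simp_all add: oper_prod_def)

lemma oper_prod_append: "oper_prod (Ds @ Es) = oper_prod Ds \<circ> oper_prod Es"
  by (induction Ds) (auto simp: comp_assoc)

lemma op_linear_oper_prod: "(\<And>D. D \<in> set Ds \<Longrightarrow> op_linear D) \<Longrightarrow> op_linear (oper_prod Ds)"
  by (induction Ds) (auto simp: op_linear_def)

text \<open>The commutator is a scalar, which linearity moves to the front past the factors of
  \<open>A\<close>.\<close>

lemma oper_prod_swap:
  fixes f :: "('e coord, 'k::field_char_0) kpoly"
  shows "oper_prod (map (\<lambda>x. \<iota> (c x)) (A @ [x, y] @ B)) f - oper_prod (map (\<lambda>x. \<iota> (c x)) (A @ [y, x] @ B)) f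
    = cst (monom (bivector (c x) (c y)) 1) * oper_prod (map (\<lambda>x. \<iota> (c x)) (A @ B)) f"
proof -
  let ?P = "\<lambda>zs. oper_prod (map (\<lambda>x. \<iota> (c x)) zs) :: ('e, 'k) oper"
  have lin: "op_linear (?P A)" by (rule op_linear_oper_prod) (auto intro: op_linear_iota)
  have "?P (A @ [x, y] @ B) f - ?P (A @ [y, x] @ B) f
     = ?P A (\<iota> (c x) (\<iota> (c y) (?P B f)) - \<iota> (c y) (\<iota> (c x) (?P B f)))"
    by (simp add: oper_prod_append op_linear_diff[OF lin])
  also have "\<dots> = cst (monom (bivector (c x) (c y)) 1) * ?P A (?P B f)"
    unfolding iota_commutator using lin by (simp add: op_linear_def)
  finally show ?thesis by (simp add: oper_prod_append)
qed

section \<open>Exchanging adjacent heights\<close>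

lemma height_order_eqI:
  assumes "inj_on H X" "set E \<subseteq> X" "map H E = [1..<card X + 1]"
  shows "height_order X H = E"
  using assms unfolding height_order_def assms(3)[symmetric]
  by (simp add: subset_eq map_idI)

text \<open>\<open>A\<close> and \<open>B\<close> list the edges below and above the exchanged pair.
  The exchange composes \<open>H\<close> with a transposition and so swaps two neighbours in the
  list; removing the pair keeps the lower heights and reduces the higher ones by 2.\<close>

lemma adjacent_heights:
  fixes H :: "'x \<Rightarrow> nat"
  assumes X: "finite X" and H: "bij_betw H X {1..card X}" and xy: "x \<in> X" "y \<in> X" "H y = H x + 1"
  defines "h \<equiv> \<lambda>z. card {w \<in> X - {x, y}. H w \<le> H z}"
  obtains A B where
    "height_order X H = A @ [x, y] @ B"
    "bij_betw (H(x := H y, y := H x)) X {1..card X}"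
    "height_order X (H(x := H y, y := H x)) = A @ [y, x] @ B"
    "bij_betw h (X - {x, y}) {1..card (X - {x, y})}"
    "height_order (X - {x, y}) h = A @ B"
proof -
  define E where "E = height_order X H"
  define k where "k = H x"
  define N where "N = card X"
  \<comment> \<open>List positions start at 0, so the edge of height \<open>k\<close> stands at
    position \<open>k - 1\<close>.\<close>
  define A where "A = take (k - 1) E"
  define B where "B = drop (k + 1) E"
  have inj: "inj_on H X" and img: "H ` X = {1..N}" using H by (auto simp: bij_betw_def N_def)
  have k: "1 \<le> k" "k + 1 \<le> N" using img xy by (force simp: k_def)+
  have lenE: "length E = N" by (simp add: E_def height_order_def N_def)
  have Enth: "E ! i \<in> X" "H (E ! i) = i + 1" if "i < N" for i
  proof -
    have E: "E ! i = inv_into X H (i + 1)" using that by (simp add: E_def height_order_def N_def del: upt_Suc)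
    have "i + 1 \<in> H ` X" using that img by auto
    then show "E ! i \<in> X" "H (E ! i) = i + 1" unfolding E by (rule inv_into_into, rule f_inv_into_f)
  qed
  have setE: "set E = X"
  proof
    show "set E \<subseteq> X" using Enth(1) lenE by (auto simp: in_set_conv_nth)
    show "X \<subseteq> set E"
    proof
      fix z assume z: "z \<in> X"
      then have "H z \<in> {1..N}" using img by auto
      then have "E ! (H z - 1) \<in> X" "H (E ! (H z - 1)) = H z" "H z - 1 < N" using Enth[of "H z - 1"] by auto
      then show "z \<in> set E" using inj z lenE by (metis inj_onD nth_mem)
    qed
  qed
  have mapE: "map H E = [1..<N + 1]" by (rule nth_equalityI) (auto simp: lenE Enth simp del: upt_Suc)
  have "distinct (map H E)" unfolding mapE by (rule distinct_upt)
  then have distE: "distinct E" by (simp add: distinct_map)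
  have Ex: "E ! (k - 1) = x" using inj_onD[OF inj, of "E ! (k - 1)" x] Enth[of "k - 1"] k xy by (simp add: k_def)
  have Ey: "E ! k = y" using inj_onD[OF inj, of "E ! k" y] Enth[of k] k xy by (simp add: k_def)
  have E: "E = A @ [x, y] @ B"
  proof -
    have "drop (k - 1) E = E ! (k - 1) # drop k E" using Cons_nth_drop_Suc[of "k - 1" E] k lenE by simp
    moreover have "drop k E = E ! k # drop (k + 1) E" using Cons_nth_drop_Suc[of k E] k lenE by simp
    ultimately show ?thesis using append_take_drop_id[of "k - 1" E] Ex Ey by (simp add: A_def B_def)
  qed
  have notin: "x \<notin> set A" "y \<notin> set A" "x \<notin> set B" "y \<notin> set B" "x \<noteq> y" using distE unfolding E by auto
  have H': "H(x := H y, y := H x) = H \<circ> transpose x y"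
    by (auto simp: fun_eq_iff transpose_def)
  have "transpose x y permutes X" by (rule permutes_swap_id) (use xy in auto)
  then have bij': "bij_betw (H \<circ> transpose x y) X {1..card X}"
    using H by (intro bij_betw_trans[OF permutes_imp_bij])
  have "map (transpose x y) E = A @ [y, x] @ B"
  proof -
    have "map (transpose x y) A = A" "map (transpose x y) B = B"
      using notin by (auto intro!: map_idI simp: transpose_def)
    then show ?thesis by (simp add: E)
  qed
  moreover have "height_order X (H \<circ> transpose x y) = map (transpose x y) E"
  proof (rule height_order_eqI)
    show "inj_on (H \<circ> transpose x y) X" using bij' by (simp add: bij_betw_def)
    show "set (map (transpose x y) E) \<subseteq> X" using setE xy by (auto simp: transpose_def)
    show "map (H \<circ> transpose x y) (map (transpose x y) E) = [1..<card X + 1]"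
      using mapE by (simp add: N_def o_def)
  qed
  ultimately have order': "height_order X (H \<circ> transpose x y) = A @ [y, x] @ B" by simp
  have setAB: "set (A @ B) = X - {x, y}" using setE notin unfolding E by auto
  have cardAB: "card (X - {x, y}) = N - 2" using xy notin X by (simp add: N_def card_Diff_subset)
  \<comment> \<open>Under \<open>H\<close> the counted edges become the heights up to
    \<open>H z\<close>, with \<open>k\<close> and \<open>k + 1\<close> missing.\<close>
  have h: "h z = card ({1..H z} - {k, k + 1})" if z: "z \<in> X" for z
  proof -
    have "H ` {w \<in> X - {x, y}. H w \<le> H z} = {1..H z} - {k, k + 1}"
    proof (intro equalityI subsetI)
      fix n assume "n \<in> H ` {w \<in> X - {x, y}. H w \<le> H z}"
      then obtain w where w: "w \<in> X" "w \<noteq> x" "w \<noteq> y" "H w \<le> H z" "n = H w" by auto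
      then have "H w \<noteq> H x" "H w \<noteq> H y"
        using inj_onD[OF inj, of w x] inj_onD[OF inj, of w y] xy(1,2) by blast+
      moreover have "1 \<le> H w" using img w by auto
      ultimately show "n \<in> {1..H z} - {k, k + 1}" using w xy by (simp add: k_def)
    next
      fix n assume n: "n \<in> {1..H z} - {k, k + 1}"
      moreover have "H z \<le> N" using img z by auto
      ultimately have "n \<in> H ` X" unfolding img by auto
      then obtain w where w: "w \<in> X" "n = H w" by blast
      then show "n \<in> H ` {w \<in> X - {x, y}. H w \<le> H z}" using n xy by (auto simp: k_def)
    qed
    moreover have "inj_on H {w \<in> X - {x, y}. H w \<le> H z}" by (rule inj_on_subset[OF inj]) auto
    ultimately show ?thesis unfolding h_def by (metis card_image)
  qed
  have hlow: "h z = H z" if "z \<in> X" "H z < k" for z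
  proof -
    have "{1..H z} - {k, k + 1} = {1..H z}" using that by auto
    then show ?thesis using h[OF that(1)] by simp
  qed
  have hhigh: "h z = H z - 2" if "z \<in> X" "H z > k + 1" for z
  proof -
    have "card ({1..H z} - {k, k + 1}) = card {1..H z} - card {k, k + 1}"
      by (rule card_Diff_subset) (use that k in auto)
    then show ?thesis using h[OF that(1)] by simp
  qed
  have lenA: "length A = k - 1" and lenB: "length B = N - (k + 1)" using k lenE by (auto simp: A_def B_def)
  have maph: "map h (A @ B) = [1..<(N - 2) + 1]"
  proof (rule nth_equalityI)
    show "length (map h (A @ B)) = length [1..<(N - 2) + 1]"
      unfolding length_map length_append length_upt using lenA lenB k by linarith
    fix i assume "i < length (map h (A @ B))"
    then have i: "i < N - 2" using lenA lenB k by simp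
    show "map h (A @ B) ! i = [1..<(N - 2) + 1] ! i"
    proof (cases "i < k - 1")
      case True
      then have "(A @ B) ! i = E ! i" using lenA by (simp add: nth_append A_def)
      then show ?thesis using True i hlow[of "E ! i"] Enth[of i] lenA lenB k by (simp add: nth_append del: upt_Suc)
    next
      case False
      then have "(A @ B) ! i = E ! (i + 2)" using lenA lenE k i by (simp add: nth_append B_def)
      then show ?thesis using False i hhigh[of "E ! (i + 2)"] Enth[of "i + 2"] lenA lenB k
        by (simp del: upt_Suc append_assoc map_append)
    qed
  qed
  have "distinct (map h (A @ B))" unfolding maph by simp
  then have injh: "inj_on h (X - {x, y})" using setAB by (metis distinct_map)
  have "h ` (X - {x, y}) = {1..N - 2}"
    using arg_cong[OF maph, of set] unfolding set_map setAB
    by (simp add: atLeastLessThanSuc_atLeastAtMost del: upt_Suc)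
  then have bijh: "bij_betw h (X - {x, y}) {1..card (X - {x, y})}" using injh cardAB by (simp add: bij_betw_def)
  have "height_order (X - {x, y}) h = A @ B"
    by (rule height_order_eqI[OF injh]) (use setAB maph cardAB in auto)
  then show thesis
    using that[of A B] E bij' order' bijh by (simp add: H' E_def)
qed

section \<open>Descent to the module of collections with heights\<close>

text \<open>Exchanging two neighbours in an ordered product costs h times a bivector, and the deltas
  in that bivector are those of gluing along \<open>{x, y}\<close>.\<close>

lemma height_relation_vanishes:
  fixes f :: "('e coord, 'k::field_char_0) kpoly" and Q :: "('v, 'e) pre_digraph"
  assumes Q: "wf_digraph Q" and r: "r \<in> hrelations Q"
  shows "lin (\<lambda>PH. rho_basis Q l PH f) r = 0"
proof -
  obtain p H x y where r_eq: "r = Poly_Mapping.single (with_heights p H) 1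
       - Poly_Mapping.single (with_heights p (H(x := H y, y := H x))) 1
       - Poly_Mapping.single
           (cut_glue Q p {x, y} (transpose x y)
              (\<lambda>z. (pr (fst p) z, card {w \<in> abs_edges (fst p) - {x, y}. H w \<le> H z})))
           (monom (bracket (pr (fst p) x) (pr (fst p) y)) 1)"
    and p: "p \<in> valid_pres Q" "H \<in> heights (fst p)" "x \<in> abs_edges (fst p)" "y \<in> abs_edges (fst p)" "H y = H x + 1"
    using r unfolding hrelations_def by blast
  obtain ws vs where ws: "p = (ws, vs)" by (cases p)
  define X where "X = abs_edges ws"
  define h where "h = (\<lambda>z. card {w \<in> X - {x, y}. H w \<le> H z})"
  define c where "c = (\<lambda>(s :: nat \<times> nat \<Rightarrow> nat) z. (pr ws z, s z, s (nxt ws z)))"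
  define b where "b = (bracket (pr ws x) (pr ws y) :: 'k)"
  let ?N = "cst (\<Prod>v\<leftarrow>vs. of_nat (l v)) :: ('e coord, 'k) kpoly"
  let ?S = "PiE X (\<lambda>x. {..<row_dim Q l (pr ws x)})"
  let ?P = "\<lambda>s zs. oper_prod (map (\<lambda>z. \<iota> (c s z)) zs) f"
  let ?Q = "cut_glue Q (ws, vs) {x, y} (transpose x y) (\<lambda>z. (pr ws z, h z))"
  have valid: "(ws, vs) \<in> valid_pres Q" and H: "bij_betw H X {1..card X}" and xy: "x \<in> X" "y \<in> X" "H y = H x + 1"
    using p by (auto simp: ws heights_def X_def)
  have r': "r = Poly_Mapping.single (with_heights (ws, vs) H) 1
       - Poly_Mapping.single (with_heights (ws, vs) (H(x := H y, y := H x))) 1 - Poly_Mapping.single ?Q (monom b 1)"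
    unfolding r_eq by (simp add: ws X_def h_def b_def)
  have "finite X" by (simp add: X_def)
  then obtain A B where AB:
    "height_order X H = A @ [x, y] @ B"
    "bij_betw (H(x := H y, y := H x)) X {1..card X}"
    "height_order X (H(x := H y, y := H x)) = A @ [y, x] @ B"
    "bij_betw h (X - {x, y}) {1..card (X - {x, y})}"
    "height_order (X - {x, y}) h = A @ B"
    unfolding h_def by (rule adjacent_heights[OF _ H xy])
  have 1: "rho_basis Q l (with_heights (ws, vs) H) f = ?N * (\<Sum>s\<in>?S. ?P s (A @ [x, y] @ B))"
    unfolding rho_basis_with_heights[OF H[unfolded X_def]] AB(1)[symmetric] c_def X_def ..
  have 2: "rho_basis Q l (with_heights (ws, vs) (H(x := H y, y := H x))) f = ?N * (\<Sum>s\<in>?S. ?P s (A @ [y, x] @ B))"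
    unfolding rho_basis_with_heights[OF AB(2)[unfolded X_def]] AB(3)[symmetric] c_def X_def ..
  have diff: "rho_basis Q l (with_heights (ws, vs) H) f - rho_basis Q l (with_heights (ws, vs) (H(x := H y, y := H x))) f
     = ?N * (\<Sum>s\<in>?S. cst (monom (bivector (c s x) (c s y)) 1) * ?P s (A @ B))"
    unfolding 1 2 right_diff_distrib[symmetric] sum_subtractf[symmetric] oper_prod_swap ..
  have lin: "lin (\<lambda>PH. rho_basis Q l PH f) r = ?N * (\<Sum>s\<in>?S. cst (monom (bivector (c s x) (c s y)) 1) * ?P s (A @ B))
     - cst (monom b 1) * rho_basis Q l ?Q f"
    unfolding r' lin_diff lin_single cst_1 mult_1 diff ..
  show ?thesis
  \<comment> \<open>For bracket 0 the gluing may violate the condition on dimensions, so its value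
    is not computed: it only occurs with coefficient 0.\<close>
  proof (cases "b = 0")
    case True
    then have "bivector (c s x) (c s y) = (0 :: 'k)" for s by (simp add: c_def bivector_def b_def)
    then show ?thesis unfolding lin by (simp add: True)
  next
    case False
    then have rev: "pr ws y = rev_edge (pr ws x)" by (auto simp: b_def bracket_eq split: if_splits)
    have "x \<noteq> y" using xy by auto
    have dim: "row_dim Q l (pr ws (nxt ws (transpose x y z))) = row_dim Q l (pr ws z)" if "z \<in> {x, y}" for z
      using that rev valid_pres_step(2)[OF Q valid, of x] valid_pres_step(2)[OF Q valid, of y] xy
      by (auto simp: row_dim_def X_def head_rev_edge tail_rev_edge)
    have 3: "rho_basis Q l ?Q f = ?N * (\<Sum>s\<in>?S. cst (of_bool (\<forall>z\<in>{x, y}. s z = s (nxt ws (transpose x y z)))) * ?P s (A @ B))"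
      unfolding c_def AB(5)[symmetric] X_def
      by (rule rho_basis_cut_glue) (use xy dim AB(4) in \<open>auto simp: X_def\<close>)
    have "cst (monom (bivector (c s x) (c s y)) 1) = cst (monom b 1) *
        (cst (of_bool (\<forall>z\<in>{x, y}. s z = s (nxt ws (transpose x y z)))) :: ('e coord, 'k) kpoly)" for s
      unfolding cst_mult[symmetric] by (auto simp: c_def bivector_def b_def)
    then have "(\<Sum>s\<in>?S. cst (monom (bivector (c s x) (c s y)) 1) * ?P s (A @ B))
      = cst (monom b 1) * (\<Sum>s\<in>?S. cst (of_bool (\<forall>z\<in>{x, y}. s z = s (nxt ws (transpose x y z)))) * ?P s (A @ B))"
      by (simp only: sum_distrib_left mult.assoc)
    then show ?thesis unfolding lin 3 by (simp only: mult.left_commute diff_self)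
  qed
qed

lemma rho_free_eq_lin: "rho_free Q l F f = lin (\<lambda>PH. rho_basis Q l PH f) F"
  by (simp add: rho_free_def lin_def)

text \<open>The map vanishes on the span of the relations, so \<open>rho_free\<close> is constant on
  the class. By reflexivity the class is nonempty, which gives the uniqueness required by
  \<open>THE\<close>.\<close>

lemma rho_h_class:
  fixes Q :: "('v, 'e) pre_digraph" and F :: "('v, 'e, 'k::field_char_0) hmod"
  assumes Q: "wf_digraph Q" and F: "F \<in> free_hmod Q"
  shows "\<rho>\<^sub>h Q l (hcong Q `` {F}) = rho_free Q l F"
proof -
  interpret M: Modules.module "\<lambda>(c :: 'k poly) (F :: ('v, 'e, 'k) hmod). cst c * F"
    by unfold_locales (simp_all add: cst_add cst_mult algebra_simps)
  have const: "rho_free Q l G = rho_free Q l F" if "(F, G) \<in> hcong Q" for G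
  proof
    fix f
    have "F - G \<in> M.span (hrelations Q)" using that by (simp add: hcong_def)
    then have "lin (\<lambda>PH. rho_basis Q l PH f) (F - G) = 0"
    proof (induction rule: M.span_induct)
      case base
      then show ?case by (auto simp: M.subspace_def lin_add lin_cst)
    next
      case (step r)
      then show ?case by (rule height_relation_vanishes[OF Q])
    qed
    then show "rho_free Q l G f = rho_free Q l F f" by (simp add: rho_free_eq_lin lin_diff)
  qed
  have refl: "(F, F) \<in> hcong Q" using F M.span_zero by (simp add: hcong_def)
  show ?thesis
    unfolding \<rho>\<^sub>h_def
  proof (rule the_equality)
    show "\<forall>G\<in>hcong Q `` {F}. rho_free Q l G = rho_free Q l F"
      by (rule ballI, rule const) (simp only: Image_singleton_iff)
    fix D assume "\<forall>G\<in>hcong Q `` {F}. rho_free Q l G = D"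
    then show "D = rho_free Q l F" using refl by (simp only: Image_singleton_iff Ball_def)
  qed
qed

section \<open>Symmetrization\<close>

lemma lookup_sum_list_single: "Poly_Mapping.lookup (\<Sum>x\<leftarrow>xs. Poly_Mapping.single x (1::nat)) a = count (mset xs) a"
  by (induction xs) (auto simp: lookup_add lookup_single)

lemma ex_enumeration: "\<exists>xs. (\<Sum>x\<leftarrow>xs. Poly_Mapping.single x (1::nat)) = m"
proof -
  obtain xs where "mset xs = (\<Sum>x\<in>Poly_Mapping.keys m. replicate_mset (Poly_Mapping.lookup m x) x)"
    using ex_mset by blast
  then have "count (mset xs) a = Poly_Mapping.lookup m a" for a
    by (simp add: count_sum in_keys_iff sum.delta)
  then show ?thesis by (intro exI[of _ xs] poly_mapping_eqI) (simp only: lookup_sum_list_single)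
qed

lemma bij_betw_permute_list:
  assumes "distinct zs"
  shows "bij_betw (\<lambda>\<sigma>. permute_list \<sigma> zs) {\<sigma>. \<sigma> permutes {..<length zs}} (permutations_of_set (set zs))"
proof (rule bij_betw_imageI)
  show "inj_on (\<lambda>\<sigma>. permute_list \<sigma> zs) {\<sigma>. \<sigma> permutes {..<length zs}}"
  proof (rule inj_onI, clarify)
    fix \<sigma> \<tau> assume perm: "\<sigma> permutes {..<length zs}" "\<tau> permutes {..<length zs}" and eq: "permute_list \<sigma> zs = permute_list \<tau> zs"
    show "\<sigma> = \<tau>"
    proof
      fix i
      show "\<sigma> i = \<tau> i"
      proof (cases "i < length zs")
        case True
        then have "zs ! \<sigma> i = zs ! \<tau> i" using eq permute_list_nth perm by metis
        moreover have "\<sigma> i < length zs" "\<tau> i < length zs"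
          using perm True permutes_in_image[of \<sigma> "{..<length zs}" i] permutes_in_image[of \<tau> "{..<length zs}" i] by auto
        ultimately show ?thesis using assms by (simp add: nth_eq_iff_index_eq)
      next
        case False
        then show ?thesis using perm by (simp add: permutes_def)
      qed
    qed
  qed
  show "(\<lambda>\<sigma>. permute_list \<sigma> zs) ` {\<sigma>. \<sigma> permutes {..<length zs}} = permutations_of_set (set zs)"
  proof (intro equalityI subsetI)
    fix ys assume "ys \<in> permutations_of_set (set zs)"
    then have "mset ys = mset zs"
      using assms set_eq_iff_mset_eq_distinct[of ys zs] by (auto simp: permutations_of_set_def)
    then obtain \<sigma> where "\<sigma> permutes {..<length zs}" "permute_list \<sigma> zs = ys" by (rule mset_eq_permutation)
    then show "ys \<in> (\<lambda>\<sigma>. permute_list \<sigma> zs) ` {\<sigma>. \<sigma> permutes {..<length zs}}" by blast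
  qed (use assms in \<open>auto simp: permutations_of_set_def\<close>)
qed

text \<open>This links the two averages: \<open>\<Phi>\<^sub>W\<close> runs over height assignments,
  \<open>\<phi>\<^sub>W\<close> over orderings of factors.\<close>

lemma bij_betw_height_order:
  assumes X: "finite X"
  shows "bij_betw (height_order X) {H \<in> X \<rightarrow>\<^sub>E {1..card X}. bij_betw H X {1..card X}} (permutations_of_set X)"
proof (rule bij_betw_imageI)
  let ?H = "{H \<in> X \<rightarrow>\<^sub>E {1..card X}. bij_betw H X {1..card X}}"
  show "inj_on (height_order X) ?H"
  proof (rule inj_onI)
    fix H K assume H: "H \<in> ?H" and K: "K \<in> ?H" and eq: "height_order X H = height_order X K"
    show "H = K"
    proof (rule extensionalityI[of _ X])
      fix x assume x: "x \<in> X"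
      have k: "H x \<in> {1..card X}" using H x by auto
      have "inv_into X H (H x) = inv_into X K (H x)"
        using eq k by (auto simp: height_order_def simp del: upt_Suc)
      then have "x = inv_into X K (H x)" using H x by (simp add: bij_betw_def)
      moreover have "K (inv_into X K (H x)) = H x" using K k by (intro f_inv_into_f) (auto simp: bij_betw_def)
      ultimately show "H x = K x" by simp
    qed (use H K in \<open>auto simp: PiE_def\<close>)
  qed
  show "height_order X ` ?H = permutations_of_set X"
  proof (intro equalityI subsetI)
    fix ys assume "ys \<in> height_order X ` ?H"
    then obtain H where H: "bij_betw H X {1..card X}" and ys: "ys = height_order X H" by auto
    have inv: "bij_betw (inv_into X H) {1..card X} X" by (rule bij_betw_inv_into[OF H])
    have up: "set [1..<card X + 1] = {1..card X}" by (auto simp del: upt_Suc)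
    show "ys \<in> permutations_of_set X"
      using inv unfolding ys height_order_def permutations_of_set_def mem_Collect_eq set_map distinct_map up
      by (simp add: bij_betw_def del: upt_Suc)
  next
    fix ys assume "ys \<in> permutations_of_set X"
    then have ys: "set ys = X" "distinct ys" by (auto simp: permutations_of_set_def)
    then have len: "length ys = card X" by (metis distinct_card)
    have nth: "bij_betw (nth ys) {..<card X} X" using ys len by (intro bij_betw_nth) auto
    define H where "H = (\<lambda>x\<in>X. Suc (inv_into {..<card X} (nth ys) x))"
    have Hnth: "H (ys ! i) = Suc i" if "i < card X" for i
      using that nth by (auto simp: H_def bij_betw_def)
    have map: "map H ys = [1..<card X + 1]"
      by (rule nth_equalityI) (auto simp: len Hnth simp del: upt_Suc)
    have "distinct (map H ys)" unfolding map by (rule distinct_upt)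
    then have inj: "inj_on H X" using ys by (simp add: distinct_map)
    have "H ` X = {1..card X}" using arg_cong[OF map, of set] unfolding set_map ys(1)
      by (simp add: atLeastLessThanSuc_atLeastAtMost del: upt_Suc)
    then have "H \<in> ?H" using inj by (auto simp: bij_betw_def H_def)
    moreover have "height_order X H = ys" by (rule height_order_eqI[OF inj]) (use ys map in auto)
    ultimately show "ys \<in> height_order X ` ?H" by blast
  qed
qed

text \<open>\<open>c\<close> may repeat values: equal factors sit at different positions, and the
  average runs over the orderings of positions. The list chosen in \<open>symmetrize\<close> is a
  rearrangement of the factors, and a fixed permutation is absorbed by the sum over all
  permutations.\<close>

lemma symmetrize_monomial:
  fixes f :: "('e coord, 'k::field_char_0) kpoly"
  assumes X: "finite X"
  shows "symmetrize (\<Sum>x\<in>X. Poly_Mapping.single (c x) 1) f = cst (monom (1 / fact (card X)) 0) *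
    (\<Sum>H | H \<in> X \<rightarrow>\<^sub>E {1..card X} \<and> bij_betw H X {1..card X}. oper_prod (map (\<lambda>x. \<iota> (c x)) (height_order X H)) f)"
proof -
  let ?m = "\<Sum>x\<in>X. Poly_Mapping.single (c x) (1::nat)"
  let ?g = "\<lambda>ys. oper_prod (map (\<lambda>x. \<iota> (c x)) ys) f"
  define xs where "xs = (SOME xs. (\<Sum>x\<leftarrow>xs. Poly_Mapping.single x (1::nat)) = ?m)"
  have xs: "(\<Sum>x\<leftarrow>xs. Poly_Mapping.single x (1::nat)) = ?m"
    unfolding xs_def by (rule someI_ex) (rule ex_enumeration)
  obtain zs where zs: "set zs = X" "distinct zs" using finite_distinct_list[OF X] by blast
  then have len: "length zs = card X" by (metis distinct_card)
  have "?m = (\<Sum>x\<leftarrow>map c zs. Poly_Mapping.single x (1::nat))"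
    using sum_list_distinct_conv_sum_set[OF zs(2), of "\<lambda>x. Poly_Mapping.single (c x) (1::nat)"] zs(1) by (simp add: o_def)
  then have "mset xs = mset (map c zs)"
    using xs by (intro multiset_eqI) (metis lookup_sum_list_single)
  then obtain \<tau> where \<tau>: "\<tau> permutes {..<length (map c zs)}" "permute_list \<tau> (map c zs) = xs" by (rule mset_eq_permutation)
  have lenxs: "length xs = card X" using \<tau>(2) len by (metis length_map length_permute_list)
  have \<tau>': "\<tau> permutes {..<card X}" using \<tau>(1) len by simp
  have perm: "permute_list \<sigma> xs = map c (permute_list (\<tau> \<circ> \<sigma>) zs)" if "\<sigma> permutes {..<card X}" for \<sigma>
  proof -
    have "permute_list \<sigma> xs = permute_list (\<tau> \<circ> \<sigma>) (map c zs)"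
      unfolding \<tau>(2)[symmetric] by (rule permute_list_compose[symmetric]) (simp add: that len)
    also have "\<dots> = map c (permute_list (\<tau> \<circ> \<sigma>) zs)"
      by (rule permute_list_map) (simp add: permutes_compose[OF that \<tau>'] len)
    finally show ?thesis .
  qed
  have "(\<Sum>\<sigma> | \<sigma> permutes {..<card X}. oper_prod (map \<iota> (permute_list \<sigma> xs)) f)
     = (\<Sum>\<sigma> | \<sigma> permutes {..<card X}. ?g (permute_list (\<tau> \<circ> \<sigma>) zs))"
    by (rule sum.cong[OF refl]) (simp add: perm o_def)
  also have "\<dots> = (\<Sum>\<sigma> | \<sigma> permutes {..<card X}. ?g (permute_list \<sigma> zs))"
    by (rule setum_permutations_compose_left[OF \<tau>', symmetric])
  also have "\<dots> = (\<Sum>ys\<in>permutations_of_set X. ?g ys)"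
    using sum.reindex_bij_betw[OF bij_betw_permute_list[OF zs(2)], of ?g] len zs(1) by simp
  also have "\<dots> = (\<Sum>H | H \<in> X \<rightarrow>\<^sub>E {1..card X} \<and> bij_betw H X {1..card X}. ?g (height_order X H))"
    by (rule sum.reindex_bij_betw[OF bij_betw_height_order[OF X], symmetric])
  finally show ?thesis
    unfolding symmetrize_def xs_def[symmetric] Let_def lenxs by simp
qed

section \<open>Closure of the submodules involved\<close>

lemma keys_sum_subset: "(\<And>i. i \<in> I \<Longrightarrow> Poly_Mapping.keys (u i) \<subseteq> S) \<Longrightarrow> Poly_Mapping.keys (\<Sum>i\<in>I. u i) \<subseteq> S"
proof (induction I rule: infinite_finite_induct)
  case (insert i I)
  then have "Poly_Mapping.keys (u i) \<subseteq> S" "Poly_Mapping.keys (\<Sum>i\<in>I. u i) \<subseteq> S" by auto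
  then show ?case using keys_add[of "u i" "\<Sum>i\<in>I. u i"] insert by (simp add: subset_iff) blast
qed auto

lemma keys_cst_mult_subset:
  fixes u :: "'m::comm_monoid_add \<Rightarrow>\<^sub>0 'd::comm_ring_1"
  shows "Poly_Mapping.keys (cst c * u) \<subseteq> Poly_Mapping.keys u"
  by (auto simp: in_keys_iff lookup_cst_mult)

lemma keys_single_subset: "m \<in> S \<Longrightarrow> Poly_Mapping.keys (Poly_Mapping.single m c) \<subseteq> S"
  by simp

lemma rep_functions_eq: "rep_functions Q l = {u. Poly_Mapping.keys u \<subseteq> {m. Poly_Mapping.keys m \<subseteq> coords Q l}}"
  by (auto simp: rep_functions_def)

lemma sum_in_D_Q: "(\<And>i. i \<in> I \<Longrightarrow> D i \<in> D_Q Q l) \<Longrightarrow> (\<lambda>p. \<Sum>i\<in>I. D i p) \<in> D_Q Q l"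
proof (induction I rule: infinite_finite_induct)
  case (insert i I)
  then show ?case using D_Q.add[of "D i" Q l "\<lambda>p. \<Sum>i\<in>I. D i p"] by simp
\<comment> \<open>The empty sum is the zero operator, obtained as 0 times the identity.\<close>
qed (use D_Q.smult[OF D_Q.one, of 0] in simp_all)

lemma iota_in_D_Q: "c \<in> coords Q l \<Longrightarrow> \<iota> c \<in> D_Q Q l"
  by (cases c rule: \<iota>.cases) (auto simp: coords_def double_def intro: D_Q.coord D_Q.deriv[unfolded One_nat_def])

lemma oper_prod_in_D_Q: "(\<And>D. D \<in> set Ds \<Longrightarrow> D \<in> D_Q Q l) \<Longrightarrow> oper_prod Ds \<in> D_Q Q l"
proof (induction Ds)
  case (Cons D Ds)
  then have "D \<in> D_Q Q l" "oper_prod Ds \<in> D_Q Q l" by auto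
  then show ?case unfolding oper_prod_Cons by (rule D_Q.comp)
qed (simp add: D_Q.one)

lemma symmetrize_in_D_Q:
  assumes "Poly_Mapping.keys m \<subseteq> coords Q l"
  shows "(symmetrize m :: ('e, 'k::field_char_0) oper) \<in> D_Q Q l"
proof -
  define xs where "xs = (SOME xs. (\<Sum>x\<leftarrow>xs. Poly_Mapping.single x (1::nat)) = m)"
  have xs: "(\<Sum>x\<leftarrow>xs. Poly_Mapping.single x (1::nat)) = m"
    unfolding xs_def by (rule someI_ex) (rule ex_enumeration)
  have sub: "set xs \<subseteq> coords Q l"
  proof
    fix a assume "a \<in> set xs"
    then have "count (mset xs) a \<noteq> 0" by simp
    then have "a \<in> Poly_Mapping.keys m" using lookup_sum_list_single[of xs a] xs by (simp add: in_keys_iff)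
    then show "a \<in> coords Q l" using assms by blast
  qed
  have "(\<lambda>p. \<Sum>\<sigma> | \<sigma> permutes {..<length xs}. oper_prod (map \<iota> (permute_list \<sigma> xs)) p :: ('e coord, 'k) kpoly) \<in> D_Q Q l"
  proof (rule sum_in_D_Q, rule oper_prod_in_D_Q)
    fix \<sigma> D assume "\<sigma> \<in> {\<sigma>. \<sigma> permutes {..<length xs}}" "D \<in> set (map \<iota> (permute_list \<sigma> xs))"
    then have "D \<in> \<iota> ` set xs" by simp
    then show "D \<in> D_Q Q l" using sub iota_in_D_Q by blast
  qed
  then show ?thesis unfolding symmetrize_def xs_def[symmetric] Let_def by (rule D_Q.smult)
qed

lemma phi_W_in_D_Q:
  assumes "u \<in> rep_functions Q l"
  shows "\<phi>\<^sub>W u \<in> D_Q Q l"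
  unfolding \<phi>\<^sub>W_def
  by (rule sum_in_D_Q, rule D_Q.smult, rule symmetrize_in_D_Q) (use assms in \<open>auto simp: rep_functions_def\<close>)

section \<open>The assertions for a fixed quiver and dimension vector\<close>

context
  fixes Q :: "('v, 'e) pre_digraph" and l :: "'v \<Rightarrow> nat"
  assumes Q: "fin_digraph Q"
begin

interpretation Q: fin_digraph Q by (rule Q)

lemma tr_in_rep_functions:
  assumes "F \<in> symL Q"
  shows "(tr Q l F :: ('e dedge coord, 'k::field_char_0) kpoly) \<in> rep_functions Q l"
proof -
  let ?S = "{m. Poly_Mapping.keys m \<subseteq> coords Q l}"
  have "Poly_Mapping.keys (\<Prod>n\<in>#P. tr_necklace Q l n :: ('e dedge coord, 'k) kpoly) \<subseteq> ?S"
    if P: "P \<in> Poly_Mapping.keys F" for P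
  proof -
    obtain ws vs where p: "P = coll (ws, vs)" "(ws, vs) \<in> valid_pres Q"
      using assms P by (auto simp: symL_def)
    have "Poly_Mapping.keys (\<Prod>x\<in>abs_edges ws. var (pr ws x, s x, s (nxt ws x)) :: ('e dedge coord, 'k) kpoly) \<subseteq> ?S"
      if "s \<in> PiE (abs_edges ws) (\<lambda>x. {..<row_dim Q l (pr ws x)})" for s
      unfolding prod_var using coords_of_indices[OF Q.wf_digraph p(2) that]
      by (auto simp: keys_sum_single[OF finite_abs_edges, unfolded One_nat_def])
    then show ?thesis
      unfolding p(1) prod_tr_necklace_coll[OF Q.wf_digraph p(2)] cst_prod_list
      by (intro order_trans[OF keys_cst_mult_subset] keys_sum_subset)
  qed
  then show ?thesis
    unfolding rep_functions_eq tr_def mem_Collect_eq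
    by (intro keys_sum_subset order_trans[OF keys_cst_mult_subset])
qed

text \<open>The class is evaluated at the representative from the definition of
  \<open>\<Phi>\<^sub>W\<close>. For each collection both sides then become the same sum of ordered
  operator products over index assignments and height assignments, divided by N!.\<close>

lemma rho_h_Phi_W:
  fixes F :: "('v, 'e, 'k::field_char_0) nalg"
  assumes F: "F \<in> symL Q"
  shows "\<Phi>\<^sub>W Q F \<in> A_h Q \<and> \<rho>\<^sub>h Q l (\<Phi>\<^sub>W Q F) = \<phi>\<^sub>W (tr Q l F)"
proof -
  let ?n = "\<lambda>P. card (abs_edges (fst (present P)))"
  let ?a = "\<lambda>P. Polynomial.smult (1 / fact (?n P)) (Poly_Mapping.lookup F P)"
  let ?H = "\<lambda>P. heights (fst (present P))"
  define G where "G = (\<Sum>P\<in>Poly_Mapping.keys F. cst (?a P) *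
      (\<Sum>H\<in>?H P. Poly_Mapping.single (with_heights (present P) H) (1 :: 'k poly)))"
  have pres: "present P \<in> valid_pres Q" if "P \<in> Poly_Mapping.keys F" for P
    using that F present_valid[OF Q.wf_digraph] by (auto simp: symL_def)
  have G: "G \<in> free_hmod Q"
    unfolding free_hmod_def mem_Collect_eq G_def
    by (intro keys_sum_subset order_trans[OF keys_cst_mult_subset] keys_single_subset CollectI exI conjI)
      (simp_all add: pres)
  have \<Phi>: "\<Phi>\<^sub>W Q F = hcong Q `` {G}" by (simp add: \<Phi>\<^sub>W_def G_def Let_def)
  have "rho_free Q l G f = \<phi>\<^sub>W (tr Q l F) f" for f :: "('e coord, 'k) kpoly"
  proof -
    have "rho_free Q l G f = (\<Sum>P\<in>Poly_Mapping.keys F. cst (?a P) *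
        (\<Sum>H\<in>?H P. rho_basis Q l (with_heights (present P) H) f))"
      by (simp only: rho_free_eq_lin G_def lin_sum lin_cst lin_single cst_1 mult_1)
    also have "\<dots> = (\<Sum>P\<in>Poly_Mapping.keys F. cst (Poly_Mapping.lookup F P) *
        lin (\<lambda>m. symmetrize m f) (\<Prod>n\<in>#P. tr_necklace Q l n))"
    proof (rule sum.cong[OF refl])
      fix P assume P: "P \<in> Poly_Mapping.keys F"
      obtain ws vs where p: "present P = (ws, vs)" by (cases "present P")
      then have P_eq: "P = coll (ws, vs)" using coll_present[of P] by simp
      have valid: "(ws, vs) \<in> valid_pres Q" using pres[OF P] p by simp
      let ?X = "abs_edges ws" let ?N = "cst (\<Prod>v\<leftarrow>vs. of_nat (l v)) :: ('e coord, 'k) kpoly"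
      let ?S = "PiE ?X (\<lambda>x. {..<row_dim Q l (pr ws x)})"
      let ?o = "\<lambda>s H. oper_prod (map (\<lambda>x. \<iota> (pr ws x, s x, s (nxt ws x))) (height_order ?X H)) f"
      let ?q = "cst (monom (1 / fact (card ?X)) 0) :: ('e coord, 'k) kpoly"
      have "rho_basis Q l (with_heights (ws, vs) H) f = ?N * (\<Sum>s\<in>?S. ?o s H)" if "H \<in> heights ws" for H
        by (rule rho_basis_with_heights) (use that in \<open>simp add: heights_def\<close>)
      then have "(\<Sum>H\<in>heights ws. rho_basis Q l (with_heights (ws, vs) H) f) = (\<Sum>H\<in>heights ws. ?N * (\<Sum>s\<in>?S. ?o s H))"
        by (rule sum.cong[OF refl])
      also have "\<dots> = ?N * (\<Sum>s\<in>?S. \<Sum>H\<in>heights ws. ?o s H)"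
        unfolding sum_distrib_left[symmetric] by (rule arg_cong[OF sum.swap])
      finally have rho: "(\<Sum>H\<in>heights ws. rho_basis Q l (with_heights (ws, vs) H) f)
        = ?N * (\<Sum>s\<in>?S. \<Sum>H\<in>heights ws. ?o s H)" .
      have "lin (\<lambda>m. symmetrize m f) (\<Prod>n\<in>#P. tr_necklace Q l n)
        = ?N * (\<Sum>s\<in>?S. symmetrize (\<Sum>x\<in>?X. Poly_Mapping.single (pr ws x, s x, s (nxt ws x)) 1) f)"
        unfolding P_eq prod_tr_necklace_coll[OF Q.wf_digraph valid] cst_prod_list
        by (simp only: lin_cst lin_sum prod_var lin_single cst_1 mult_1)
      also have "\<dots> = ?N * (\<Sum>s\<in>?S. ?q * (\<Sum>H\<in>heights ws. ?o s H))"
        unfolding symmetrize_monomial[OF finite_abs_edges] heights_def ..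
      also have "\<dots> = ?q * (\<Sum>H\<in>heights ws. rho_basis Q l (with_heights (ws, vs) H) f)"
        unfolding rho by (simp only: sum_distrib_left[symmetric] mult.left_commute)
      finally have sym: "lin (\<lambda>m. symmetrize m f) (\<Prod>n\<in>#P. tr_necklace Q l n)
        = ?q * (\<Sum>H\<in>heights ws. rho_basis Q l (with_heights (ws, vs) H) f)" .
      have coef: "cst (Poly_Mapping.lookup F P) * ?q = cst (Polynomial.smult (1 / fact (card ?X)) (Poly_Mapping.lookup F P))"
        by (simp add: cst_mult[symmetric] monom_0)
      show "cst (?a P) * (\<Sum>H\<in>?H P. rho_basis Q l (with_heights (present P) H) f)
        = cst (Poly_Mapping.lookup F P) * lin (\<lambda>m. symmetrize m f) (\<Prod>n\<in>#P. tr_necklace Q l n)"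
        unfolding sym p fst_conv mult.assoc[symmetric] coef ..
    qed
    also have "\<dots> = lin (\<lambda>m. symmetrize m f) (tr Q l F)"
      by (simp only: tr_def lin_sum lin_cst)
    finally show ?thesis by (simp only: \<phi>\<^sub>W_def lin_def)
  qed
  then have "rho_free Q l G = \<phi>\<^sub>W (tr Q l F)" by (rule ext)
  then show ?thesis
    unfolding \<Phi> A_h_def using rho_h_class[OF Q.wf_digraph G] G by (simp only: quotientI simp_thms)
qed

lemma tr_ring_hom:
  "(tr Q l :: ('v, 'e, 'k::field_char_0) nalg \<Rightarrow> _) \<in> ring_hom (necklace_algebra Q) (moyal_algebra Q l)"
proof (rule ring_hom_memI)
  show "tr Q l F \<in> carrier (moyal_algebra Q l)" if "F \<in> carrier (necklace_algebra Q)" for F :: "('v, 'e, 'k) nalg"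
    using tr_in_rep_functions that by (simp add: necklace_algebra_def moyal_algebra_def)
  show "tr Q l (F \<otimes>\<^bsub>necklace_algebra Q\<^esub> G) = tr Q l F \<otimes>\<^bsub>moyal_algebra Q l\<^esub> tr Q l G"
    if "F \<in> carrier (necklace_algebra Q)" "G \<in> carrier (necklace_algebra Q)" for F G :: "('v, 'e, 'k) nalg"
    using tr_star[OF Q] that by (simp add: necklace_algebra_def moyal_algebra_def)
  show "tr Q l (F \<oplus>\<^bsub>necklace_algebra Q\<^esub> G) = tr Q l F \<oplus>\<^bsub>moyal_algebra Q l\<^esub> tr Q l G" for F G :: "('v, 'e, 'k) nalg"
    unfolding necklace_algebra_def moyal_algebra_def by (simp add: tr_def lin_add flip: lin_def)
  show "tr Q l \<one>\<^bsub>necklace_algebra Q\<^esub> = (\<one>\<^bsub>moyal_algebra Q l\<^esub> :: ('e dedge coord, 'k) kpoly)"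
    by (simp add: necklace_algebra_def moyal_algebra_def tr_def)
qed

end

theorem mainTheorem5:
  fixes Q :: "('v, 'e) pre_digraph"
    and l :: "'v \<Rightarrow> nat"
  assumes "fin_digraph Q"
  shows "(\<forall>F :: ('v, 'e, 'k::field_char_0) nalg. F \<in> symL Q \<longrightarrow>
            \<Phi>\<^sub>W Q F \<in> A_h Q \<and> \<phi>\<^sub>W (tr Q l F) \<in> D_Q Q l \<and>
            \<rho>\<^sub>h Q l (\<Phi>\<^sub>W Q F) = \<phi>\<^sub>W (tr Q l F))
       \<and> (tr Q l :: ('v, 'e, 'k) nalg \<Rightarrow> _)
            \<in> ring_hom (necklace_algebra Q) (moyal_algebra Q l)
       \<and> (\<forall>(c :: 'k poly) (F :: ('v, 'e, 'k) nalg). F \<in> carrier (necklace_algebra Q) \<longrightarrow>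
            tr Q l (c \<odot>\<^bsub>necklace_algebra Q\<^esub> F) = c \<odot>\<^bsub>moyal_algebra Q l\<^esub> tr Q l F)"
proof (intro conjI allI impI)
  fix F :: "('v, 'e, 'k) nalg" assume F: "F \<in> symL Q"
  show "\<Phi>\<^sub>W Q F \<in> A_h Q" "\<rho>\<^sub>h Q l (\<Phi>\<^sub>W Q F) = \<phi>\<^sub>W (tr Q l F)"
    using rho_h_Phi_W[OF assms F] by simp_all
  show "\<phi>\<^sub>W (tr Q l F) \<in> D_Q Q l"
    by (rule phi_W_in_D_Q) (rule tr_in_rep_functions[OF assms F])
next
  show "(tr Q l :: ('v, 'e, 'k) nalg \<Rightarrow> _) \<in> ring_hom (necklace_algebra Q) (moyal_algebra Q l)"
    by (rule tr_ring_hom[OF assms])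
next
  fix c :: "'k poly" and F :: "('v, 'e, 'k) nalg"
  show "tr Q l (c \<odot>\<^bsub>necklace_algebra Q\<^esub> F) = c \<odot>\<^bsub>moyal_algebra Q l\<^esub> tr Q l F"
    unfolding necklace_algebra_def moyal_algebra_def by (simp add: tr_def lin_cst flip: lin_def)
qed

end
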